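(* The following decision problem is NP-complete: given a bipartite graph $G$ and an integer $d$, decide whether $\delta_{loc}(G) \leq d$.
   Context: All graphs are finite, simple and undirected. The local complementation of a graph $G$ at a vertex $u$ is the graph $G * u = G \,\Delta\, K_{\mathcal{N}(u)}$, i.e. the edge set is replaced by its symmetric difference with the edge set of the complete graph on the neighborhood $\mathcal{N}(u)$ of $u$. Two graphs are locally equivalent, $G \equiv_{LC} G'$, if one can be obtained from the other by a finite sequence of local complementations. The local minimum degree is $\delta_{loc}(G) = \min\{\delta(G') : G' \equiv_{LC} G\}$, where $\delta(G')$ denotes the minimum degree of $G'$. *)

theory Defs
  imports Main "HOL-Computational_Algebra.Polynomial"
begin

section \<open>Finite simple graphs and local complementation\<close>

record 'a graph =
  verts :: "'a set"
  edges :: "'a set set"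

definition simple_graph :: "'a graph \<Rightarrow> bool" where
  "simple_graph G \<longleftrightarrow> finite (verts G) \<and>
     (\<forall>e \<in> edges G. \<exists>u \<in> verts G. \<exists>v \<in> verts G. u \<noteq> v \<and> e = {u, v})"

definition bipartite :: "'a graph \<Rightarrow> bool" where
  "bipartite G \<longleftrightarrow> (\<exists>A B. A \<union> B = verts G \<and> A \<inter> B = {} \<and>
     (\<forall>e \<in> edges G. \<exists>a \<in> A. \<exists>b \<in> B. e = {a, b}))"

definition neighborhood :: "'a graph \<Rightarrow> 'a \<Rightarrow> 'a set" where
  "neighborhood G u = {v. {u, v} \<in> edges G}"

definition degree :: "'a graph \<Rightarrow> 'a \<Rightarrow> nat" where
  "degree G u = card (neighborhood G u)"

definition min_degree :: "'a graph \<Rightarrow> nat" where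
  "min_degree G = Min (degree G ` verts G)"

definition complete_edges :: "'a set \<Rightarrow> 'a set set" where
  "complete_edges S = {{v, w} | v w. v \<in> S \<and> w \<in> S \<and> v \<noteq> w}"

definition local_complement :: "'a graph \<Rightarrow> 'a \<Rightarrow> 'a graph" where
  "local_complement G u =
     G\<lparr>edges := sym_diff (edges G) (complete_edges (neighborhood G u))\<rparr>"

definition local_step :: "'a graph \<Rightarrow> 'a graph \<Rightarrow> bool" where
  "local_step G G' \<longleftrightarrow> (\<exists>u \<in> verts G. G' = local_complement G u)"

definition locally_equivalent :: "'a graph \<Rightarrow> 'a graph \<Rightarrow> bool" where
  "locally_equivalent = local_step\<^sup>*\<^sup>*"

definition local_min_degree :: "'a graph \<Rightarrow> nat" where
  "local_min_degree G = Min {min_degree G' | G'. locally_equivalent G G'}"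


section \<open>Deterministic multitape Turing machines\<close>

text \<open>
  Tapes are infinite in both directions. A machine has states \<open>0, \<dots>, num_states - 1\<close> and tape
  symbols \<open>0, \<dots>, num_symbols - 1\<close>. State \<open>0\<close> is the start state and state \<open>1\<close> is the halting
  state. Symbol \<open>0\<close> is the blank, \<open>1\<close> and \<open>2\<close> are the bits, and \<open>3\<close> is a separator. Tape \<open>0\<close>
  holds the input and tape \<open>1\<close> the output, both starting at cell \<open>0\<close>.
\<close>

datatype move = Left | Stay | Right

fun shift :: "move \<Rightarrow> int" where
  "shift Left = - 1"
| "shift Stay = 0"
| "shift Right = 1"

record tm =
  num_tapes :: nat
  num_states :: nat
  num_symbols :: nat
  trans :: "nat \<Rightarrow> nat list \<Rightarrow> nat \<times> (nat \<times> move) list"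

definition wf_tm :: "tm \<Rightarrow> bool" where
  "wf_tm M \<longleftrightarrow> num_tapes M \<ge> 2 \<and> num_states M \<ge> 2 \<and> num_symbols M \<ge> 4 \<and>
     (\<forall>q rs. q < num_states M \<and> length rs = num_tapes M \<and> (\<forall>r \<in> set rs. r < num_symbols M) \<longrightarrow>
        (case trans M q rs of (q', acts) \<Rightarrow>
           q' < num_states M \<and> length acts = num_tapes M \<and>
           (\<forall>(a, m) \<in> set acts. a < num_symbols M)))"

text \<open>A tape is its contents together with the position of its head.\<close>

type_synonym tape = "(int \<Rightarrow> nat) \<times> int"
type_synonym config = "nat \<times> tape list"

fun act :: "tape \<Rightarrow> nat \<times> move \<Rightarrow> tape" where
  "act (t, h) (a, m) = (t(h := a), h + shift m)"

definition step :: "tm \<Rightarrow> config \<Rightarrow> config" where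
  "step M = (\<lambda>(q, ts).
     if q = 1 then (q, ts)
     else case trans M q (map (\<lambda>(t, h). t h) ts) of (q', acts) \<Rightarrow> (q', map2 act ts acts))"

definition written :: "nat list \<Rightarrow> int \<Rightarrow> nat" where
  "written w = (\<lambda>i. if 0 \<le> i \<and> i < int (length w) then w ! nat i else 0)"

definition init_config :: "tm \<Rightarrow> nat list \<Rightarrow> config" where
  "init_config M w = (0, (written w, 0) # replicate (num_tapes M - 1) (written [], 0))"

text \<open>The output is read from cell \<open>0\<close> of tape \<open>1\<close> up to the first blank.\<close>

definition outputs_within :: "tm \<Rightarrow> nat list \<Rightarrow> nat \<Rightarrow> nat list \<Rightarrow> bool" where
  "outputs_within M w T v \<longleftrightarrow>
     (case (step M ^^ T) (init_config M w) of (q, ts) \<Rightarrow>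
        q = 1 \<and>
        (\<forall>i < length v. fst (ts ! 1) (int i) = v ! i) \<and> fst (ts ! 1) (int (length v)) = 0)"

text \<open>
  \<open>polytime e f\<close>: some machine computes \<open>f a\<close> from the word \<open>e a\<close>, for every \<open>a\<close>, in time
  polynomial in the length of \<open>e a\<close>.
\<close>

definition polytime :: "('a \<Rightarrow> nat list) \<Rightarrow> ('a \<Rightarrow> nat list) \<Rightarrow> bool" where
  "polytime e f \<longleftrightarrow> (\<exists>M (p :: nat poly). wf_tm M \<and>
     (\<forall>a. outputs_within M (e a) (poly p (length (e a))) (f a)))"


section \<open>NP-completeness\<close>

definition bits :: "bool list \<Rightarrow> nat list" where
  "bits = map (\<lambda>b. if b then 2 else 1)"

definition pair :: "bool list \<times> bool list \<Rightarrow> nat list" where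
  "pair = (\<lambda>(x, y). bits x @ [3] @ bits y)"

text \<open>Languages over the binary alphabet.\<close>

type_synonym language = "bool list set"

definition polytime_fun :: "(bool list \<Rightarrow> bool list) \<Rightarrow> bool" where
  "polytime_fun f \<longleftrightarrow> polytime bits (\<lambda>x. bits (f x))"

definition polytime_rel :: "(bool list \<Rightarrow> bool list \<Rightarrow> bool) \<Rightarrow> bool" where
  "polytime_rel R \<longleftrightarrow> polytime pair (\<lambda>(x, y). bits [R x y])"

definition in_NP :: "language \<Rightarrow> bool" where
  "in_NP L \<longleftrightarrow> (\<exists>R (p :: nat poly). polytime_rel R \<and>
     (\<forall>x. x \<in> L \<longleftrightarrow> (\<exists>y. length y \<le> poly p (length x) \<and> R x y)))"

definition polytime_reducible :: "language \<Rightarrow> language \<Rightarrow> bool" where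
  "polytime_reducible L L' \<longleftrightarrow> (\<exists>f. polytime_fun f \<and> (\<forall>x. x \<in> L \<longleftrightarrow> f x \<in> L'))"

definition NP_complete :: "language \<Rightarrow> bool" where
  "NP_complete L \<longleftrightarrow> in_NP L \<and> (\<forall>L'. in_NP L' \<longrightarrow> polytime_reducible L' L)"


section \<open>Encoding of instances\<close>

text \<open>
  Meant for graphs with vertex set \<open>{..<n}\<close>: \<open>n\<close> in unary, terminated by \<open>False\<close>, followed by the
  rows of the adjacency matrix.
\<close>

definition encode_graph :: "nat graph \<Rightarrow> bool list" where
  "encode_graph G = (let n = card (verts G) in
     replicate n True @ [False] @
     concat (map (\<lambda>i. map (\<lambda>j. {i, j} \<in> edges G) [0..<n]) [0..<n]))"

text \<open>Binary digits without trailing zeros, least significant first.\<close>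

fun encode_nat :: "nat \<Rightarrow> bool list" where
  "encode_nat n = (if n = 0 then [] else odd n # encode_nat (n div 2))"

declare encode_nat.simps [simp del]

definition encode_int :: "int \<Rightarrow> bool list" where
  "encode_int d = (d < 0) # encode_nat (nat \<bar>d\<bar>)"

definition encode_instance :: "nat graph \<Rightarrow> int \<Rightarrow> bool list" where
  "encode_instance G d = encode_graph G @ encode_int d"

end

theory Submission
  imports Defs "HOL-Number_Theory.Cong"
begin

text \<open>
  Let \<open>Odd(D)\<close> be the set of vertices with oddly many neighbours in \<open>D\<close>. Local complementation
  preserves the family of the sets \<open>D \<union> Odd(D)\<close>, and the smallest such set with \<open>D\<close> nonempty has
  \<open>\<delta>\<^sub>l\<^sub>o\<^sub>c(G) + 1\<close> elements. So \<open>D\<close> together with a bipartition is a certificate.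

  For hardness, a polynomial-time verification is first written as a system of quadratic equations
  over the two-element field: the entries of the tableau are gates, each of which is a sum of
  products of two gates. Replacing the products \<open>y\<^sub>i y\<^sub>j\<close> by the entries of a symmetric matrix \<open>Y\<close>
  makes the system linear, and its solutions are the nonzero feasible \<open>Y\<close> of rank one. If \<open>E\<close>
  generates a code whose nonzero codewords all have nearly the same weight \<open>w\<close>, then \<open>E Y E\<^sup>T\<close> has
  weight about \<open>w\<^sup>2\<close> for \<open>Y\<close> of rank one, but at least about \<open>3/2 w\<^sup>2\<close> for \<open>Y\<close> of larger rank.
  Together with many copies of the linear constraints as further parity checks, this turns
  solvability into a question about the minimum distance of a binary code. For \<open>E\<close>, hashing isolates
  an element of any given set at some level, a Hadamard code spreads the resulting bits, and adding
  independent copies reduces the bias.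

  In a bipartite graph with biadjacency matrix \<open>A\<close>, the sets \<open>D\<close> inside one side correspond to the
  codewords generated by \<open>(I | A)\<close>, and those inside the other side to the dual code. Replacing each
  column vertex by a point of its own point-line incidence graph without cycles of length four makes
  \<open>D \<union> Odd(D)\<close> large as soon as \<open>D\<close> contains a vertex outside the rows, so only the intended code
  matters.
\<close>

section \<open>A while language for Turing machines\<close>

text \<open>The argument closes by a comparison of constants. Write \<open>L\<close> for
  \<open>code_len n\<close>; nonzero codewords weigh between \<open>9/20 L\<close> and
  \<open>1/2 L\<close>, so rank one gives at most \<open>L^2/4 = 200/800 L^2\<close>. Over the
  two-element field, rank above one means two distinct nonzero columns. Their codewords
  \<open>A\<close>, \<open>B\<close> satisfy \<open>|A| + |B| + |A + B| = 2 |A \<union> B|\<close>,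
  so at least \<open>27/40 L\<close> positions see one of them, and each such position contributes a
  nonzero codeword: \<open>243/800 L^2\<close> in total. The surplus \<open>43/800 L^2\<close> must
  beat \<open>n^2\<close>, because the graph also counts the entries of the matrix itself. The
  reduction being deterministic, the code must be explicit and of polynomial length. A Hadamard code
  of dimension \<open>n\<close> would be perfectly balanced but exponentially long; hashing leaves
  only logarithmically many bits for it to spread, at the price of a bias that the independent
  copies then shrink. All quantities are polynomial in the input, so the machine programs compute in
  unary; only the bound \<open>d\<close> of an instance is binary, and the verifier truncates it at
  \<open>n\<close>.\<close>

datatype com =
    Do "nat list \<Rightarrow> (nat \<times> move) list"
  | Seq com com (infixr \<open>;;\<close> 60)
  | While "nat list \<Rightarrow> bool" com

fun csize :: "com \<Rightarrow> nat" where
  "csize (Do f) = 1"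
| "csize (a ;; b) = csize a + csize b"
| "csize (While b c) = Suc (csize c)"

definition idle :: "nat list \<Rightarrow> (nat \<times> move) list" where
  "idle rs = map (\<lambda>r. (r, Stay)) rs"

text \<open>The code of a command occupies the \<open>csize\<close> states from \<open>s\<close> on
  and leaves to state \<open>x\<close>. A loop body leaves to the test of its loop.\<close>

fun ctrans :: "com \<Rightarrow> nat \<Rightarrow> nat \<Rightarrow> nat \<Rightarrow> nat list \<Rightarrow> nat \<times> (nat \<times> move) list" where
  "ctrans (Do f) s x q rs = (x, f rs)"
| "ctrans (a ;; b) s x q rs =
     (if q < s + csize a then ctrans a s (s + csize a) q rs else ctrans b (s + csize a) x q rs)"
| "ctrans (While b c) s x q rs =
     (if q = s then (if b rs then Suc s else x, idle rs) else ctrans c (Suc s) s q rs)"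

definition wfa :: "(nat list \<Rightarrow> (nat \<times> move) list) \<Rightarrow> bool" where
  "wfa f \<longleftrightarrow> (\<forall>rs. (\<forall>r \<in> set rs. r < 4) \<longrightarrow> length (f rs) = length rs \<and> (\<forall>(a, m) \<in> set (f rs). a < 4))"

fun wfc :: "com \<Rightarrow> bool" where
  "wfc (Do f) \<longleftrightarrow> wfa f"
| "wfc (a ;; b) \<longleftrightarrow> wfc a \<and> wfc b"
| "wfc (While b c) \<longleftrightarrow> wfc c"

definition reads :: "tape list \<Rightarrow> nat list" where
  "reads ts = map (\<lambda>(t, h). t h) ts"

inductive run :: "com \<Rightarrow> tape list \<Rightarrow> nat \<Rightarrow> tape list \<Rightarrow> bool" where
  run_Do: "run (Do f) ts 1 (map2 act ts (f (reads ts)))"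
| run_Seq: "run a ts n ts' \<Longrightarrow> run b ts' m ts'' \<Longrightarrow> run (a ;; b) ts (n + m) ts''"
| run_WhileF: "\<not> b (reads ts) \<Longrightarrow> run (While b c) ts 1 ts"
| run_WhileT: "b (reads ts) \<Longrightarrow> run c ts n ts' \<Longrightarrow> run (While b c) ts' m ts''
    \<Longrightarrow> run (While b c) ts (Suc (n + m)) ts''"

lemma csize_pos: "0 < csize c"
  by (induction c) auto

lemma act_idle: "map2 act ts (idle (reads ts)) = ts"
proof -
  have "act x ((case x of (t, h) \<Rightarrow> t h), Stay) = x" for x
    by (cases x) auto
  then show ?thesis
    by (induction ts) (auto simp: idle_def reads_def)
qed

lemma ctrans_wf:
  assumes "wfc c" "s \<le> q" "q < s + csize c" "\<forall>r \<in> set rs. r < 4" "s + csize c \<le> B" "x < B"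
  shows "fst (ctrans c s x q rs) < B \<and> length (snd (ctrans c s x q rs)) = length rs \<and>
    (\<forall>(a, m) \<in> set (snd (ctrans c s x q rs)). a < 4)"
  using assms
proof (induction c arbitrary: s x)
  case (Do f)
  then show ?case by (simp add: wfa_def)
next
  case (Seq c1 c2)
  show ?case
  proof (cases "q < s + csize c1")
    case True
    then show ?thesis using Seq.prems Seq.IH(1)[of s "s + csize c1"] csize_pos[of c2] by simp
  next
    case False
    then show ?thesis using Seq.prems Seq.IH(2)[of "s + csize c1" x] by simp
  qed
next
  case (While b c)
  show ?case
  proof (cases "q = s")
    case True
    then show ?thesis using While.prems csize_pos[of c] by (auto simp: idle_def)
  next
    case False
    then show ?thesis using While.prems While.IH[of "Suc s" s] by auto
  qed
qed

text \<open>\<open>2 \<le> s\<close> keeps the code away from the halting state \<open>1\<close>,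
  where \<open>step\<close> ignores the transition function.\<close>

lemma run_steps:
  assumes "run c ts n ts'" "2 \<le> s"
    "\<And>q rs. s \<le> q \<Longrightarrow> q < s + csize c \<Longrightarrow> trans M q rs = ctrans c s x q rs"
  shows "(step M ^^ n) (s, ts) = (x, ts')"
  using assms
proof (induction arbitrary: s x)
  case (run_Do f ts)
  then show ?case by (auto simp: step_def reads_def[symmetric] case_prod_beta)
next
  case (run_Seq a ts n ts' b m ts'')
  have 1: "(step M ^^ n) (s, ts) = (s + csize a, ts')"
    by (rule run_Seq.IH(1)) (use run_Seq.prems in auto)
  have 2: "(step M ^^ m) (s + csize a, ts') = (x, ts'')"
    by (rule run_Seq.IH(2)) (use run_Seq.prems in auto)
  show ?case
    using 1 2 funpow_add[of m n "step M"] by (simp add: add.commute)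
next
  case (run_WhileF b ts c)
  then show ?case using act_idle[of ts] by (auto simp: step_def reads_def[symmetric])
next
  case (run_WhileT b ts c n ts' m ts'')
  have 0: "step M (s, ts) = (Suc s, ts)"
    using run_WhileT act_idle[of ts] by (auto simp: step_def reads_def[symmetric])
  have 1: "(step M ^^ n) (Suc s, ts) = (s, ts')"
    by (rule run_WhileT.IH(1)) (use run_WhileT.prems in auto)
  have 2: "(step M ^^ m) (s, ts') = (x, ts'')"
    by (rule run_WhileT.IH(2)) (use run_WhileT.prems in auto)
  have "(step M ^^ Suc (n + m)) (s, ts) = (step M ^^ (m + n)) (step M (s, ts))"
    by (simp add: funpow_swap1 add.commute)
  then show ?case
    using 0 1 2 by (simp add: funpow_add)
qed

text \<open>State \<open>0\<close> only jumps to the code, which starts at state \<open>2\<close>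
  and leaves to the halting state. Besides the input and output tapes there are \<open>K\<close>
  register tapes.\<close>

definition machine :: "nat \<Rightarrow> com \<Rightarrow> tm" where
  "machine K c = \<lparr>num_tapes = K + 2, num_states = csize c + 2, num_symbols = 4,
     trans = (\<lambda>q rs. if q = 0 then (2, idle rs) else if q = 1 then (1, idle rs)
       else ctrans c 2 1 q rs)\<rparr>"

lemma wf_machine:
  assumes "wfc c"
  shows "wf_tm (machine K c)"
proof -
  have "fst (trans (machine K c) q rs) < csize c + 2 \<and>
      length (snd (trans (machine K c) q rs)) = length rs \<and>
      (\<forall>(a, m) \<in> set (snd (trans (machine K c) q rs)). a < 4)"
    if "q < csize c + 2" "\<forall>r \<in> set rs. r < 4" for q rs
  proof (cases "q \<le> 1")
    case True
    then show ?thesis using that csize_pos[of c] by (auto simp: machine_def idle_def)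
  next
    case False
    then show ?thesis
      using ctrans_wf[of c 2 q rs "csize c + 2" 1] that assms by (simp add: machine_def)
  qed
  moreover have "num_tapes (machine K c) = K + 2" "num_states (machine K c) = csize c + 2"
      "num_symbols (machine K c) = 4"
    by (simp_all add: machine_def)
  ultimately show ?thesis
    unfolding wf_tm_def case_prod_beta by auto
qed

lemma halted: "(step M ^^ n) (1, ts) = (1, ts)"
  by (induction n) (auto simp: step_def)

lemma machine_run:
  assumes "run c ts n ts'" "n < T"
  shows "(step (machine K c) ^^ T) (0, ts) = (1, ts')"
proof -
  \<comment> \<open>The additional step is the jump out of state \<open>0\<close>; the remaining
    \<open>r\<close> steps idle in the halting state.\<close>
  obtain r where T: "T = r + (n + 1)"
    using assms(2) by (metis Suc_eq_plus1 add.commute less_imp_Suc_add add_Suc_right)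
  have 0: "step (machine K c) (0, ts) = (2, ts)"
    using act_idle[of ts] by (auto simp: machine_def step_def reads_def[symmetric])
  have 1: "(step (machine K c) ^^ n) (2, ts) = (1, ts')"
    by (rule run_steps[OF assms(1)]) (auto simp: machine_def)
  have "(step (machine K c) ^^ (n + 1)) (0, ts) = (1, ts')"
    using 0 1 by (simp only: funpow_add o_apply) simp
  then show ?thesis unfolding T using halted by (simp only: funpow_add o_apply)
qed

definition rle :: "com \<Rightarrow> tape list \<Rightarrow> nat \<Rightarrow> tape list \<Rightarrow> bool" where
  "rle c ts t ts' \<longleftrightarrow> (\<exists>n \<le> t. run c ts n ts')"

lemma rle_mono: "rle c ts t ts' \<Longrightarrow> t \<le> u \<Longrightarrow> rle c ts u ts'"
  unfolding rle_def using le_trans by blast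

lemma rle_Seq: "rle a ts t ts' \<Longrightarrow> rle b ts' u ts'' \<Longrightarrow> rle (a ;; b) ts (t + u) ts''"
  unfolding rle_def using run_Seq add_mono by blast

text \<open>In place of an invariant, \<open>\<sigma> i\<close> names the configuration after
  \<open>i\<close> rounds; \<open>t\<close> bounds every round uniformly.\<close>

lemma rle_While:
  assumes "\<And>i. i < n \<Longrightarrow> b (reads (\<sigma> i))" "\<And>i. i < n \<Longrightarrow> rle c (\<sigma> i) t (\<sigma> (Suc i))"
    "\<not> b (reads (\<sigma> n))"
  shows "rle (While b c) (\<sigma> 0) (n * (t + 1) + 1) (\<sigma> n)"
  using assms
proof (induction n arbitrary: \<sigma>)
  case 0
  then show ?case unfolding rle_def using run_WhileF by force
next
  case (Suc n)
  have "rle (While b c) (\<sigma> (Suc 0)) (n * (t + 1) + 1) (\<sigma> (Suc n))"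
    using Suc.IH[of "\<lambda>i. \<sigma> (Suc i)"] Suc.prems by simp
  then obtain m where m: "m \<le> n * (t + 1) + 1" "run (While b c) (\<sigma> (Suc 0)) m (\<sigma> (Suc n))"
    by (auto simp: rle_def)
  obtain k where k: "k \<le> t" "run c (\<sigma> 0) k (\<sigma> (Suc 0))"
    using Suc.prems(2)[of 0] by (auto simp: rle_def)
  have "run (While b c) (\<sigma> 0) (Suc (k + m)) (\<sigma> (Suc n))"
    using run_WhileT[OF _ k(2) m(2)] Suc.prems(1) by simp
  then show ?case unfolding rle_def using k(1) m(1) by (intro exI[of _ "Suc (k + m)"]) auto
qed

section \<open>Unary registers on tapes\<close>

definition mark :: "int \<Rightarrow> nat" where
  "mark i = (if i = 0 then 3 else 0)"

text \<open>A register holds its value as a head position; the head never leaves the nonnegative cells,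
  and the mark in cell \<open>0\<close> is what the zero test reads.\<close>

definition conc :: "nat \<Rightarrow> nat list \<Rightarrow> nat \<Rightarrow> (nat \<Rightarrow> nat) \<Rightarrow> nat list \<Rightarrow> tape list" where
  "conc K w h e out =
     (written w, int h) # (written out, int (length out)) # map (\<lambda>r. (mark, int (e r))) [0..<K]"

definition moves :: "(nat list \<Rightarrow> nat \<Rightarrow> move) \<Rightarrow> nat list \<Rightarrow> (nat \<times> move) list" where
  "moves g rs = map (\<lambda>i. (rs ! i, g rs i)) [0..<length rs]"

lemma wfa_moves: "wfa (moves g)"
  by (auto simp: wfa_def moves_def)

lemma reads_conc: "reads (conc K w h e out) =
    written w (int h) # 0 # map (\<lambda>r. mark (int (e r))) [0..<K]"
  by (simp add: reads_def conc_def written_def)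

lemma length_reads: "length (reads ts) = length ts"
  by (simp add: reads_def)

lemma map2_act_moves:
  "map2 act ts (moves g (reads ts)) =
     map (\<lambda>i. (fst (ts ! i), snd (ts ! i) + shift (g (reads ts) i))) [0..<length ts]"
proof -
  have "act x (case x of (t, h) \<Rightarrow> t h, m) = (fst x, snd x + shift m)" for x m
    by (cases x) auto
  then show ?thesis
    by (intro nth_equalityI) (auto simp: moves_def reads_def)
qed

lemma index_cases:
  fixes i K :: nat
  assumes "i < K + 2"
  obtains "i = 0" | "i = 1" | r where "i = r + 2" "r < K"
proof (cases "i < 2")
  case True
  then show ?thesis using that(1,2) by linarith
next
  case False
  then show ?thesis using that(3)[of "i - 2"] assms by simp
qed

lemma rle_moves:
  assumes "\<And>rs. rs = reads (conc K w h e out) \<Longrightarrow>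
     int h' = int h + shift (g rs 0) \<and> g rs 1 = Stay \<and>
     (\<forall>r < K. int (e' r) = int (e r) + shift (g rs (r + 2)))"
  shows "rle (Do (moves g)) (conc K w h e out) 1 (conc K w h' e' out)"
proof -
  let ?C = "conc K w h e out"
  have "(fst (?C ! i), snd (?C ! i) + shift (g (reads ?C) i)) = conc K w h' e' out ! i"
    if i: "i < K + 2" for i
  proof -
    from i show ?thesis
      using assms[OF refl] by (cases rule: index_cases) (simp_all add: conc_def)
  qed
  moreover have "length ?C = K + 2" "length (conc K w h' e' out) = K + 2"
    by (simp_all add: conc_def)
  ultimately have "map2 act ?C (moves g (reads ?C)) = conc K w h' e' out"
    unfolding map2_act_moves by (intro nth_equalityI) (simp_all del: upt_Suc)
  then show ?thesis
    unfolding rle_def using run_Do[of "moves g" ?C] by (metis order_refl)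
qed

definition nz :: "nat \<Rightarrow> nat list \<Rightarrow> bool" where
  "nz r rs \<longleftrightarrow> rs ! (r + 2) \<noteq> 3"

lemma nz_conc: "r < K \<Longrightarrow> nz r (reads (conc K w h e out)) \<longleftrightarrow> e r \<noteq> 0"
  by (simp add: nz_def reads_conc mark_def)

text \<open>Empties register \<open>r\<close> into all registers of \<open>L\<close> at once while
  the input head moves along. With \<open>L\<close> empty it clears a register, and with
  \<open>m = Right\<close> or \<open>m = Left\<close> it places the input head or brings it
  back.\<close>

definition tr :: "nat \<Rightarrow> nat set \<Rightarrow> move \<Rightarrow> com" where
  "tr r L m = While (nz r) (Do (moves (\<lambda>rs i. if i = 0 then m else if i = 1 then Stay
     else if i = r + 2 then Left else if i - 2 \<in> L then Right else Stay)))"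

lemma wfc_tr: "wfc (tr r L m)"
  by (simp add: tr_def wfa_moves)

lemma rle_tr:
  assumes "r < K" "r \<notin> L" "m = Left \<Longrightarrow> e r \<le> h"
  shows "rle (tr r L m) (conc K w h e out) (e r * 2 + 1)
    (conc K w (nat (int h + shift m * int (e r)))
      (\<lambda>i. if i = r then 0 else if i \<in> L then e i + e r else e i) out)"
proof -
  define \<sigma> where "\<sigma> k = conc K w (nat (int h + shift m * int k))
      (\<lambda>i. if i = r then e r - k else if i \<in> L then e i + k else e i) out" for k
  have h: "0 \<le> int h + shift m * int k" if "k \<le> e r" for k
    using assms(3) that by (cases m) auto
  have "rle (While (nz r) (Do (moves (\<lambda>rs i. if i = 0 then m else if i = 1 then Stay
     else if i = r + 2 then Left else if i - 2 \<in> L then Right else Stay))))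
      (\<sigma> 0) (e r * (1 + 1) + 1) (\<sigma> (e r))"
  proof (rule rle_While)
    fix k assume k: "k < e r"
    show "nz r (reads (\<sigma> k))" using k assms(1) by (simp add: \<sigma>_def nz_conc)
    show "rle (Do (moves (\<lambda>rs i. if i = 0 then m else if i = 1 then Stay
     else if i = r + 2 then Left else if i - 2 \<in> L then Right else Stay))) (\<sigma> k) 1 (\<sigma> (Suc k))"
      unfolding \<sigma>_def
      by (rule rle_moves) (use k h[of k] h[of "Suc k"] assms(2) in \<open>auto simp: algebra_simps\<close>)
  next
    show "\<not> nz r (reads (\<sigma> (e r)))" using assms(1) by (simp add: \<sigma>_def nz_conc)
  qed
  moreover have "\<sigma> 0 = conc K w h e out"
    unfolding \<sigma>_def by (rule arg_cong2[of _ _ _ _ "\<lambda>h e. conc K w h e out"]) auto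
  moreover have "\<sigma> (e r) = conc K w (nat (int h + shift m * int (e r)))
      (\<lambda>i. if i = r then 0 else if i \<in> L then e i + e r else e i) out"
    unfolding \<sigma>_def by (simp cong: if_cong)
  ultimately show ?thesis unfolding tr_def by (simp add: mult_2_right)
qed

lemma conc_eqI: "h = h' \<Longrightarrow> (\<And>i. e i = e' i) \<Longrightarrow> conc K w h e out = conc K w h' e' out"
  by (metis ext)

lemma rle_trI:
  assumes "r < K" "r \<notin> L" "m = Left \<Longrightarrow> n \<le> h" "e r = n" "int h' = int h + shift m * int n"
    "\<And>i. e' i = (if i = r then 0 else if i \<in> L then e i + n else e i)"
  shows "rle (tr r L m) (conc K w h e out) (n * 2 + 1) (conc K w h' e' out)"
proof -
  have "conc K w (nat (int h + shift m * int (e r)))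
      (\<lambda>i. if i = r then 0 else if i \<in> L then e i + e r else e i) out = conc K w h' e' out"
    using assms(4-6) by (intro conc_eqI) (simp_all flip: assms(5))
  then show ?thesis
    using rle_tr[of r K L m e h w out] assms(1-4) by simp
qed

lemma rle_clear:
  "r < K \<Longrightarrow> e r = n \<Longrightarrow> rle (tr r {} Stay) (conc K w h e out) (n * 2 + 1) (conc K w h (e(r := 0)) out)"
  by (rule rle_trI) auto

definition inc :: "nat \<Rightarrow> com" where
  "inc r = Do (moves (\<lambda>rs i. if i = r + 2 then Right else Stay))"

definition dec :: "nat \<Rightarrow> com" where
  "dec r = Do (moves (\<lambda>rs i. if i = r + 2 then Left else Stay))"

lemma wfc_inc: "wfc (inc r)" and wfc_dec: "wfc (dec r)"
  by (simp_all add: inc_def dec_def wfa_moves)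

lemma rle_inc: "rle (inc r) (conc K w h e out) 1 (conc K w h (e(r := Suc (e r))) out)"
  unfolding inc_def by (rule rle_moves) auto

lemma rle_dec: "0 < e r \<Longrightarrow> rle (dec r) (conc K w h e out) 1 (conc K w h (e(r := e r - 1)) out)"
  unfolding dec_def by (rule rle_moves) auto

section \<open>Polynomial bounds and composable programs\<close>

lemma poly_mono_nat: "x \<le> y \<Longrightarrow> poly p x \<le> poly p (y :: nat)"
  by (induction p) (auto intro: add_mono mult_mono)

definition pbd :: "('a \<Rightarrow> nat) \<Rightarrow> ('a \<Rightarrow> nat) \<Rightarrow> bool" where
  "pbd s G \<longleftrightarrow> (\<exists>p :: nat poly. \<forall>a. G a \<le> poly p (s a))"

lemma pbd_const: "pbd s (\<lambda>_. c)"
  unfolding pbd_def by (rule exI[of _ "[:c:]"]) simp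

lemma pbd_id: "pbd s s"
  unfolding pbd_def by (rule exI[of _ "[:0, 1:]"]) simp

lemma pbd_add: "pbd s F \<Longrightarrow> pbd s G \<Longrightarrow> pbd s (\<lambda>a. F a + G a)"
  unfolding pbd_def by (metis add_mono poly_add)

lemma pbd_mult: "pbd s F \<Longrightarrow> pbd s G \<Longrightarrow> pbd s (\<lambda>a. F a * G a)"
  unfolding pbd_def by (metis mult_le_mono poly_mult)

lemma pbd_mono: "pbd s G \<Longrightarrow> (\<And>a. F a \<le> G a) \<Longrightarrow> pbd s F"
  unfolding pbd_def using le_trans by blast

lemma pbd_poly: "pbd s G \<Longrightarrow> pbd s (\<lambda>a. poly p (G a))"
  unfolding pbd_def by (metis poly_mono_nat poly_pcompose)

lemma pbd_trans:
  assumes "pbd s F" "pbd t s"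
  shows "pbd t F"
proof -
  obtain p where "\<And>a. F a \<le> poly p (s a)" using assms(1) by (auto simp: pbd_def)
  then show ?thesis using pbd_mono[OF pbd_poly[OF assms(2)]] by blast
qed

lemmas pbd_rules = pbd_const pbd_id pbd_add pbd_mult pbd_poly

definition sz :: "('a \<Rightarrow> nat) list \<Rightarrow> ('a \<Rightarrow> nat list) \<Rightarrow> 'a \<Rightarrow> nat" where
  "sz vs W a = length (W a) + sum_list (map (\<lambda>v. v a) vs)"

text \<open>Without blanks inside the word, the first blank marks its end.\<close>

definition okw :: "nat list \<Rightarrow> bool" where
  "okw w \<longleftrightarrow> (\<forall>s \<in> set w. 0 < s \<and> s < 4)"

text \<open>The contract that lets programs be chained: the registers from \<open>d\<close> on are
  zero before and, except for the result in \<open>d\<close>, zero again afterwards; the arguments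
  survive and the input head returns to cell \<open>0\<close>. \<open>k\<close> is a number of
  registers that suffices.\<close>

definition prog where
  "prog vs W F ps d c k T \<longleftrightarrow> wfc c \<and> pbd (sz vs W) T \<and> (\<forall>K \<ge> k. \<forall>a e out.
     okw (W a) \<longrightarrow> (\<forall>i \<ge> d. e i = 0) \<longrightarrow> map e ps = map (\<lambda>v. v a) vs \<longrightarrow>
     rle c (conc K (W a) 0 e out) (T a) (conc K (W a) 0 (e(d := F a)) out))"

text \<open>\<open>pf vs W F\<close>: the function \<open>F\<close> is computable in polynomial time in unary notation from the
  word \<open>W\<close> and the values of the variables \<open>vs\<close>; the program may be placed anywhere, with the
  variables in registers \<open>ps\<close> and the result in the first free register \<open>d\<close>.\<close>

definition pf :: "('a \<Rightarrow> nat) list \<Rightarrow> ('a \<Rightarrow> nat list) \<Rightarrow> ('a \<Rightarrow> nat) \<Rightarrow> bool" where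
  "pf vs W F \<longleftrightarrow> pbd (sz vs W) F \<and>
     (\<forall>ps d. length ps = length vs \<and> (\<forall>p \<in> set ps. p < d) \<longrightarrow> (\<exists>c k T. prog vs W F ps d c k T))"

lemma pf_pbd: "pf vs W F \<Longrightarrow> pbd (sz vs W) F"
  by (simp add: pf_def)

lemma pfD:
  "pf vs W F \<Longrightarrow> length ps = length vs \<Longrightarrow> \<forall>p \<in> set ps. p < d \<Longrightarrow> \<exists>c k T. prog vs W F ps d c k T"
  unfolding pf_def by blast

lemma prog_wfc: "prog vs W F ps d c k T \<Longrightarrow> wfc c"
  and prog_pbd: "prog vs W F ps d c k T \<Longrightarrow> pbd (sz vs W) T"
  by (simp_all add: prog_def)

lemma prog_run:
  "prog vs W F ps d c k T \<Longrightarrow> k \<le> K \<Longrightarrow> okw (W a) \<Longrightarrow> \<forall>i \<ge> d. e i = 0 \<Longrightarrow> map e ps = map (\<lambda>v. v a) vs \<Longrightarrow>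
     rle c (conc K (W a) 0 e out) (T a) (conc K (W a) 0 (e(d := F a)) out)"
  by (simp add: prog_def)

lemmas progD = prog_wfc prog_pbd prog_run

lemma pfI:
  assumes "pbd (sz vs W) F"
    "\<And>ps d. length ps = length vs \<Longrightarrow> \<forall>p \<in> set ps. p < d \<Longrightarrow> \<exists>c k T. prog vs W F ps d c k T"
  shows "pf vs W F"
  using assms unfolding pf_def by blast

lemma sz_var: "v \<in> set vs \<Longrightarrow> v a \<le> sz vs W a"
  unfolding sz_def by (simp add: member_le_sum_list trans_le_add2)

lemma pf_var:
  assumes "v \<in> set vs"
  shows "pf vs W v"
proof (rule pfI)
  show "pbd (sz vs W) v" by (rule pbd_mono[OF pbd_id sz_var[OF assms]])
  fix ps :: "nat list" and d :: nat
  assume ps: "length ps = length vs" "\<forall>p \<in> set ps. p < d"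
  obtain j where j: "j < length vs" "vs ! j = v" using assms by (auto simp: in_set_conv_nth)
  define p where "p = ps ! j"
  have p: "p < d" using j ps by (simp add: p_def)
  \<comment> \<open>A register can be read only by emptying it, so a second copy is made in
    \<open>d + 1\<close> and moved back.\<close>
  have "prog vs W v ps d (tr p {d, d + 1} Stay ;; tr (d + 1) {p} Stay) (d + 2)
      (\<lambda>a. (v a * 2 + 1) + (v a * 2 + 1))"
    unfolding prog_def
  proof (intro conjI allI impI)
    show "wfc (tr p {d, d + 1} Stay ;; tr (d + 1) {p} Stay)" by (simp add: wfc_tr)
    show "pbd (sz vs W) (\<lambda>a. (v a * 2 + 1) + (v a * 2 + 1))"
      by (intro pbd_rules) (rule pbd_mono[OF pbd_id sz_var[OF assms]])+
    fix K a out and e :: "nat \<Rightarrow> nat"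
    assume K: "d + 2 \<le> K" and e: "\<forall>i \<ge> d. e i = 0" "map e ps = map (\<lambda>v. v a) vs"
    have ep: "e p = v a" using e(2) j ps(1) unfolding p_def by (metis nth_map)
    have 1: "rle (tr p {d, d + 1} Stay) (conc K (W a) 0 e out) (v a * 2 + 1)
        (conc K (W a) 0 (e(p := 0, d := v a, d + 1 := v a)) out)"
      by (rule rle_trI) (use K p ep e(1) in auto)
    have 2: "rle (tr (d + 1) {p} Stay) (conc K (W a) 0 (e(p := 0, d := v a, d + 1 := v a)) out)
        (v a * 2 + 1) (conc K (W a) 0 (e(d := v a)) out)"
      by (rule rle_trI) (use K p ep e(1) in auto)
    show "rle (tr p {d, d + 1} Stay ;; tr (d + 1) {p} Stay) (conc K (W a) 0 e out)
        ((v a * 2 + 1) + (v a * 2 + 1)) (conc K (W a) 0 (e(d := v a)) out)"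
      by (rule rle_Seq[OF 1 2])
  qed
  then show "\<exists>c k T. prog vs W v ps d c k T" by blast
qed

lemma pf_0: "pf vs W (\<lambda>_. 0)"
proof (rule pfI)
  show "pbd (sz vs W) (\<lambda>_. 0)" by (rule pbd_const)
  fix ps :: "nat list" and d :: nat
  have "prog vs W (\<lambda>_. 0) ps d (Do (moves (\<lambda>rs i. Stay))) 0 (\<lambda>_. 1)"
    unfolding prog_def by (auto simp: wfa_moves pbd_const fun_upd_idem intro: rle_moves[simplified])
  then show "\<exists>c k T. prog vs W (\<lambda>_. 0) ps d c k T" by blast
qed

lemma pf_Suc:
  assumes "pf vs W F"
  shows "pf vs W (\<lambda>a. Suc (F a))"
proof (rule pfI)
  show "pbd (sz vs W) (\<lambda>a. Suc (F a))"
    using pbd_add[OF pf_pbd[OF assms] pbd_const[of _ 1]] by simp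
  fix ps :: "nat list" and d :: nat
  assume "length ps = length vs" "\<forall>p \<in> set ps. p < d"
  then obtain c k T where "prog vs W F ps d c k T"
      using pfD[OF assms] by blast
    note c = progD[OF this]
  have "prog vs W (\<lambda>a. Suc (F a)) ps d (c ;; inc d) k (\<lambda>a. T a + 1)"
    unfolding prog_def
  proof (intro conjI allI impI)
    fix K a out and e :: "nat \<Rightarrow> nat"
    assume "k \<le> K" "okw (W a)" "\<forall>i \<ge> d. e i = 0" "map e ps = map (\<lambda>v. v a) vs"
    from rle_Seq[OF c(3)[OF this] rle_inc[of d]]
    show "rle (c ;; inc d) (conc K (W a) 0 e out) (T a + 1) (conc K (W a) 0 (e(d := Suc (F a))) out)"
      by simp
  next
    show "pbd (sz vs W) (\<lambda>a. T a + 1)" by (intro pbd_rules c)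
  qed (simp add: wfc_inc c)
  then show "\<exists>c k T. prog vs W (\<lambda>a. Suc (F a)) ps d c k T" by blast
qed


text \<open>Positions beyond the word read as the blank. The cap \<open>3\<close> is what three
  conditional increments can count; on words with symbols below \<open>4\<close> it changes
  nothing.\<close>

definition symb :: "nat list \<Rightarrow> nat \<Rightarrow> nat" where
  "symb w i = (if i < length w then min 3 (w ! i) else 0)"

definition incsym :: "nat \<Rightarrow> nat \<Rightarrow> com" where
  "incsym d j = Do (moves (\<lambda>rs i. if i = d + 2 \<and> j < rs ! 0 then Right else Stay))"

lemma wfc_incsym: "wfc (incsym d j)"
  by (simp add: incsym_def wfa_moves)

lemma rle_incsym:
  "rle (incsym d j) (conc K w h e out) 1
     (conc K w h (e(d := e d + of_bool (j < written w (int h)))) out)"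
  unfolding incsym_def by (rule rle_moves) (auto simp: reads_conc)

lemma pf_sym:
  assumes "pf vs W F"
  shows "pf vs W (\<lambda>a. symb (W a) (F a))"
proof (rule pfI)
  show "pbd (sz vs W) (\<lambda>a. symb (W a) (F a))"
    by (rule pbd_mono[OF pbd_const[of _ 3]]) (simp add: symb_def)
  fix ps :: "nat list" and d :: nat
  assume "length ps = length vs" "\<forall>p \<in> set ps. p < d"
  then obtain c k T where "prog vs W F ps d c k T"
      using pfD[OF assms] by blast
    note c = progD[OF this]
  \<comment> \<open>The head walks \<open>F a\<close> cells to the right, the distance being kept in
    \<open>d + 1\<close>. The scanned symbol is converted to unary by comparing it with
    \<open>0\<close>, \<open>1\<close> and \<open>2\<close>, and the kept distance leads the head
    back.\<close>
  let ?c = "c ;; tr d {d + 1} Right ;; incsym d 0 ;; incsym d 1 ;; incsym d 2 ;; tr (d + 1) {} Left"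
  have "prog vs W (\<lambda>a. symb (W a) (F a)) ps d ?c (k + d + 2)
      (\<lambda>a. T a + ((F a * 2 + 1) + (1 + (1 + (1 + (F a * 2 + 1))))))"
    unfolding prog_def
  proof (intro conjI allI impI)
    fix K a out and e :: "nat \<Rightarrow> nat"
    assume K: "k + d + 2 \<le> K" and e: "okw (W a)" "\<forall>i \<ge> d. e i = 0" "map e ps = map (\<lambda>v. v a) vs"
    have 1: "rle c (conc K (W a) 0 e out) (T a) (conc K (W a) 0 (e(d := F a)) out)"
      using c(3)[OF _ e] K by simp
    have 2: "rle (tr d {d + 1} Right) (conc K (W a) 0 (e(d := F a)) out) (F a * 2 + 1)
        (conc K (W a) (F a) (e(d + 1 := F a)) out)"
      by (rule rle_trI) (use K e(2) in auto)
    let ?s = "written (W a) (int (F a))"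
    let ?e = "e(d + 1 := F a, d := of_bool (0 < ?s) + of_bool (1 < ?s) + of_bool (2 < ?s))"
    have 3: "rle (incsym d 0) (conc K (W a) (F a) (e(d + 1 := F a)) out) 1
        (conc K (W a) (F a) (e(d + 1 := F a, d := of_bool (0 < ?s))) out)"
      using rle_incsym[of d 0 K "W a" "F a" "e(d + 1 := F a)" out] e(2) by simp
    have 4: "rle (incsym d 1) (conc K (W a) (F a) (e(d + 1 := F a, d := of_bool (0 < ?s))) out) 1
        (conc K (W a) (F a) (e(d + 1 := F a, d := of_bool (0 < ?s) + of_bool (1 < ?s))) out)"
      using rle_incsym[of d 1 K "W a" "F a" "e(d + 1 := F a, d := of_bool (0 < ?s))" out] by simp
    have 5: "rle (incsym d 2)
        (conc K (W a) (F a) (e(d + 1 := F a, d := of_bool (0 < ?s) + of_bool (1 < ?s))) out) 1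
        (conc K (W a) (F a) ?e out)"
      using rle_incsym[of d 2 K "W a" "F a"
          "e(d + 1 := F a, d := of_bool (0 < ?s) + of_bool (1 < ?s))" out] by simp
    have s: "of_bool (0 < ?s) + of_bool (1 < ?s) + of_bool (2 < ?s) = symb (W a) (F a)"
      by (auto simp: symb_def written_def)
    have 6: "rle (tr (d + 1) {} Left) (conc K (W a) (F a) ?e out) (F a * 2 + 1)
        (conc K (W a) 0 (e(d := symb (W a) (F a))) out)"
      unfolding s by (rule rle_trI) (use K e(2) in auto)
    show "rle ?c (conc K (W a) 0 e out) (T a + ((F a * 2 + 1) + (1 + (1 + (1 + (F a * 2 + 1))))))
        (conc K (W a) 0 (e(d := symb (W a) (F a))) out)"
      by (rule rle_Seq[OF 1 rle_Seq[OF 2 rle_Seq[OF 3 rle_Seq[OF 4 rle_Seq[OF 5 6]]]]])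
  next
    show "pbd (sz vs W) (\<lambda>a. T a + ((F a * 2 + 1) + (1 + (1 + (1 + (F a * 2 + 1))))))"
      by (intro pbd_rules c pf_pbd[OF assms])
  qed (simp add: wfc_tr wfc_incsym c)
  then show "\<exists>c k T. prog vs W (\<lambda>a. symb (W a) (F a)) ps d c k T" by blast
qed

lemma pf_length: "pf vs W (\<lambda>a. length (W a))"
proof (rule pfI)
  show pl: "pbd (sz vs W) (\<lambda>a. length (W a))"
    by (rule pbd_mono[OF pbd_id]) (simp add: sz_def)
  fix ps :: "nat list" and d :: nat
  let ?b = "Do (moves (\<lambda>rs i. if i = 0 \<or> i = d + 2 \<or> i = d + 3 then Right else Stay))"
  let ?c = "While (\<lambda>rs. rs ! 0 \<noteq> 0) ?b ;; tr (d + 1) {} Left"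
  have "prog vs W (\<lambda>a. length (W a)) ps d ?c (d + 2)
      (\<lambda>a. (length (W a) * (1 + 1) + 1) + (length (W a) * 2 + 1))"
    unfolding prog_def
  proof (intro conjI allI impI)
    fix K a out and e :: "nat \<Rightarrow> nat"
    assume K: "d + 2 \<le> K" and e: "okw (W a)" "\<forall>i \<ge> d. e i = 0"
    define \<sigma> where "\<sigma> i = conc K (W a) i (e(d := i, d + 1 := i)) out" for i
    have "rle (While (\<lambda>rs. rs ! 0 \<noteq> 0) ?b) (\<sigma> 0) (length (W a) * (1 + 1) + 1) (\<sigma> (length (W a)))"
    proof (rule rle_While)
      show "reads (\<sigma> i) ! 0 \<noteq> 0" if "i < length (W a)" for i
        using that e(1) by (auto simp: \<sigma>_def reads_conc written_def okw_def)
      show "rle ?b (\<sigma> i) 1 (\<sigma> (Suc i))" for i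
        unfolding \<sigma>_def by (rule rle_moves) auto
    qed (simp add: \<sigma>_def reads_conc written_def)
    moreover have "\<sigma> 0 = conc K (W a) 0 e out"
      unfolding \<sigma>_def by (rule conc_eqI) (use e(2) in auto)
    ultimately have 1: "rle (While (\<lambda>rs. rs ! 0 \<noteq> 0) ?b) (conc K (W a) 0 e out)
        (length (W a) * (1 + 1) + 1) (\<sigma> (length (W a)))" by simp
    have 2: "rle (tr (d + 1) {} Left) (\<sigma> (length (W a))) (length (W a) * 2 + 1)
        (conc K (W a) 0 (e(d := length (W a))) out)"
      unfolding \<sigma>_def
      by (rule rle_trI) (use K e(2) in auto)
    show "rle ?c (conc K (W a) 0 e out) ((length (W a) * (1 + 1) + 1) + (length (W a) * 2 + 1))
        (conc K (W a) 0 (e(d := length (W a))) out)"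
      by (rule rle_Seq[OF 1 2])
  next
    show "pbd (sz vs W) (\<lambda>a. (length (W a) * (1 + 1) + 1) + (length (W a) * 2 + 1))"
      by (intro pbd_rules pl)
  qed (simp_all add: wfc_tr wfa_moves)
  then show "\<exists>c k T. prog vs W (\<lambda>a. length (W a)) ps d c k T" by blast
qed

text \<open>Change of environment: each old variable, composed with \<open>g\<close>, occurs among
  the new ones, so the same program works with its argument list redirected to the matching
  registers.\<close>

lemma pf_weaken:
  assumes F: "pf vs W F" and us: "\<And>v. v \<in> set vs \<Longrightarrow> (\<lambda>p. v (g p)) \<in> set us"
  shows "pf us (\<lambda>p. W (g p)) (\<lambda>p. F (g p))"
proof -
  let ?W = "\<lambda>p. W (g p)"
  have "sz vs W (g p) \<le> (length vs + 1) * sz us ?W p" for p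
  proof -
    have "sum_list (map (\<lambda>v. v (g p)) vs) \<le> sum_list (map (\<lambda>v. sz us ?W p) vs)"
      by (rule sum_list_mono) (use us sz_var in fastforce)
    then show ?thesis by (simp add: sz_def[of vs] sum_list_triv) (simp add: sz_def)
  qed
  then have sz: "pbd (sz us ?W) (\<lambda>p. sz vs W (g p))"
    by (intro pbd_mono[OF pbd_mult[OF pbd_const pbd_id]])
  have lift: "pbd (sz us ?W) (\<lambda>p. T (g p))" if "pbd (sz vs W) T" for T
    using that by (intro pbd_trans[OF _ sz]) (auto simp: pbd_def)
  show ?thesis
  proof (rule pfI)
    show "pbd (sz us ?W) (\<lambda>p. F (g p))" by (rule lift[OF pf_pbd[OF F]])
    fix ps :: "nat list" and d :: nat
    assume ps: "length ps = length us" "\<forall>p \<in> set ps. p < d"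
    have "\<forall>v \<in> set vs. \<exists>j < length us. us ! j = (\<lambda>p. v (g p))"
      using us by (auto simp: in_set_conv_nth)
    then obtain j where j: "\<And>v. v \<in> set vs \<Longrightarrow> j v < length us \<and> us ! j v = (\<lambda>p. v (g p))"
      by metis
    define qs where "qs = map (\<lambda>v. ps ! j v) vs"
    have "length qs = length vs" "\<forall>p \<in> set qs. p < d" using ps j by (auto simp: qs_def)
    then obtain c k T where "prog vs W F qs d c k T"
      using pfD[OF F] by blast
    note c = progD[OF this]
    have "map e qs = map (\<lambda>v. v (g p)) vs" if "map e ps = map (\<lambda>v. v p) us" for e p
    proof -
      have "e (ps ! j v) = v (g p)" if v: "v \<in> set vs" for v
        using arg_cong[OF \<open>map e ps = _\<close>, of "\<lambda>xs. xs ! j v"] j[OF v] ps(1) by simp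
      then show ?thesis by (simp add: qs_def)
    qed
    then have "prog us ?W (\<lambda>p. F (g p)) ps d c k (\<lambda>p. T (g p))"
      unfolding prog_def using c lift by blast
    then show "\<exists>c k T. prog us ?W (\<lambda>p. F (g p)) ps d c k T" by blast
  qed
qed


lemma upd_out:
  assumes "\<forall>p \<in> set ps. p < (d :: nat)" "d \<le> i"
  shows "map (e(i := x)) ps = map e ps"
  using assms by (auto simp: map_fun_upd)

text \<open>Primitive recursion. The bound \<open>B\<close> on all intermediate values is what keeps
  this inside polynomial time, since iterating a polynomially bounded function can grow
  exponentially. In the environment of \<open>f\<close>, the two new variables are the index and the
  value so far.\<close>

lemma pf_rec_nat:
  assumes n: "pf vs W n" and z: "pf vs W z"
    and f: "pf ((\<lambda>p. fst (snd p)) # (\<lambda>p. snd (snd p)) # map (\<lambda>v p. v (fst p)) vs) (\<lambda>p. W (fst p))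
        (\<lambda>p. f (fst p) (fst (snd p)) (snd (snd p)))"
    and B: "pbd (sz vs W) B" "\<And>a i. i \<le> n a \<Longrightarrow> rec_nat (z a) (f a) i \<le> B a"
  shows "pf vs W (\<lambda>a. rec_nat (z a) (f a) (n a))"
proof (rule pfI)
  let ?F = "\<lambda>a. rec_nat (z a) (f a) (n a)"
  let ?us = "(\<lambda>p. fst (snd p)) # (\<lambda>p. snd (snd p)) # map (\<lambda>v p. v (fst p)) vs"
  show "pbd (sz vs W) ?F" by (rule pbd_mono[OF B(1) B(2)]) simp
  fix ps :: "nat list" and d :: nat
  assume ps: "length ps = length vs" and pd: "\<forall>p \<in> set ps. p < d"
  obtain cz kz Tz where "prog vs W z ps d cz kz Tz" using pfD[OF z ps pd] by blast
  note cz = progD[OF this]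
  have pd1: "\<forall>p \<in> set ps. p < d + 1" using pd by auto
  obtain cn kn Tn where "prog vs W n ps (d + 1) cn kn Tn" using pfD[OF n ps pd1] by blast
  note cn = progD[OF this]
  have "\<forall>p \<in> set ((d + 2) # d # ps). p < d + 3" using pd by auto
  then obtain cf kf Tf where "prog ?us (\<lambda>p. W (fst p)) (\<lambda>p. f (fst p) (fst (snd p)) (snd (snd p)))
      ((d + 2) # d # ps) (d + 3) cf kf Tf" using pfD[OF f, of "(d + 2) # d # ps" "d + 3"] ps by auto
  note cf = progD[OF this]
  obtain pT where pT: "\<And>p. Tf p \<le> poly pT (sz ?us (\<lambda>p. W (fst p)) p)"
    using cf(2) by (auto simp: pbd_def)
  \<comment> \<open>A time bound for the body that serves all rounds, as index and value never
    exceed \<open>n a\<close> and \<open>B a\<close>.\<close>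
  define S where "S a = poly pT (sz vs W a + n a + B a)" for a
  define t where "t a = 1 + (S a + ((B a * 2 + 1) + ((B a * 2 + 1) + 1)))" for a
  \<comment> \<open>Register \<open>d\<close> holds the value, \<open>d + 1\<close> the number of
    rounds left, \<open>d + 2\<close> the index and \<open>d + 3\<close> the next value.\<close>
  let ?b = "dec (d + 1) ;; cf ;; tr d {} Stay ;; tr (d + 3) {d} Stay ;; inc (d + 2)"
  let ?c = "cz ;; cn ;; While (nz (d + 1)) ?b ;; tr (d + 2) {} Stay"
  have "prog vs W ?F ps d ?c (kz + kn + kf + d + 4)
      (\<lambda>a. Tz a + (Tn a + ((n a * (t a + 1) + 1) + (n a * 2 + 1))))"
    unfolding prog_def
  proof (intro conjI allI impI)
    show "wfc ?c" using cz(1) cn(1) cf(1) by (simp add: wfc_tr wfc_inc wfc_dec)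
    show "pbd (sz vs W) (\<lambda>a. Tz a + (Tn a + ((n a * (t a + 1) + 1) + (n a * 2 + 1))))"
      unfolding t_def S_def by (intro pbd_rules cz cn B pf_pbd[OF n])
    fix K a out and e :: "nat \<Rightarrow> nat"
    assume K: "kz + kn + kf + d + 4 \<le> K" and w: "okw (W a)" and e: "\<forall>i \<ge> d. e i = 0"
      and m: "map e ps = map (\<lambda>v. v a) vs"
    define it where "it i = rec_nat (z a) (f a) i" for i
    define \<sigma> where "\<sigma> i = conc K (W a) 0 (e(d := it i, d + 1 := n a - i, d + 2 := i)) out" for i
    have 1: "rle cz (conc K (W a) 0 e out) (Tz a) (conc K (W a) 0 (e(d := z a)) out)"
      by (rule cz(3)) (use K w e m in auto)
    have 2: "rle cn (conc K (W a) 0 (e(d := z a)) out) (Tn a)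
        (conc K (W a) 0 (e(d := z a, d + 1 := n a)) out)"
    proof (rule cn(3))
      show "map (e(d := z a)) ps = map (\<lambda>v. v a) vs"
        using upd_out[OF pd order_refl] m by metis
    qed (use K w e in auto)
    have "rle (While (nz (d + 1)) ?b) (\<sigma> 0) (n a * (t a + 1) + 1) (\<sigma> (n a))"
    proof (rule rle_While)
      fix i assume i: "i < n a"
      show "nz (d + 1) (reads (\<sigma> i))" using i K by (simp add: \<sigma>_def nz_conc)
      let ?e1 = "e(d := it i, d + 1 := n a - Suc i, d + 2 := i)"
      have b1: "rle (dec (d + 1)) (\<sigma> i) 1 (conc K (W a) 0 ?e1 out)"
      proof -
        let ?e0 = "e(d := it i, d + 1 := n a - i, d + 2 := i)"
        have "?e0(d + 1 := ?e0 (d + 1) - 1) = ?e1" by (auto simp: fun_eq_iff)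
        then show ?thesis using rle_dec[of ?e0 "d + 1" K "W a" 0 out] i by (simp add: \<sigma>_def)
      qed
      have "rle cf (conc K (W (fst (a, i, it i))) 0 ?e1 out) (Tf (a, i, it i))
          (conc K (W (fst (a, i, it i))) 0
            (?e1(d + 3 := f (fst (a, i, it i)) (fst (snd (a, i, it i))) (snd (snd (a, i, it i))))) out)"
      proof (rule cf(3))
        have "map ?e1 ps = map e ps" by (rule map_cong) (use pd in auto)
        then show "map ?e1 ((d + 2) # d # ps) = map (\<lambda>v. v (a, i, it i)) ?us" using m by simp
      qed (use K w e in auto)
      moreover have "Tf (a, i, it i) \<le> S a"
        unfolding S_def using i B(2)[of i a]
        by (intro order_trans[OF pT] poly_mono_nat) (simp add: sz_def it_def comp_def)
      ultimately have b2: "rle cf (conc K (W a) 0 ?e1 out) (S a)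
          (conc K (W a) 0 (?e1(d + 3 := it (Suc i))) out)"
        by (auto simp: it_def intro: rle_mono)
      have b3: "rle (tr d {} Stay) (conc K (W a) 0 (?e1(d + 3 := it (Suc i))) out) (B a * 2 + 1)
          (conc K (W a) 0 (?e1(d + 3 := it (Suc i), d := 0)) out)"
        by (rule rle_mono, rule rle_clear[OF _ refl]) (use K B(2)[of i a] i in \<open>auto simp: it_def\<close>)
      have b4: "rle (tr (d + 3) {d} Stay) (conc K (W a) 0 (?e1(d + 3 := it (Suc i), d := 0)) out)
          (B a * 2 + 1) (conc K (W a) 0 (?e1(d := it (Suc i))) out)"
        by (rule rle_mono, rule rle_trI[where n = "it (Suc i)"])
          (use K B(2)[of "Suc i" a] i e in \<open>auto simp: it_def\<close>)
      have b5: "rle (inc (d + 2)) (conc K (W a) 0 (?e1(d := it (Suc i))) out) 1 (\<sigma> (Suc i))"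
      proof -
        have "\<sigma> (Suc i) = conc K (W a) 0 (?e1(d := it (Suc i),
            d + 2 := Suc ((?e1(d := it (Suc i))) (d + 2)))) out"
          unfolding \<sigma>_def by (rule conc_eqI) auto
        then show ?thesis by (simp only: rle_inc)
      qed
      show "rle ?b (\<sigma> i) (t a) (\<sigma> (Suc i))"
        unfolding t_def by (rule rle_Seq[OF b1 rle_Seq[OF b2 rle_Seq[OF b3 rle_Seq[OF b4 b5]]]])
    next
      show "\<not> nz (d + 1) (reads (\<sigma> (n a)))" using K by (simp add: \<sigma>_def nz_conc)
    qed
    moreover have "\<sigma> 0 = conc K (W a) 0 (e(d := z a, d + 1 := n a)) out"
      unfolding \<sigma>_def it_def by (rule conc_eqI) (use e in auto)
    ultimately have 3: "rle (While (nz (d + 1)) ?b) (conc K (W a) 0 (e(d := z a, d + 1 := n a)) out)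
        (n a * (t a + 1) + 1) (\<sigma> (n a))" by simp
    have 4: "rle (tr (d + 2) {} Stay) (\<sigma> (n a)) (n a * 2 + 1) (conc K (W a) 0 (e(d := ?F a)) out)"
      unfolding \<sigma>_def it_def by (rule rle_trI) (use K e in auto)
    show "rle ?c (conc K (W a) 0 e out) (Tz a + (Tn a + ((n a * (t a + 1) + 1) + (n a * 2 + 1))))
        (conc K (W a) 0 (e(d := ?F a)) out)"
      by (rule rle_Seq[OF 1 rle_Seq[OF 2 rle_Seq[OF 3 4]]])
  qed
  then show "\<exists>c k T. prog vs W ?F ps d c k T" by blast
qed


section \<open>From programs to machines that write an output\<close>

definition initreg :: com where
  "initreg = Do (\<lambda>rs. map (\<lambda>i. (if 2 \<le> i then 3 else rs ! i, Stay)) [0..<length rs])"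

text \<open>Scanning the mark \<open>3\<close> means that register \<open>d\<close> is zero, so the
  bits \<open>1\<close> and \<open>2\<close> are written for zero and nonzero.\<close>

definition put :: "nat \<Rightarrow> com" where
  "put d = Do (\<lambda>rs. map (\<lambda>i. if i = 1 then (if rs ! (d + 2) = 3 then 1 else 2, Right) else (rs ! i, Stay))
     [0..<length rs])"

lemma wfc_initreg: "wfc initreg" and wfc_put: "wfc (put d)"
  by (auto simp: initreg_def put_def wfa_def)

lemma length_conc: "length (conc K w h e out) = K + 2"
  by (simp add: conc_def)

lemma rle_initreg:
  "rle initreg (snd (init_config (machine K c) w)) 1 (conc K w 0 (\<lambda>_. 0) [])"
proof -
  define ts where "ts = (written w, 0 :: int) # replicate (Suc K) (written [], 0)"
  have ts: "snd (init_config (machine K c) w) = ts"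
    by (simp add: init_config_def machine_def ts_def)
  have len: "length ts = K + 2" by (simp add: ts_def)
  let ?f = "\<lambda>rs. map (\<lambda>i. (if 2 \<le> i then 3 else rs ! i, Stay)) [0..<length rs]"
  have "map2 act ts (?f (reads ts)) = conc K w 0 (\<lambda>_. 0) []"
  proof (rule nth_equalityI)
    fix i assume "i < length (map2 act ts (?f (reads ts)))"
    then have i: "i < K + 2" by (simp add: len length_reads)
    have "map2 act ts (?f (reads ts)) ! i = act (ts ! i) (if 2 \<le> i then 3 else reads ts ! i, Stay)"
      using i by (simp add: len length_reads del: upt_Suc)
    also have "\<dots> = conc K w 0 (\<lambda>_. 0) [] ! i"
      using i by (rule index_cases)
        (auto simp: ts_def conc_def reads_def written_def mark_def fun_eq_iff)
    finally show "map2 act ts (?f (reads ts)) ! i = conc K w 0 (\<lambda>_. 0) [] ! i" .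
  qed (simp add: len length_reads length_conc)
  then have "run initreg ts 1 (conc K w 0 (\<lambda>_. 0) [])"
    using run_Do[of ?f ts] by (simp only: initreg_def)
  then show ?thesis
    unfolding rle_def ts by blast
qed

lemma rle_put:
  assumes "d < K"
  shows "rle (put d) (conc K w h e out) 1 (conc K w h e (out @ [if e d = 0 then 1 else 2]))"
proof -
  let ?ts = "conc K w h e out"
  let ?o = "out @ [if e d = 0 then 1 else 2]"
  let ?f = "\<lambda>rs. map (\<lambda>i. if i = 1 then (if rs ! (d + 2) = 3 then 1 else 2, Right) else (rs ! i, Stay))
     [0..<length rs]"
  have w: "(written out)(int (length out) := x) = written (out @ [x])" for x
    by (auto simp: written_def fun_eq_iff nth_append nat_less_iff)
  have "map2 act ?ts (?f (reads ?ts)) = conc K w h e ?o"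
  proof (rule nth_equalityI)
    fix i assume "i < length (map2 act ?ts (?f (reads ?ts)))"
    then have i: "i < K + 2" by (simp add: length_conc length_reads)
    have "map2 act ?ts (?f (reads ?ts)) ! i = act (?ts ! i)
        (if i = 1 then (if reads ?ts ! (d + 2) = 3 then 1 else 2, Right) else (reads ?ts ! i, Stay))"
      using i by (simp add: length_conc length_reads del: upt_Suc)
    also have "\<dots> = conc K w h e ?o ! i"
      using i by (rule index_cases) (use assms w in \<open>auto simp: conc_def reads_conc mark_def reads_def\<close>)
    finally show "map2 act ?ts (?f (reads ?ts)) ! i = conc K w h e ?o ! i" .
  qed (simp add: length_conc length_reads)
  then have "run (put d) ?ts 1 (conc K w h e ?o)"
    using run_Do[of ?f ?ts] by (simp only: put_def)
  then show ?thesis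
    unfolding rle_def by blast
qed

text \<open>It suffices to compute the output length and each output bit separately; every bit is
  recomputed from the untouched input.\<close>

theorem polytimeI:
  assumes len: "pf [] W len" and bit: "pf [snd] (\<lambda>p. W (fst p)) (\<lambda>p. of_bool (bt (fst p) (snd p)))"
    and W: "\<And>a. okw (W a)"
  shows "polytime W (\<lambda>a. map (\<lambda>i. if bt a i then 2 else 1) [0..<len a])"
proof -
  obtain cl kl Tl where "prog [] W len [] 0 cl kl Tl" using pfD[OF len, of "[]" 0] by auto
  note cl = progD[OF this]
  obtain cb kb Tb where "prog [snd] (\<lambda>p. W (fst p)) (\<lambda>p. of_bool (bt (fst p) (snd p))) [1] 2 cb kb Tb"
    using pfD[OF bit, of "[1]" 2] by auto
  note cb = progD[OF this]
  obtain pT where pT: "\<And>p. Tb p \<le> poly pT (sz [snd] (\<lambda>p. W (fst p)) p)"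
    using cb(2) by (auto simp: pbd_def)
  define t where "t a = poly pT (length (W a) + len a) + (1 + ((1 * 2 + 1) + (1 + 1)))" for a
  \<comment> \<open>Register \<open>0\<close> counts the bits still to be written, \<open>1\<close>
    is the current position and \<open>2\<close> the bit.\<close>
  let ?b = "cb ;; put 2 ;; tr 2 {} Stay ;; inc 1 ;; dec 0"
  define c where "c = initreg ;; cl ;; While (nz 0) ?b"
  define K where "K = kl + kb + 3"
  let ?o = "\<lambda>a i. map (\<lambda>i. if bt a i then 2 else 1) [0..<i]"
  have szl: "sz [] W a = length (W a)" for a by (simp add: sz_def)
  have run: "rle c (snd (init_config (machine K c) (W a))) (1 + (Tl a + (len a * (t a + 1) + 1)))
      (conc K (W a) 0 ((\<lambda>_ :: nat. 0)(1 := len a)) (?o a (len a)))" for a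
  proof -
    define \<sigma> where "\<sigma> i = conc K (W a) 0 ((\<lambda>_ :: nat. 0)(0 := len a - i, 1 := i)) (?o a i)" for i
    have 1: "rle cl (conc K (W a) 0 (\<lambda>_. 0) []) (Tl a) (\<sigma> 0)"
      using cl(3)[of K a "\<lambda>_. 0" "[]"] W by (simp add: K_def \<sigma>_def fun_upd_idem)
    have "rle (While (nz 0) ?b) (\<sigma> 0) (len a * (t a + 1) + 1) (\<sigma> (len a))"
    proof (rule rle_While)
      fix i assume i: "i < len a"
      let ?e = "(\<lambda>_ :: nat. 0)(0 := len a - i, 1 := i)"
      let ?v = "of_bool (bt a i) :: nat"
      show "nz 0 (reads (\<sigma> i))" using i by (simp add: \<sigma>_def nz_conc K_def)
      have "rle cb (conc K (W (fst (a, i))) 0 ?e (?o a i)) (Tb (a, i))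
          (conc K (W (fst (a, i))) 0 (?e(2 := of_bool (bt (fst (a, i)) (snd (a, i))))) (?o a i))"
        by (rule cb(3)) (auto simp: K_def W)
      moreover have "Tb (a, i) \<le> poly pT (length (W a) + len a)"
        using i by (intro order_trans[OF pT] poly_mono_nat) (simp add: sz_def)
      ultimately have b1: "rle cb (\<sigma> i) (poly pT (length (W a) + len a))
          (conc K (W a) 0 (?e(2 := ?v)) (?o a i))"
        by (auto simp: \<sigma>_def intro: rle_mono)
      have b2: "rle (put 2) (conc K (W a) 0 (?e(2 := ?v)) (?o a i)) 1
          (conc K (W a) 0 (?e(2 := ?v)) (?o a (Suc i)))"
        using rle_put[of 2 K "W a" 0 "?e(2 := ?v)" "?o a i"] by (auto simp: K_def)
      have b3: "rle (tr 2 {} Stay) (conc K (W a) 0 (?e(2 := ?v)) (?o a (Suc i))) (1 * 2 + 1)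
          (conc K (W a) 0 ?e (?o a (Suc i)))"
        by (rule rle_mono, rule rle_trI[where n = ?v]) (auto simp: K_def)
      have b4: "rle (inc 1) (conc K (W a) 0 ?e (?o a (Suc i))) 1
          (conc K (W a) 0 (?e(1 := Suc i)) (?o a (Suc i)))"
        using rle_inc[of 1 K "W a" 0 ?e] by simp
      have b5: "rle (dec 0) (conc K (W a) 0 (?e(1 := Suc i)) (?o a (Suc i))) 1 (\<sigma> (Suc i))"
      proof -
        have "\<sigma> (Suc i) = conc K (W a) 0 (?e(1 := Suc i, 0 := (?e(1 := Suc i)) 0 - 1)) (?o a (Suc i))"
          unfolding \<sigma>_def by (rule conc_eqI) auto
        then show ?thesis using rle_dec[of "?e(1 := Suc i)" 0] i by simp
      qed
      show "rle ?b (\<sigma> i) (t a) (\<sigma> (Suc i))"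
        unfolding t_def by (rule rle_Seq[OF b1 rle_Seq[OF b2 rle_Seq[OF b3 rle_Seq[OF b4 b5]]]])
    qed (simp add: \<sigma>_def nz_conc K_def)
    moreover have "\<sigma> (len a) = conc K (W a) 0 ((\<lambda>_ :: nat. 0)(1 := len a)) (?o a (len a))"
      unfolding \<sigma>_def by (rule conc_eqI) auto
    ultimately have "rle (While (nz 0) ?b) (\<sigma> 0) (len a * (t a + 1) + 1)
        (conc K (W a) 0 ((\<lambda>_ :: nat. 0)(1 := len a)) (?o a (len a)))" by metis
    from rle_Seq[OF rle_initreg rle_Seq[OF 1 this]] show ?thesis
      unfolding c_def[symmetric] .
  qed
  have "pbd (sz [] W) (\<lambda>a. 1 + (Tl a + (len a * (t a + 1) + 1)) + 1)"
    unfolding t_def szl[symmetric] by (intro pbd_rules cl pf_pbd[OF len])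
  then obtain p where p: "\<And>a. 1 + (Tl a + (len a * (t a + 1) + 1)) < poly p (length (W a))"
    by (auto simp: pbd_def szl Suc_le_eq)
  have "outputs_within (machine K c) (W a) (poly p (length (W a))) (?o a (len a))" for a
  proof -
    obtain n where n: "n \<le> 1 + (Tl a + (len a * (t a + 1) + 1))"
      "run c (snd (init_config (machine K c) (W a))) n
        (conc K (W a) 0 ((\<lambda>_ :: nat. 0)(1 := len a)) (?o a (len a)))"
      using run[of a] by (auto simp: rle_def)
    have "init_config (machine K c) (W a) = (0, snd (init_config (machine K c) (W a)))"
      by (simp add: init_config_def)
    then have "(step (machine K c) ^^ poly p (length (W a))) (init_config (machine K c) (W a)) =
        (1, conc K (W a) 0 ((\<lambda>_ :: nat. 0)(1 := len a)) (?o a (len a)))"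
      using machine_run[OF n(2) le_less_trans[OF n(1) p]] by metis
    then show ?thesis
      by (simp add: outputs_within_def conc_def written_def)
  qed
  moreover have "wf_tm (machine K c)"
    by (rule wf_machine) (simp add: c_def wfc_initreg wfc_put wfc_tr wfc_inc wfc_dec cl cb)
  ultimately show ?thesis unfolding polytime_def by blast
qed

section \<open>Functions computable in polynomial time\<close>

lemma pf_const: "pf vs W (\<lambda>_. c)"
  by (induction c) (auto intro: pf_0 pf_Suc)

text \<open>Sums and bounded quantifiers add their index as a new first variable; this rule treats
  the terms under the binder that do not mention it.\<close>

lemma pf_lift: "pf vs W F \<Longrightarrow> pf (u # map (\<lambda>v p. v (fst p)) vs) (\<lambda>p. W (fst p)) (\<lambda>p. F (fst p))"
  by (rule pf_weaken[of vs W F fst]) auto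

lemma pf_lift2:
  "pf vs W F \<Longrightarrow> pf (u # u' # map (\<lambda>v p. v (fst p)) vs) (\<lambda>p. W (fst p)) (\<lambda>p. F (fst p))"
  by (rule pf_weaken[of vs W F fst]) auto

lemma pf_add:
  assumes A: "pf vs W A" and B: "pf vs W B"
  shows "pf vs W (\<lambda>a. A a + B a)"
proof -
  have eq: "rec_nat (A a) (\<lambda>i s. Suc s) i = A a + i" for a i by (induction i) auto
  have "pf vs W (\<lambda>a. rec_nat (A a) (\<lambda>i s. Suc s) (B a))"
    by (rule pf_rec_nat[where f = "\<lambda>a i s. Suc s" and B = "\<lambda>a. A a + B a"])
      (rule A B pf_Suc pbd_add pf_pbd | (rule pf_var, simp; fail) | simp add: eq)+
  then show ?thesis by (simp only: eq)
qed

lemma pf_mult: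
  assumes A: "pf vs W A" and B: "pf vs W B"
  shows "pf vs W (\<lambda>a. A a * B a)"
proof -
  have eq: "rec_nat 0 (\<lambda>i s. s + A a) i = A a * i" for a i by (induction i) auto
  have "pf vs W (\<lambda>a. rec_nat 0 (\<lambda>i s. s + A a) (B a))"
    by (rule pf_rec_nat[where f = "\<lambda>a i s. s + A a" and z = "\<lambda>_. 0" and B = "\<lambda>a. A a * B a"])
      (rule A B pf_0 pf_add pbd_mult pf_pbd | (rule pf_var, simp; fail) | rule pf_lift2 | simp add: eq)+
  then show ?thesis by (simp only: eq)
qed

lemma pf_pred:
  assumes A: "pf vs W A"
  shows "pf vs W (\<lambda>a. A a - 1)"
proof -
  have eq: "rec_nat 0 (\<lambda>i s. i) i = i - 1" for i :: nat by (cases i) auto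
  have "pf vs W (\<lambda>a. rec_nat 0 (\<lambda>i s. i) (A a))"
    by (rule pf_rec_nat[where f = "\<lambda>a i s. i" and z = "\<lambda>_. 0" and B = A])
      (rule A pf_0 pf_pbd | (rule pf_var, simp; fail) | simp add: eq)+
  then show ?thesis by (simp only: eq)
qed

lemma pf_diff:
  assumes A: "pf vs W A" and B: "pf vs W B"
  shows "pf vs W (\<lambda>a. A a - B a)"
proof -
  have eq: "rec_nat (A a) (\<lambda>i s. s - 1) i = A a - i" for a i by (induction i) auto
  have "pf vs W (\<lambda>a. rec_nat (A a) (\<lambda>i s. s - 1) (B a))"
    by (rule pf_rec_nat[where f = "\<lambda>a i s. s - 1" and z = A and B = A, OF B A])
      (rule A pf_pred pf_pbd | (rule pf_var, simp; fail) | simp only: eq diff_le_self)+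
  then show ?thesis by (simp only: eq)
qed

lemma pf_eq_0:
  assumes A: "pf vs W A"
  shows "pf vs W (\<lambda>a. of_bool (A a = 0))"
proof -
  have eq: "rec_nat 1 (\<lambda>i s. 0) i = (of_bool (i = 0) :: nat)" for i by (cases i) auto
  have "pf vs W (\<lambda>a. rec_nat 1 (\<lambda>i s. 0) (A a) :: nat)"
    by (rule pf_rec_nat[where f = "\<lambda>a i s. 0" and z = "\<lambda>_. 1" and B = "\<lambda>_. 1"])
      (rule A pf_const pbd_const | (simp only: eq, simp))+
  then show ?thesis by (simp only: eq)
qed

lemma pf_not: "pf vs W (\<lambda>a. of_bool (P a)) \<Longrightarrow> pf vs W (\<lambda>a. of_bool (\<not> P a))"
  using pf_eq_0[of vs W "\<lambda>a. of_bool (P a)"] by simp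

lemma pf_conj:
  "pf vs W (\<lambda>a. of_bool (P a)) \<Longrightarrow> pf vs W (\<lambda>a. of_bool (Q a)) \<Longrightarrow> pf vs W (\<lambda>a. of_bool (P a \<and> Q a))"
  using pf_mult[of vs W "\<lambda>a. of_bool (P a)" "\<lambda>a. of_bool (Q a)"] by (simp add: of_bool_conj)

lemma pf_disj:
  assumes "pf vs W (\<lambda>a. of_bool (P a))" "pf vs W (\<lambda>a. of_bool (Q a))"
  shows "pf vs W (\<lambda>a. of_bool (P a \<or> Q a))"
proof -
  have "pf vs W (\<lambda>a. of_bool (\<not> (\<not> P a \<and> \<not> Q a)))"
    by (rule pf_not, rule pf_conj, rule pf_not, rule assms, rule pf_not, rule assms)
  then show ?thesis by (simp only: de_Morgan_conj not_not)
qed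

lemma pf_imp:
  assumes "pf vs W (\<lambda>a. of_bool (P a))" "pf vs W (\<lambda>a. of_bool (Q a))"
  shows "pf vs W (\<lambda>a. of_bool (P a \<longrightarrow> Q a))"
  unfolding imp_conv_disj by (rule pf_disj, rule pf_not, rule assms, rule assms)

lemma pf_le:
  assumes "pf vs W A" "pf vs W B"
  shows "pf vs W (\<lambda>a. of_bool (A a \<le> B a))"
  using pf_eq_0[OF pf_diff[OF assms]] by simp

lemma pf_less:
  assumes "pf vs W A" "pf vs W B"
  shows "pf vs W (\<lambda>a. of_bool (A a < B a))"
  using pf_not[OF pf_le[OF assms(2,1)]] by (simp add: not_le)

lemma pf_eq:
  assumes "pf vs W A" "pf vs W B"
  shows "pf vs W (\<lambda>a. of_bool (A a = B a))"
  using pf_conj[OF pf_le[OF assms] pf_le[OF assms(2,1)]] by (simp add: eq_iff)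

lemma pf_iff:
  assumes "pf vs W (\<lambda>a. of_bool (P a))" "pf vs W (\<lambda>a. of_bool (Q a))"
  shows "pf vs W (\<lambda>a. of_bool (P a \<longleftrightarrow> Q a))"
  using pf_eq[OF assms] by (simp only: of_bool_eq_iff)

lemma pf_if:
  assumes "pf vs W (\<lambda>a. of_bool (P a))" "pf vs W A" "pf vs W B"
  shows "pf vs W (\<lambda>a. if P a then A a else B a)"
proof -
  have "(if P a then A a else B a) = of_bool (P a) * A a + of_bool (\<not> P a) * B a" for a by simp
  then show ?thesis using assms by (simp only: pf_add pf_mult pf_not)
qed

lemma pf_sum:
  assumes n: "pf vs W n"
    and F: "pf (snd # map (\<lambda>v p. v (fst p)) vs) (\<lambda>p. W (fst p)) (\<lambda>p. F (fst p) (snd p))"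
  shows "pf vs W (\<lambda>a. \<Sum>i<n a. F a i)"
proof -
  have eq: "rec_nat 0 (\<lambda>i s. s + F a i) n = (\<Sum>i<n. F a i)" for a n by (induction n) auto
  obtain p where p: "\<And>a. F (fst a) (snd a) \<le> poly p (sz (snd # map (\<lambda>v p. v (fst p)) vs) (\<lambda>p. W (fst p)) a)"
    using pf_pbd[OF F] unfolding pbd_def by blast
  have b: "(\<Sum>i<m. F a i) \<le> n a * poly p (sz vs W a + n a)" if m: "m \<le> n a" for a m
  proof -
    have "F a i \<le> poly p (sz vs W a + n a)" if "i < m" for i
      using that m order_trans[OF p[of "(a, i)"] poly_mono_nat[of _ "sz vs W a + n a" p]]
      by (simp add: sz_def comp_def)
    then have "(\<Sum>i<m. F a i) \<le> m * poly p (sz vs W a + n a)"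
      using sum_bounded_above[of "{..<m}" "F a" "poly p (sz vs W a + n a)"] by simp
    also have "\<dots> \<le> n a * poly p (sz vs W a + n a)" using m by simp
    finally show ?thesis .
  qed
  have F': "pf ((\<lambda>p. fst (snd p)) # (\<lambda>p. snd (snd p)) # map (\<lambda>v p. v (fst p)) vs) (\<lambda>p. W (fst p))
      (\<lambda>p. F (fst p) (fst (snd p)))"
    by (rule pf_weaken[OF F, where g = "\<lambda>p. (fst p, fst (snd p))", unfolded fst_conv snd_conv]) auto
  have "pf vs W (\<lambda>a. rec_nat 0 (\<lambda>i s. s + F a i) (n a))"
    by (rule pf_rec_nat[where f = "\<lambda>a i s. s + F a i" and z = "\<lambda>_. 0"
          and B = "\<lambda>a. n a * poly p (sz vs W a + n a)"])
      (rule n pf_0 pf_add F' pbd_rules pf_pbd | (rule pf_var, simp; fail) | simp add: eq b)+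
  then show ?thesis by (simp only: eq)
qed

lemma pf_ex:
  assumes n: "pf vs W n"
    and P: "pf (snd # map (\<lambda>v p. v (fst p)) vs) (\<lambda>p. W (fst p)) (\<lambda>p. of_bool (P (fst p) (snd p)))"
  shows "pf vs W (\<lambda>a. of_bool (\<exists>i<n a. P a i))"
proof -
  have "of_bool (\<exists>i<n a. P a i) = (of_bool (\<not> (\<Sum>i<n a. of_bool (P a i) :: nat) = 0) :: nat)" for a
    by auto
  then show ?thesis
    by (simp only:) (rule pf_not, rule pf_eq_0, rule pf_sum, rule n, rule P)
qed

lemma pf_all:
  assumes n: "pf vs W n"
    and P: "pf (snd # map (\<lambda>v p. v (fst p)) vs) (\<lambda>p. W (fst p)) (\<lambda>p. of_bool (P (fst p) (snd p)))"
  shows "pf vs W (\<lambda>a. of_bool (\<forall>i<n a. P a i))"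
proof -
  have "pf vs W (\<lambda>a. of_bool (\<not> (\<exists>i<n a. \<not> P a i)))"
    by (rule pf_not, rule pf_ex, rule n, rule pf_not, rule P)
  then show ?thesis by simp
qed

text \<open>The quotient counts the positive multiples of \<open>n\<close> up to \<open>m\<close>;
  the guard \<open>0 < n\<close> reproduces division by zero.\<close>

lemma div_conv_sum: "(m :: nat) div n = (\<Sum>i<m. of_bool (0 < n \<and> Suc i * n \<le> m))"
proof (cases "n = 0")
  case False
  have "{i. i < m \<and> Suc i * n \<le> m} = {..<m div n}"
  proof -
    have "Suc i * n \<le> m \<longleftrightarrow> i < m div n" for i
      using False by (metis Suc_le_eq gr0I less_eq_div_iff_mult_less_eq)
    moreover have "i < m div n \<Longrightarrow> i < m" for i
      using div_le_dividend less_le_trans by blast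
    ultimately show ?thesis by auto
  qed
  then show ?thesis using False by (simp add: sum.If_cases of_bool_def Int_def)
qed simp

lemmas pf_rules = pf_const pf_Suc pf_add pf_mult pf_diff pf_not pf_conj pf_disj pf_imp pf_le pf_less
  pf_eq pf_iff pf_if pf_sum pf_ex pf_all pf_sym pf_length

lemma pf_div:
  assumes "pf vs W A" "pf vs W B"
  shows "pf vs W (\<lambda>a. A a div B a)"
  unfolding div_conv_sum
  by (assumption | rule assms pf_rules | (rule pf_var, simp; fail) | rule pf_lift)+

lemma pf_mod:
  assumes "pf vs W A" "pf vs W B"
  shows "pf vs W (\<lambda>a. A a mod B a)"
  unfolding minus_div_mult_eq_mod[symmetric]
  by (assumption | rule assms pf_rules pf_div | (rule pf_var, simp; fail) | rule pf_lift)+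

lemma pf_odd: "pf vs W A \<Longrightarrow> pf vs W (\<lambda>a. of_bool (odd (A a)))"
  unfolding odd_iff_mod_2_eq_one by (intro pf_eq pf_mod pf_const)

lemma pf_power: "pf vs W A \<Longrightarrow> pf vs W (\<lambda>a. A a ^ k)"
  by (induction k) (auto intro: pf_const[of _ _ 1, simplified] pf_mult)

lemma pf_poly: "pf vs W A \<Longrightarrow> pf vs W (\<lambda>a. poly p (A a))"
  by (induction p) (auto intro: pf_const pf_add pf_mult)

lemma pf_funpow:
  assumes n: "pf vs W n" and z: "pf vs W z"
    and f: "pf (snd # map (\<lambda>v p. v (fst p)) vs) (\<lambda>p. W (fst p)) (\<lambda>p. f (fst p) (snd p))"
    and B: "pf vs W B" "\<And>a i. i \<le> n a \<Longrightarrow> (f a ^^ i) (z a) \<le> B a"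
  shows "pf vs W (\<lambda>a. (f a ^^ n a) (z a))"
proof -
  have eq: "rec_nat (z a) (\<lambda>i s. f a s) n = (f a ^^ n) (z a)" for a n by (induction n) auto
  have f': "pf ((\<lambda>p. fst (snd p)) # (\<lambda>p. snd (snd p)) # map (\<lambda>v p. v (fst p)) vs) (\<lambda>p. W (fst p))
      (\<lambda>p. f (fst p) (snd (snd p)))"
    by (rule pf_weaken[OF f, where g = "\<lambda>p. (fst p, snd (snd p))", unfolded fst_conv snd_conv]) auto
  have "pf vs W (\<lambda>a. rec_nat (z a) (\<lambda>i s. f a s) (n a))"
    by (rule pf_rec_nat[where f = "\<lambda>a i s. f a s" and z = z and B = B])
      (rule n z f' pf_pbd B | simp add: eq B)+
  then show ?thesis by (simp only: eq)
qed

section \<open>Local sets\<close>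

lemma odd_card_sym_diff:
  assumes "finite A" "finite B"
  shows "odd (card (sym_diff A B)) \<longleftrightarrow> odd (card A) \<noteq> odd (card B)"
proof -
  have "card (sym_diff A B) = card (A - B) + card (B - A)"
    by (rule card_Un_disjoint) (use assms in auto)
  moreover have "card A = card (A - B) + card (A \<inter> B)" "card B = card (B - A) + card (A \<inter> B)"
    using assms by (metis card_Int_Diff add.commute, metis card_Int_Diff add.commute inf_commute)
  ultimately show ?thesis by (simp only: even_add) blast
qed

context
  fixes G :: "'a graph"
  assumes G: "simple_graph G"
begin

lemma nbD: "v \<in> neighborhood G u \<Longrightarrow> u \<in> verts G \<and> v \<in> verts G \<and> u \<noteq> v"
  using G unfolding simple_graph_def neighborhood_def by (fastforce simp: doubleton_eq_iff)

lemma nb_sym: "v \<in> neighborhood G u \<longleftrightarrow> u \<in> neighborhood G v"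
  by (simp add: neighborhood_def insert_commute)

lemma finite_verts: "finite (verts G)"
  using G by (simp add: simple_graph_def)

lemma finite_nb: "finite (neighborhood G u)"
  by (rule finite_subset[OF _ finite_verts]) (use nbD in auto)

end

lemma verts_lc: "verts (local_complement G u) = verts G"
  by (simp add: local_complement_def)

lemma in_complete_edges: "{v, w} \<in> complete_edges S \<longleftrightarrow> v \<in> S \<and> w \<in> S \<and> v \<noteq> w"
  by (auto simp: complete_edges_def doubleton_eq_iff)

lemma simple_lc:
  assumes "simple_graph G"
  shows "simple_graph (local_complement G u)"
proof -
  have "\<exists>x \<in> verts G. \<exists>y \<in> verts G. x \<noteq> y \<and> e = {x, y}"
    if "e \<in> edges (local_complement G u)" for e
  proof -
    have "e \<in> edges G \<or> e \<in> complete_edges (neighborhood G u)"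
      using that by (auto simp: local_complement_def)
    then show ?thesis
    proof
      assume "e \<in> edges G"
      then show ?thesis using assms by (simp add: simple_graph_def)
    next
      assume "e \<in> complete_edges (neighborhood G u)"
      then obtain x y where "x \<in> neighborhood G u" "y \<in> neighborhood G u" "x \<noteq> y" "e = {x, y}"
        by (auto simp: complete_edges_def)
      then show ?thesis using nbD[OF assms] by blast
    qed
  qed
  then show ?thesis
    using assms by (auto simp: simple_graph_def verts_lc)
qed

lemma nb_lc:
  assumes "simple_graph G"
  shows "neighborhood (local_complement G u) v =
    (if v \<in> neighborhood G u then sym_diff (neighborhood G v) (neighborhood G u - {v})
     else neighborhood G v)"
proof -
  have "w \<in> neighborhood (local_complement G u) v \<longleftrightarrow> (w \<in> neighborhood G v) \<noteq>
      ({v, w} \<in> complete_edges (neighborhood G u))" for w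
    by (auto simp: neighborhood_def[of _ v] local_complement_def)
  then show ?thesis
    using nbD[OF assms, of v v] unfolding in_complete_edges by (auto split: if_splits)
qed

lemma lc_lc:
  assumes "simple_graph G"
  shows "local_complement (local_complement G u) u = G"
proof -
  have n: "neighborhood (local_complement G u) u = neighborhood G u"
    using nb_lc[OF assms, of u u] nbD[OF assms, of u u] by auto
  show ?thesis
    unfolding local_complement_def[of "local_complement G u"] n
    by (rule graph.equality) (auto simp: local_complement_def)
qed

definition odd_nb :: "'a graph \<Rightarrow> 'a set \<Rightarrow> 'a set" where
  "odd_nb G D = {v. odd (card (neighborhood G v \<inter> D))}"

lemma odd_nb_subset:
  assumes "simple_graph G"
  shows "odd_nb G D \<subseteq> verts G"
proof
  fix v assume "v \<in> odd_nb G D"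
  then have "neighborhood G v \<inter> D \<noteq> {}" by (auto simp: odd_nb_def)
  then show "v \<in> verts G" using nbD[OF assms] by blast
qed

text \<open>The sets \<open>D \<union> odd_nb G D\<close> are invariant under local complementation; when \<open>u\<close> has oddly many
  neighbours in \<open>D\<close>, the set representing the same union is the symmetric difference of \<open>D\<close>
  and \<open>{u}\<close>.\<close>

lemma odd_nb_lc:
  assumes G: "simple_graph G" and D: "finite D"
    and D': "D' = (if u \<in> odd_nb G D then sym_diff D {u} else D)"
  shows "v \<in> odd_nb (local_complement G u) D' \<longleftrightarrow>
    (v \<in> odd_nb G D) \<noteq> (v \<in> neighborhood G u \<and> v \<in> D)"
proof -
  have fD': "finite D'" using D D' by auto
  have dist: "sym_diff A B \<inter> C = sym_diff (A \<inter> C) (B \<inter> C)" for A B C :: "'a set" by auto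
  have 1: "odd (card (neighborhood G v \<inter> D')) \<longleftrightarrow>
      (v \<in> odd_nb G D) \<noteq> (u \<in> odd_nb G D \<and> v \<in> neighborhood G u)"
  proof (cases "u \<in> odd_nb G D")
    case True
    have "neighborhood G v \<inter> D' = sym_diff (neighborhood G v \<inter> D) (neighborhood G v \<inter> {u})"
      using True D' by auto
    moreover have "odd (card (neighborhood G v \<inter> {u})) \<longleftrightarrow> v \<in> neighborhood G u"
      using nb_sym[OF G, of u v] by (cases "u \<in> neighborhood G v") auto
    ultimately show ?thesis
      using True odd_card_sym_diff[of "neighborhood G v \<inter> D" "neighborhood G v \<inter> {u}"] D
      by (simp add: odd_nb_def)
  qed (simp add: D' odd_nb_def)
  show ?thesis
  proof (cases "v \<in> neighborhood G u")
    case False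
    then show ?thesis
      using 1 by (simp add: odd_nb_def nb_lc[OF G])
  next
    case True
    then have vu: "v \<noteq> u" using nbD[OF G] by auto
    have "(neighborhood G u - {v}) \<inter> D' = (neighborhood G u \<inter> D) - {v}"
      using D' nbD[OF G, of u u] by auto
    also have "\<dots> = sym_diff (neighborhood G u \<inter> D) ({v} \<inter> D)" using True by auto
    finally have "odd (card ((neighborhood G u - {v}) \<inter> D')) \<longleftrightarrow> (u \<in> odd_nb G D) \<noteq> (v \<in> D)"
      using odd_card_sym_diff[of "neighborhood G u \<inter> D" "{v} \<inter> D"] D
      by (cases "v \<in> D") (auto simp: odd_nb_def)
    then have "v \<in> odd_nb (local_complement G u) D' \<longleftrightarrow>
        ((v \<in> odd_nb G D) \<noteq> (u \<in> odd_nb G D)) \<noteq> ((u \<in> odd_nb G D) \<noteq> (v \<in> D))"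
      using odd_card_sym_diff[of "neighborhood G v \<inter> D'" "(neighborhood G u - {v}) \<inter> D'"] fD' 1 True
      by (simp add: odd_nb_def[of "local_complement G u"] nb_lc[OF G] dist)
    then show ?thesis using True by auto
  qed
qed

text \<open>Only vertices of \<open>D\<close> change their parity, and these lie in the union
  anyway. \<open>D\<close> itself changes at most in \<open>u\<close>, and then \<open>u\<close> has
  odd parity before and after.\<close>

lemma Un_odd_nb_lc:
  assumes G: "simple_graph G" and D: "finite D"
    and D': "D' = (if u \<in> odd_nb G D then sym_diff D {u} else D)"
  shows "D' \<union> odd_nb (local_complement G u) D' = D \<union> odd_nb G D"
proof -
  have "v \<in> D' \<union> odd_nb (local_complement G u) D' \<longleftrightarrow> v \<in> D \<union> odd_nb G D" for v
    using odd_nb_lc[OF assms, of v] D' nbD[OF G, of u u] by (cases "v = u") auto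
  then show ?thesis by blast
qed

definition local_set_le :: "'a graph \<Rightarrow> nat \<Rightarrow> bool" where
  "local_set_le G k \<longleftrightarrow> (\<exists>D. D \<noteq> {} \<and> D \<subseteq> verts G \<and> card (D \<union> odd_nb G D) \<le> k)"

lemma local_set_le_lc:
  assumes G: "simple_graph G" and u: "u \<in> verts G" and "local_set_le G k"
  shows "local_set_le (local_complement G u) k"
proof -
  obtain D where D: "D \<noteq> {}" "D \<subseteq> verts G" "card (D \<union> odd_nb G D) \<le> k"
    using assms(3) by (auto simp: local_set_le_def)
  have fD: "finite D" using D(2) finite_verts[OF G] finite_subset by blast
  define D' where "D' = (if u \<in> odd_nb G D then sym_diff D {u} else D)"
  have "neighborhood G u \<inter> {u} = {}" using nbD[OF G, of u u] by auto
  then have "u \<notin> odd_nb G {u}" by (simp add: odd_nb_def)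
  \<comment> \<open>The new set could be empty only for \<open>D = {u}\<close>, but \<open>u\<close>
    is no neighbour of itself.\<close>
  then have "D \<noteq> {u}" if "u \<in> odd_nb G D" using that by metis
  then have "D' \<noteq> {}" using D(1) by (auto simp: D'_def)
  moreover have "D' \<subseteq> verts G" using D(2) u by (auto simp: D'_def)
  ultimately show ?thesis
    using D(3) Un_odd_nb_lc[OF G fD D'_def] unfolding local_set_le_def verts_lc by metis
qed

lemma locally_equivalent_simple:
  assumes "locally_equivalent G G'" "simple_graph G"
  shows "simple_graph G' \<and> verts G' = verts G"
  using assms(1) unfolding locally_equivalent_def
proof (induction rule: rtranclp_induct)
  case (step y z)
  obtain u where "z = local_complement y u" using step(2) unfolding local_step_def by blast
  then show ?case using step.IH simple_lc[of y u] by (simp add: verts_lc)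
qed (use assms in simp)

lemma local_set_le_equivalent:
  assumes "locally_equivalent G G'" "simple_graph G" "local_set_le G' k"
  shows "local_set_le G k"
  using assms(1,3) unfolding locally_equivalent_def
proof (induction rule: rtranclp_induct)
  case (step y z)
  have y: "simple_graph y"
    using step(1) locally_equivalent_simple[of G y] assms(2) by (simp add: locally_equivalent_def)
  obtain u where u: "u \<in> verts y" "z = local_complement y u" using step(2) by (auto simp: local_step_def)
  have "local_set_le (local_complement z u) k"
    using local_set_le_lc[of z u k] step.prems u y simple_lc[of y u] by (simp add: verts_lc)
  then show ?case using step.IH lc_lc[OF y] u by simp
qed

lemma locally_equivalent_lc:
  "u \<in> verts G \<Longrightarrow> locally_equivalent (local_complement G u) G' \<Longrightarrow> locally_equivalent G G'"
  unfolding locally_equivalent_def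
  by (rule converse_rtranclp_into_rtranclp) (auto simp: local_step_def)

text \<open>If some \<open>u\<close> in \<open>D\<close> has odd parity, complementing at
  \<open>u\<close> removes it from \<open>D\<close>. If some \<open>u\<close> in \<open>D\<close> is
  even and has a neighbour \<open>w\<close> that is even too, complementing at \<open>w\<close>
  keeps \<open>D\<close> and makes \<open>u\<close> odd. If neither applies, all neighbourhoods of
  members of \<open>D\<close> lie in \<open>odd_nb G D\<close>, so any member has its closed
  neighbourhood inside the union.\<close>

lemma local_set_shrink:
  assumes "simple_graph G" "D \<noteq> {}" "D \<subseteq> verts G"
  shows "\<exists>G' v. locally_equivalent G G' \<and> v \<in> verts G \<and>
    card (insert v (neighborhood G' v)) \<le> card (D \<union> odd_nb G D)"
  using assms
proof (induction "card D" arbitrary: G D rule: less_induct)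
  case less
  note G = less.prems(1)
  have fD: "finite D" using less.prems finite_verts[OF G] finite_subset by blast
  have shrink: "\<exists>G' v. locally_equivalent H G' \<and> v \<in> verts H \<and>
      card (insert v (neighborhood G' v)) \<le> card (D \<union> odd_nb H D)"
    if H: "simple_graph H" "verts H = verts G" and u: "u \<in> D" "u \<in> odd_nb H D" for H u
  proof -
    let ?D = "sym_diff D {u}"
    have "neighborhood H u \<inter> {u} = {}" using nbD[OF H(1), of u u] by auto
    then have "u \<notin> odd_nb H {u}" by (simp add: odd_nb_def)
    then have "D \<noteq> {u}" using u(2) by metis
    then have D: "?D \<noteq> {}" "?D \<subseteq> verts (local_complement H u)"
      using u less.prems(3) H(2) by (auto simp: verts_lc)
    have "?D = D - {u}" using u by auto
    then have "card ?D < card D" using card_Diff1_less[OF fD u(1)] by simp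
    from less.hyps[OF this simple_lc[OF H(1)] D] obtain G' v where
      "locally_equivalent (local_complement H u) G'" "v \<in> verts H"
      "card (insert v (neighborhood G' v)) \<le> card (?D \<union> odd_nb (local_complement H u) ?D)"
      by (auto simp: verts_lc)
    moreover have "u \<in> verts H" using u(1) less.prems(3) H(2) by auto
    ultimately show ?thesis
      using Un_odd_nb_lc[OF H(1) fD, of ?D u] u(2) locally_equivalent_lc[of u H G']
      by (intro exI[of _ G'] exI[of _ v]) simp
  qed
  consider u where "u \<in> D" "u \<in> odd_nb G D"
    | u w where "u \<in> D" "u \<notin> odd_nb G D" "w \<in> neighborhood G u" "w \<notin> odd_nb G D"
    | "\<forall>u \<in> D. neighborhood G u \<subseteq> odd_nb G D" by blast
  then show ?case
  proof cases
    case 1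
    then show ?thesis using shrink[OF G] by simp
  next
    case 2
    let ?H = "local_complement G w"
    have "u \<in> odd_nb ?H D"
      using odd_nb_lc[OF G fD, of D w u] 2 nb_sym[OF G] by simp
    from shrink[OF simple_lc[OF G] verts_lc 2(1) this] obtain G' v where
      "locally_equivalent ?H G'" "v \<in> verts G"
      "card (insert v (neighborhood G' v)) \<le> card (D \<union> odd_nb ?H D)"
      by (auto simp: verts_lc)
    moreover have "w \<in> verts G" using 2(3) nbD[OF G] by blast
    ultimately show ?thesis
      using Un_odd_nb_lc[OF G fD, of D w] 2(4) locally_equivalent_lc[of w G G']
      by (intro exI[of _ G'] exI[of _ v]) simp
  next
    case 3
    obtain u where u: "u \<in> D" using less.prems by auto
    have "finite (D \<union> odd_nb G D)"
      using fD odd_nb_subset[OF G] finite_verts[OF G] finite_subset by blast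
    then have "card (insert u (neighborhood G u)) \<le> card (D \<union> odd_nb G D)"
      by (rule card_mono) (use u 3 in auto)
    then show ?thesis using u less.prems(3) unfolding locally_equivalent_def by blast
  qed
qed

text \<open>A vertex \<open>v\<close> of a locally equivalent graph gives the set
  \<open>{v}\<close>, whose union with its odd neighbourhood is the closed neighbourhood, and
  invariance carries it back to \<open>G\<close>; conversely every set shrinks to a closed
  neighbourhood. The vertex itself accounts for the \<open>+ 1\<close>.\<close>

theorem local_min_degree_le_iff:
  assumes G: "simple_graph G" and ne: "verts G \<noteq> {}"
  shows "local_min_degree G \<le> d \<longleftrightarrow> local_set_le G (d + 1)"
proof -
  let ?S = "{min_degree G' | G'. locally_equivalent G G'}"
  have md: "min_degree G' \<le> k \<longleftrightarrow> (\<exists>v \<in> verts G. degree G' v \<le> k)"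
    if "locally_equivalent G G'" for G' k
    using locally_equivalent_simple[OF that G] ne finite_verts[OF G]
    by (auto simp: min_degree_def Min_le_iff)
  have deg: "card (insert v (neighborhood G' v)) = degree G' v + 1"
    if "locally_equivalent G G'" for G' v
  proof -
    have "simple_graph G'" using locally_equivalent_simple[OF that G] by simp
    then have "finite (neighborhood G' v)" "v \<notin> neighborhood G' v"
      using finite_nb[of G' v] nbD[of G' v v] by auto
    then show ?thesis unfolding Defs.degree_def by simp
  qed
  have "min_degree G' \<le> card (verts G)" if "locally_equivalent G G'" for G'
  proof -
    have "neighborhood G' v \<subseteq> verts G" for v
      using locally_equivalent_simple[OF that G] nbD[of G'] by auto
    then show ?thesis
      using md[OF that] ne card_mono[OF finite_verts[OF G]] by (auto simp: Defs.degree_def)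
  qed
  \<comment> \<open>\<open>Min\<close> is meaningful only on finite sets, which is secured by
    bounding the values rather than the number of equivalent graphs.\<close>
  then have "?S \<subseteq> {..card (verts G)}" by auto
  then have fin: "finite ?S" using finite_subset by blast
  have "locally_equivalent G G" by (simp add: locally_equivalent_def)
  then have "?S \<noteq> {}" by blast
  then have "local_min_degree G \<le> d \<longleftrightarrow> (\<exists>G'. locally_equivalent G G' \<and> (\<exists>v \<in> verts G. degree G' v \<le> d))"
    using fin md by (auto simp: local_min_degree_def Min_le_iff)
  also have "\<dots> \<longleftrightarrow> local_set_le G (d + 1)"
  proof
    assume "\<exists>G'. locally_equivalent G G' \<and> (\<exists>v \<in> verts G. degree G' v \<le> d)"
    then obtain G' v where G': "locally_equivalent G G'" "v \<in> verts G" "degree G' v \<le> d" by blast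
    have s: "simple_graph G'" "verts G' = verts G" using locally_equivalent_simple[OF G'(1) G] by auto
    have "odd_nb G' {v} = neighborhood G' v"
    proof -
      have "w \<in> odd_nb G' {v} \<longleftrightarrow> w \<in> neighborhood G' v" for w
        using nb_sym[OF s(1), of v w] by (cases "v \<in> neighborhood G' w") (auto simp: odd_nb_def)
      then show ?thesis by blast
    qed
    then have "local_set_le G' (d + 1)"
      unfolding local_set_le_def using G' s deg[OF G'(1), of v] by (intro exI[of _ "{v}"]) simp
    then show "local_set_le G (d + 1)" using local_set_le_equivalent[OF G'(1) G] by simp
  next
    assume "local_set_le G (d + 1)"
    then obtain D where D: "D \<noteq> {}" "D \<subseteq> verts G" "card (D \<union> odd_nb G D) \<le> d + 1"
      by (auto simp: local_set_le_def)
    from local_set_shrink[OF G D(1,2)] obtain G' v where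
      "locally_equivalent G G'" "v \<in> verts G" "card (insert v (neighborhood G' v)) \<le> d + 1"
      using D(3) by fastforce
    then show "\<exists>G'. locally_equivalent G G' \<and> (\<exists>v \<in> verts G. degree G' v \<le> d)"
      using deg by auto
  qed
  finally show ?thesis .
qed

section \<open>Near pairwise independence of the hash functions \<open>x * i + b\<close> modulo
  \<open>W\<close>\<close>

lemma card_Collect_shift:
  fixes W c :: nat
  shows "card {b. b < W \<and> P ((c + b) mod W)} = card {u. u < W \<and> P u}"
proof (cases "W = 0")
  case False
  let ?f = "\<lambda>b. (c + b) mod W"
  have inj: "inj_on ?f {..<W}"
    by (rule inj_onI) (metis cong_def cong_add_lcancel_nat lessThan_iff mod_less)
  have im: "?f ` {..<W} = {..<W}"
    by (rule endo_inj_surj) (use False inj in auto)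
  have "?f ` {b. b < W \<and> P (?f b)} = {u. u < W \<and> P u}"
  proof (intro equalityI subsetI)
    fix u assume u: "u \<in> {u. u < W \<and> P u}"
    then obtain b where "b < W" "u = ?f b" using im by (metis (no_types, lifting) imageE lessThan_iff mem_Collect_eq)
    then show "u \<in> ?f ` {b. b < W \<and> P (?f b)}" using u by auto
  qed (use False in auto)
  moreover have "card (?f ` {b. b < W \<and> P (?f b)}) = card {b. b < W \<and> P (?f b)}"
    by (rule card_image, rule inj_on_subset[OF inj]) auto
  ultimately show ?thesis by simp
qed simp

text \<open>With \<open>g = gcd z W\<close>, all values \<open>x * z + u\<close> modulo
  \<open>W\<close> lie in one residue class modulo \<open>g\<close>. As \<open>g\<close> divides
  \<open>l\<close>, that class has \<open>l div g\<close> members below \<open>l\<close>, and each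
  is attained by at most \<open>g\<close> values of \<open>x\<close>.\<close>

lemma card_multiples_le:
  fixes W z u l :: nat
  assumes W: "0 < W" and g: "gcd z W dvd l"
  shows "card {x. x < W \<and> (x * z + u) mod W < l} \<le> l"
proof -
  define g where "g = gcd z W"
  define V where "V = W div g"
  define z' where "z' = z div g"
  have gp: "0 < g" using W by (simp add: g_def)
  have WV: "W = g * V" and zz: "z = g * z'" by (simp_all add: g_def V_def z'_def)
  have V: "0 < V" using W WV by (metis gr0I mult_0_right)
  have cop: "coprime z' V"
    unfolding z'_def V_def g_def using W by (metis div_gcd_coprime neq0_conv)
  let ?A = "{x. x < W \<and> (x * z + u) mod W < l}"
  let ?t = "\<lambda>x. (x * z + u) mod W"
  let ?f = "\<lambda>x. (?t x div g, x div V)"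
  have tg: "?t x mod g = u mod g" for x
  proof -
    have "?t x mod g = (x * z + u) mod g" by (simp add: WV mod_mult2_eq)
    also have "\<dots> = u mod g" by (simp add: zz mod_add_left_eq mult.assoc mult.left_commute)
    finally show ?thesis .
  qed
  have inj: "inj_on ?f ?A"
  proof (rule inj_onI)
    fix x y assume "x \<in> ?A" "y \<in> ?A" and e: "?f x = ?f y"
    have "?t x div g = ?t y div g" using e by simp
    then have "?t x = ?t y" using tg by (metis div_mult_mod_eq)
    then have "[x * z = y * z] (mod W)" using cong_add_rcancel_nat[of "x * z" u "y * z" W] by (simp add: cong_def)
    then have "[g * (x * z') = g * (y * z')] (mod (g * V))" by (simp add: zz WV mult.left_commute)
    then have "[x * z' = y * z'] (mod V)" using gp by (simp add: cong_def mult_mod_right[symmetric])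
    then have "[x = y] (mod V)" using cong_mult_rcancel_nat[of z' V x y] cop by (simp add: coprime_commute)
    then have "x mod V = y mod V" by (simp add: cong_def)
    then show "x = y" using e by (metis div_mult_mod_eq prod.inject)
  qed
  have im: "?f ` ?A \<subseteq> {..<l div g} \<times> {..<g}"
  proof
    fix p assume "p \<in> ?f ` ?A"
    then obtain x where x: "p = ?f x" "x < W" "?t x < l" by blast
    have "?t x div g < l div g"
      using x(3) g gp g_def by (metis dvd_div_mult_self less_mult_imp_div_less)
    moreover have "x div V < g" using x(2) WV by (simp add: less_mult_imp_div_less)
    ultimately show "p \<in> {..<l div g} \<times> {..<g}" using x(1) by simp
  qed
  have "card ?A \<le> card ({..<l div g} \<times> {..<g})"
    by (rule card_inj_on_le[OF inj im]) simp
  also have "\<dots> = l" using g by (simp add: g_def)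
  finally show ?thesis .
qed

lemma card_sigma_nat:
  fixes A B :: nat
  shows "card {(x, y). x < A \<and> y < B \<and> P x y} = (\<Sum>x<A. card {y. y < B \<and> P x y})"
proof -
  have "{(x, y). x < A \<and> y < B \<and> P x y} = (SIGMA x:{..<A}. {y. y < B \<and> P x y})" by auto
  then show ?thesis by simp
qed

lemma card_hit:
  fixes W l i :: nat
  assumes "l \<le> W"
  shows "card {(x, b). x < W \<and> b < W \<and> (x * i + b) mod W < l} = W * l"
proof -
  have "card {b. b < W \<and> (x * i + b) mod W < l} = l" for x
  proof -
    have "{u. u < W \<and> u < l} = {..<l}" using assms by auto
    then show ?thesis using card_Collect_shift[of W "\<lambda>u. u < l" "x * i"] by simp
  qed
  then show ?thesis by (simp add: card_sigma_nat)
qed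

text \<open>For fixed \<open>x\<close>, replacing \<open>b\<close> by the hash value
  \<open>u\<close> of \<open>i\<close> is a bijection, and the hash value of \<open>j\<close>
  becomes \<open>x * (j - i) + u\<close>. Each \<open>u < l\<close> then allows at most
  \<open>l\<close> values of \<open>x\<close>.\<close>

lemma card_hit2_less:
  fixes W l i j :: nat
  assumes W: "0 < W" and l: "l \<le> W" "gcd (j - i) W dvd l" and ij: "i < j"
  shows "card {(x, b). x < W \<and> b < W \<and> (x * i + b) mod W < l \<and> (x * j + b) mod W < l} \<le> l * l"
proof -
  define z where "z = j - i"
  have "(x * j + b) mod W = (x * z + (x * i + b) mod W) mod W" for x b
  proof -
    have "x * j + b = x * z + (x * i + b)" using ij by (simp add: z_def flip: add_mult_distrib2 add.assoc)
    then show ?thesis by (simp add: mod_add_right_eq add.assoc)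
  qed
  then have "card {b. b < W \<and> (x * i + b) mod W < l \<and> (x * j + b) mod W < l} =
      card {u. u < W \<and> u < l \<and> (x * z + u) mod W < l}" for x
    using card_Collect_shift[of W "\<lambda>u. u < l \<and> (x * z + u) mod W < l" "x * i"] by simp
  moreover have "{u. u < W \<and> u < l \<and> Q u} = {u. u < l \<and> Q u}" for Q using l by auto
  ultimately have "card {(x, b). x < W \<and> b < W \<and> (x * i + b) mod W < l \<and> (x * j + b) mod W < l} =
      (\<Sum>x<W. card {u. u < l \<and> (x * z + u) mod W < l})"
    by (simp add: card_sigma_nat)
  also have "\<dots> = card {(x, u). x < W \<and> u < l \<and> (x * z + u) mod W < l}"
    by (simp add: card_sigma_nat)
  also have "\<dots> = card {(u, x). u < l \<and> x < W \<and> (x * z + u) mod W < l}"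
    by (rule bij_betw_same_card[of prod.swap]) (auto simp: bij_betw_def inj_on_def image_iff)
  also have "\<dots> = (\<Sum>u<l. card {x. x < W \<and> (x * z + u) mod W < l})"
    by (simp add: card_sigma_nat)
  also have "\<dots> \<le> (\<Sum>u<l. l)"
    by (rule sum_mono) (use card_multiples_le[OF W, of z l] l in \<open>simp add: z_def\<close>)
  finally show ?thesis by simp
qed

lemma card_hit2:
  fixes W l i j :: nat
  assumes "0 < W" "l \<le> W" "i \<noteq> j" "\<And>z. 0 < z \<Longrightarrow> z < n \<Longrightarrow> gcd z W dvd l" "i < n" "j < n"
  shows "card {(x, b). x < W \<and> b < W \<and> (x * i + b) mod W < l \<and> (x * j + b) mod W < l} \<le> l * l"
proof (cases "i < j")
  case True
  then show ?thesis using assms by (intro card_hit2_less) auto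
next
  case False
  then show ?thesis
    using card_hit2_less[of W l i j] assms by (simp add: conj_commute)
qed

text \<open>Second moment argument: if \<open>p\<close> lies in \<open>m\<close> of the sets, then
  \<open>m - (m^2 - m)\<close> is \<open>0\<close> for \<open>m = 0\<close>, \<open>1\<close> for
  \<open>m = 1\<close> and not positive otherwise, hence at most the parity of \<open>m\<close>.
  Summing over \<open>p\<close> turns \<open>m\<close> and \<open>m^2\<close> into sizes of sets and
  of pairwise intersections.\<close>

lemma isolation:
  fixes A :: "'b \<Rightarrow> 'c set" and a c :: int
  assumes fin: "finite U" "finite S" and A: "\<And>i. i \<in> S \<Longrightarrow> A i \<subseteq> U"
    and a: "\<And>i. i \<in> S \<Longrightarrow> int (card (A i)) = a"
    and c: "\<And>i j. i \<in> S \<Longrightarrow> j \<in> S \<Longrightarrow> i \<noteq> j \<Longrightarrow> int (card (A i \<inter> A j)) \<le> c" and c0: "0 \<le> c"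
  shows "int (card {p \<in> U. odd (card {i \<in> S. p \<in> A i})}) \<ge> int (card S) * a - (int (card S) * int (card S)) * c"
proof -
  let ?m = "\<lambda>p. card {i \<in> S. p \<in> A i}"
  have pt: "int (?m p) - (int (?m p) * int (?m p) - int (?m p)) \<le> of_bool (odd (?m p))" for p
  proof -
    consider "?m p = 0" | "?m p = 1" | "?m p \<ge> 2" by linarith
    then show ?thesis
    proof cases
      case 3
      then have "2 * int (?m p) \<le> int (?m p) * int (?m p)" by (intro mult_right_mono) auto
      then show ?thesis by auto
    qed auto
  qed
  have m: "int (?m p) = (\<Sum>i\<in>S. of_bool (p \<in> A i))" for p
    using fin(2) by (simp add: sum.If_cases of_bool_def Int_def)
  have cA: "int (card (A i)) = (\<Sum>p\<in>U. of_bool (p \<in> A i))" if "i \<in> S" for i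
  proof -
    have "A i = {p \<in> U. p \<in> A i}" using A[OF that] by auto
    then show ?thesis using fin(1) by (simp add: sum.If_cases of_bool_def Int_def)
  qed
  have cAA: "int (card (A i \<inter> A j)) = (\<Sum>p\<in>U. of_bool (p \<in> A i) * of_bool (p \<in> A j))"
    if "i \<in> S" for i j
  proof -
    have "A i \<inter> A j = {p \<in> U. p \<in> A i \<and> p \<in> A j}" using A[OF that] by auto
    moreover have "(\<Sum>p\<in>U. of_bool (p \<in> A i) * of_bool (p \<in> A j)) =
        (\<Sum>p\<in>U. of_bool (p \<in> A i \<and> p \<in> A j) :: int)" by (simp only: of_bool_conj)
    ultimately show ?thesis using fin(1) by (simp add: sum.If_cases of_bool_def Int_def)
  qed
  have s1: "(\<Sum>p\<in>U. int (?m p)) = int (card S) * a"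
    unfolding m by (subst sum.swap) (simp flip: cA add: a)
  have "(\<Sum>p\<in>U. int (?m p) * int (?m p)) = (\<Sum>i\<in>S. \<Sum>j\<in>S. int (card (A i \<inter> A j)))"
  proof -
    have "(\<Sum>p\<in>U. int (?m p) * int (?m p)) = (\<Sum>p\<in>U. \<Sum>i\<in>S. \<Sum>j\<in>S. of_bool (p \<in> A i) * of_bool (p \<in> A j))"
      unfolding m by (simp only: sum_product)
    also have "\<dots> = (\<Sum>i\<in>S. \<Sum>p\<in>U. \<Sum>j\<in>S. of_bool (p \<in> A i) * of_bool (p \<in> A j))" by (rule sum.swap)
    also have "\<dots> = (\<Sum>i\<in>S. \<Sum>j\<in>S. \<Sum>p\<in>U. of_bool (p \<in> A i) * of_bool (p \<in> A j))"
      by (rule sum.cong[OF refl], rule sum.swap)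
    also have "\<dots> = (\<Sum>i\<in>S. \<Sum>j\<in>S. int (card (A i \<inter> A j)))"
      by (intro sum.cong refl) (simp add: cAA)
    finally show ?thesis .
  qed
  also have "\<dots> \<le> (\<Sum>i\<in>S. \<Sum>j\<in>S. (if i = j then a else 0) + c)"
    by (intro sum_mono) (use a c c0 in \<open>auto\<close>)
  also have "\<dots> = int (card S) * a + (int (card S) * int (card S)) * c"
    using fin(2) by (simp add: sum.distrib sum.delta algebra_simps)
  finally have s2: "(\<Sum>p\<in>U. int (?m p) * int (?m p)) \<le> int (card S) * a + (int (card S) * int (card S)) * c" .
  have "(\<Sum>p\<in>U. int (?m p) - (int (?m p) * int (?m p) - int (?m p))) \<le> (\<Sum>p\<in>U. of_bool (odd (?m p)))"
    by (rule sum_mono) (rule pt)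
  moreover have "(\<Sum>p\<in>U. of_bool (odd (?m p))) = int (card {p \<in> U. odd (?m p)})"
    using fin(1) by (simp add: sum.If_cases of_bool_def Int_def)
  moreover have "(\<Sum>p\<in>U. int (?m p) - (int (?m p) * int (?m p) - int (?m p))) =
      2 * (\<Sum>p\<in>U. int (?m p)) - (\<Sum>p\<in>U. int (?m p) * int (?m p))"
    by (simp add: sum_subtractf sum_distrib_left)
  ultimately show ?thesis using s1 s2 by linarith
qed


section \<open>A balanced binary code\<close>

definition bit_at :: "nat \<Rightarrow> nat \<Rightarrow> nat" where
  "bit_at g j = (g div 2 ^ j) mod 2"

text \<open>A position \<open>l\<close> of the base code stands for a triple of \<open>x, b < n ^ 3\<close>, which give the hash
  function \<open>i \<mapsto> (x * i + b) mod n ^ 3\<close>, and a Hadamard position; level \<open>j\<close> keeps the \<open>i\<close> with hash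
  below \<open>n ^ 3 / 2 ^ j\<close>.\<close>

definition hit :: "nat \<Rightarrow> nat \<Rightarrow> nat \<Rightarrow> nat \<Rightarrow> nat \<Rightarrow> bool" where
  "hit W x b j i \<longleftrightarrow> (x * i + b) mod W < W div 2 ^ j"

definition base_len :: "nat \<Rightarrow> nat" where
  "base_len n = n ^ 3 * (n ^ 3 * (4 * n))"

text \<open>For \<open>n = 2 ^ \<nu>\<close> a Hadamard position is below
  \<open>4 * n = 2 ^ (\<nu> + 2)\<close>, so only the levels below \<open>\<nu> + 2\<close>
  contribute. Summing up to \<open>4 * n\<close> avoids a logarithm.\<close>

definition base_code :: "nat \<Rightarrow> nat \<Rightarrow> nat \<Rightarrow> nat" where
  "base_code n l i = (\<Sum>j<4 * n. bit_at (l div n ^ 3 div n ^ 3) j *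
     of_bool (hit (n ^ 3) (l mod n ^ 3) (l div n ^ 3 mod n ^ 3) j i)) mod 2"

definition code_len :: "nat \<Rightarrow> nat" where
  "code_len n = base_len n ^ 16"

text \<open>The base \<open>base_len n\<close> digits of \<open>l\<close> address sixteen
  independent positions whose bits are added; biases multiply, and
  \<open>(13/16)^16 < 1/10\<close>.\<close>

definition code :: "nat \<Rightarrow> nat \<Rightarrow> nat \<Rightarrow> nat" where
  "code n l i = (\<Sum>k<16. base_code n (l div base_len n ^ k mod base_len n) i) mod 2"

section \<open>Weights of codewords as sums of signs\<close>

definition chi :: "nat \<Rightarrow> int" where
  "chi m = (if odd m then -1 else 1)"

lemma chi_add: "chi (a + b) = chi a * chi b"
  by (simp add: chi_def)

lemma chi_sum: "finite A \<Longrightarrow> chi (\<Sum>i\<in>A. f i) = (\<Prod>i\<in>A. chi (f i))"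
  by (induction A rule: finite_induct) (simp_all add: chi_add, simp add: chi_def)

lemma chi_cong: "odd a \<longleftrightarrow> odd b \<Longrightarrow> chi a = chi b"
  by (simp add: chi_def)

lemma sum_div_mod:
  fixes A B :: nat and f :: "nat \<Rightarrow> nat \<Rightarrow> int"
  assumes "0 < A"
  shows "(\<Sum>l<A * B. f (l mod A) (l div A)) = (\<Sum>a<A. \<Sum>b<B. f a b)"
proof -
  have "(\<Sum>l<A * B. f (l mod A) (l div A)) = (\<Sum>(a, b)\<in>{..<A} \<times> {..<B}. f a b)"
  proof (rule sum.reindex_bij_witness[of _ "\<lambda>(a, b). a + A * b" "\<lambda>l. (l mod A, l div A)"])
    fix p assume "p \<in> {..<A} \<times> {..<B}"
    then obtain a b where p: "p = (a, b)" "a < A" "b < B" by auto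
    have "a + A * b < A * Suc b" using p by simp
    also have "\<dots> \<le> A * B" using p by (intro mult_le_mono2) simp
    finally show "(case p of (a, b) \<Rightarrow> a + A * b) \<in> {..<A * B}" using p by simp
  qed (use assms in \<open>auto simp: less_mult_imp_div_less mult.commute\<close>)
  then show ?thesis by (simp add: sum.cartesian_product)
qed

text \<open>Splitting off the lowest bit of \<open>g\<close> yields the factor
  \<open>1 + chi (c 0)\<close>, which vanishes as soon as \<open>c 0\<close> is odd.\<close>

lemma hadamard:
  "(\<Sum>g<2 ^ J. chi (\<Sum>j<J. bit_at g j * c j)) = (if \<exists>j<J. odd (c j) then 0 else 2 ^ J)"
proof (induction J arbitrary: c)
  case 0
  then show ?case by (simp add: chi_def)
next
  case (Suc J)
  have "chi (\<Sum>j<Suc J. bit_at g j * c j) =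
      chi ((g mod 2) * c 0) * chi (\<Sum>j<J. bit_at (g div 2) j * c (Suc j))" for g
    by (simp only: sum.lessThan_Suc_shift chi_add) (simp add: bit_at_def div_mult2_eq)
  then have "(\<Sum>g<2 ^ Suc J. chi (\<Sum>j<Suc J. bit_at g j * c j)) =
      (\<Sum>g<2 * 2 ^ J. (\<lambda>t h. chi (t * c 0) * chi (\<Sum>j<J. bit_at h j * c (Suc j))) (g mod 2) (g div 2))"
    by simp
  also have "\<dots> = (\<Sum>t<2. \<Sum>h<2 ^ J. chi (t * c 0) * chi (\<Sum>j<J. bit_at h j * c (Suc j)))"
    by (rule sum_div_mod) simp
  also have "\<dots> = (1 + chi (c 0)) * (\<Sum>h<2 ^ J. chi (\<Sum>j<J. bit_at h j * c (Suc j)))"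
  proof -
    have two: "(\<Sum>t<2. F t) = F 0 + F 1" for F :: "nat \<Rightarrow> int" by (simp add: numeral_2_eq_2)
    have "chi 0 = 1" by (simp add: chi_def)
    then show ?thesis by (simp add: two distrib_right flip: sum_distrib_left)
  qed
  also have "\<dots> = (if \<exists>j<Suc J. odd (c j) then 0 else 2 ^ Suc J)"
    unfolding Suc.IH by (auto simp: chi_def less_Suc_eq_0_disj intro!: gr0I)
  finally show ?case .
qed

lemma sum_power_digits:
  fixes f :: "nat \<Rightarrow> int"
  assumes "0 < B"
  shows "(\<Sum>l<B ^ c. \<Prod>k<c. f (l div B ^ k mod B)) = (\<Sum>l<B. f l) ^ c"
proof (induction c)
  case (Suc c)
  have "(\<Prod>k<Suc c. f (l div B ^ k mod B)) = f (l mod B) * (\<Prod>k<c. f (l div B div B ^ k mod B))" for l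
    by (simp only: prod.lessThan_Suc_shift) (simp add: div_mult2_eq)
  then have "(\<Sum>l<B ^ Suc c. \<Prod>k<Suc c. f (l div B ^ k mod B)) =
      (\<Sum>l<B * B ^ c. (\<lambda>a b. f a * (\<Prod>k<c. f (b div B ^ k mod B))) (l mod B) (l div B))"
    by simp
  also have "\<dots> = (\<Sum>a<B. \<Sum>b<B ^ c. f a * (\<Prod>k<c. f (b div B ^ k mod B)))"
    by (rule sum_div_mod) (rule assms)
  also have "\<dots> = (\<Sum>l<B. f l) ^ Suc c"
    by (simp flip: sum_distrib_left sum_distrib_right add: Suc.IH)
  finally show ?case .
qed simp

lemma bit_at_zero: "g < 2 ^ J \<Longrightarrow> J \<le> j \<Longrightarrow> bit_at g j = 0"
proof -
  assume "g < 2 ^ J" "J \<le> j"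
  then have "g < 2 ^ j" using power_increasing[of J j "2 :: nat"] by linarith
  then show ?thesis by (simp add: bit_at_def)
qed

lemma odd_sum_mod2: "finite S \<Longrightarrow> odd (\<Sum>i\<in>S. f i mod 2) \<longleftrightarrow> odd (\<Sum>i\<in>S. f i :: nat)"
  by (induction S rule: finite_induct) auto

context
  fixes n \<nu> :: nat
  assumes n: "n = 2 ^ \<nu>" and \<nu>: "1 \<le> \<nu>"
begin

lemma n_ge: "2 \<le> n"
  using n \<nu> power_increasing[of 1 \<nu> "2 :: nat"] by simp

text \<open>For a fixed hash function, the Hadamard positions cancel if some level contains oddly
  many elements of \<open>S\<close>, and all count \<open>1\<close> otherwise. The bias is thus the
  fraction of hash functions that leave every level even.\<close>

lemma base_chi:
  assumes "S \<subseteq> {..<n}"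
  shows "(\<Sum>l<base_len n. chi (\<Sum>i\<in>S. base_code n l i)) =
    4 * int n * (int (n ^ 3 * n ^ 3) -
      int (card {(x, b). x < n ^ 3 \<and> b < n ^ 3 \<and> (\<exists>j<\<nu> + 2. odd (card {i \<in> S. hit (n ^ 3) x b j i}))}))"
proof -
  let ?W = "n ^ 3"
  let ?c = "\<lambda>x b j. card {i \<in> S. hit ?W x b j i}"
  let ?Q = "\<lambda>x b. \<exists>j<\<nu> + 2. odd (?c x b j)"
  have fS: "finite S" using assms finite_subset by blast
  have J: "2 ^ (\<nu> + 2) = 4 * n" by (simp add: n)
  have Jle: "\<nu> + 2 \<le> 4 * n" using less_exp[of "\<nu> + 2"] J by linarith
  have "chi (\<Sum>i\<in>S. base_code n l i) =
      chi (\<Sum>j<\<nu> + 2. bit_at (l div ?W div ?W) j * ?c (l mod ?W) (l div ?W mod ?W) j)"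
    if l: "l < base_len n" for l
  proof -
    have g: "l div ?W div ?W < 2 ^ (\<nu> + 2)"
      using l unfolding J base_len_def by (simp add: less_mult_imp_div_less mult.commute mult.left_commute)
    let ?b = "\<lambda>j. bit_at (l div ?W div ?W) j"
    let ?h = "\<lambda>j i. of_bool (hit ?W (l mod ?W) (l div ?W mod ?W) j i) :: nat"
    have "odd (\<Sum>i\<in>S. base_code n l i) \<longleftrightarrow> odd (\<Sum>i\<in>S. \<Sum>j<4 * n. ?b j * ?h j i)"
      unfolding base_code_def by (rule odd_sum_mod2[OF fS])
    also have "(\<Sum>i\<in>S. \<Sum>j<4 * n. ?b j * ?h j i) = (\<Sum>j<4 * n. ?b j * (\<Sum>i\<in>S. ?h j i))"
      by (subst sum.swap) (simp add: sum_distrib_left)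
    also have "\<dots> = (\<Sum>j<\<nu> + 2. ?b j * (\<Sum>i\<in>S. ?h j i))"
      by (rule sum.mono_neutral_right) (use Jle bit_at_zero[OF g] in auto)
    also have "\<dots> = (\<Sum>j<\<nu> + 2. ?b j * ?c (l mod ?W) (l div ?W mod ?W) j)"
      using fS by (simp add: sum.If_cases of_bool_def Int_def)
    finally show ?thesis by (rule chi_cong)
  qed
  then have "(\<Sum>l<base_len n. chi (\<Sum>i\<in>S. base_code n l i)) = (\<Sum>l<?W * (?W * (4 * n)).
      (\<lambda>x r. chi (\<Sum>j<\<nu> + 2. bit_at (r div ?W) j * ?c x (r mod ?W) j)) (l mod ?W) (l div ?W))"
    by (simp add: base_len_def)
  also have "\<dots> = (\<Sum>x<?W. \<Sum>r<?W * (4 * n). chi (\<Sum>j<\<nu> + 2. bit_at (r div ?W) j * ?c x (r mod ?W) j))"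
    by (rule sum_div_mod) (use n_ge in simp)
  also have "\<dots> = (\<Sum>x<?W. \<Sum>b<?W. \<Sum>g<4 * n. chi (\<Sum>j<\<nu> + 2. bit_at g j * ?c x b j))"
  proof (rule sum.cong[OF refl])
    fix x
    show "(\<Sum>r<?W * (4 * n). chi (\<Sum>j<\<nu> + 2. bit_at (r div ?W) j * ?c x (r mod ?W) j)) =
        (\<Sum>b<?W. \<Sum>g<4 * n. chi (\<Sum>j<\<nu> + 2. bit_at g j * ?c x b j))"
      using sum_div_mod[of ?W "\<lambda>b g. chi (\<Sum>j<\<nu> + 2. bit_at g j * ?c x b j)" "4 * n"] n_ge by simp
  qed
  also have "\<dots> = (\<Sum>x<?W. \<Sum>b<?W. 4 * int n * (1 - of_bool (?Q x b)))"
  proof (intro sum.cong refl)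
    fix x b
    show "(\<Sum>g<4 * n. chi (\<Sum>j<\<nu> + 2. bit_at g j * ?c x b j)) = 4 * int n * (1 - of_bool (?Q x b))"
      using hadamard[where J = "\<nu> + 2" and c = "?c x b"] unfolding J by (simp add: n)
  qed
  also have "\<dots> = 4 * int n * (int (?W * ?W) - (\<Sum>x<?W. \<Sum>b<?W. of_bool (?Q x b)))"
    by (simp add: sum_subtractf right_diff_distrib flip: sum_distrib_left)
  also have "(\<Sum>x<?W. \<Sum>b<?W. of_bool (?Q x b)) = int (card {(x, b). x < ?W \<and> b < ?W \<and> ?Q x b})"
    by (simp add: card_sigma_nat sum.If_cases of_bool_def Int_def)
  finally show ?thesis .
qed

text \<open>For \<open>s = card S\<close>, the level with \<open>2 * s \<le> 2 ^ j < 4 * s\<close>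
  keeps a fraction \<open>1/P\<close> of the indices, where \<open>P = 2 ^ j\<close>. By
  \<open>isolation\<close> at least the fraction \<open>s/P - (s/P)^2\<close> of the hash functions
  makes the count there odd, and on the interval from \<open>1/4\<close> to \<open>1/2\<close> this
  is at least \<open>3/16\<close>.\<close>

lemma base_hits:
  assumes "S \<subseteq> {..<n}" "S \<noteq> {}"
  shows "3 * int (n ^ 3 * n ^ 3) \<le> 16 *
      int (card {(x, b). x < n ^ 3 \<and> b < n ^ 3 \<and> (\<exists>j<\<nu> + 2. odd (card {i \<in> S. hit (n ^ 3) x b j i}))})"
proof -
  let ?W = "n ^ 3"
  let ?U = "{..<?W} \<times> {..<?W}"
  have fS: "finite S" using assms(1) finite_subset by blast
  define s where "s = card S"
  have s: "1 \<le> s" "s \<le> n"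
    using assms fS card_mono[of "{..<n}" S] by (auto simp: s_def Suc_le_eq card_gt_0_iff)
  define j where "j = (LEAST j. 2 * s \<le> 2 ^ j)"
  have jn: "2 * s \<le> 2 ^ (\<nu> + 1)" using s n by simp
  have j1: "2 * s \<le> 2 ^ j" unfolding j_def by (rule LeastI[of _ "\<nu> + 1"]) (rule jn)
  have j2: "j \<le> \<nu> + 1" unfolding j_def by (rule Least_le) (rule jn)
  have "j \<noteq> 0"
  proof
    assume "j = 0"
    then show False using j1 s(1) by simp
  qed
  then obtain j' where j': "j = Suc j'" using not0_implies_Suc by blast
  have "\<not> 2 * s \<le> 2 ^ j'" using not_less_Least[of j' "\<lambda>j. 2 * s \<le> 2 ^ j"] j' j_def by simp
  then have j3: "2 ^ j < 4 * s" using j' by simp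
  have W: "?W = 2 ^ (3 * \<nu>)" by (simp add: n power_mult[symmetric] mult.commute)
  have j4: "j \<le> 3 * \<nu>" using j2 \<nu> by linarith
  define l where "l = (2 :: nat) ^ (3 * \<nu> - j)"
  have Wl: "?W = 2 ^ j * l" unfolding W l_def using j4 by (simp flip: power_add)
  have ldef: "?W div 2 ^ j = l" using Wl by simp
  have lW: "l \<le> ?W" using Wl by simp
  \<comment> \<open>Differences of indices are below \<open>n\<close>, so the gcd is a power of two
    below \<open>n\<close>; the modulus \<open>n ^ 3\<close> is large enough for \<open>l\<close> to
    be a multiple of every such power.\<close>
  have g: "gcd z ?W dvd l" if "0 < z" "z < n" for z
  proof -
    obtain r where r: "gcd z ?W = 2 ^ r"
      using divides_primepow_nat[of 2 "gcd z ?W" "3 * \<nu>"] W by auto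
    have "2 ^ r \<le> z" using that r by (metis gcd_le1_nat neq0_conv)
    then have "(2 :: nat) ^ r < 2 ^ \<nu>" using that n by linarith
    then have "r \<le> 3 * \<nu> - j" using j2 \<nu> by (simp add: power_strict_increasing_iff)
    then show ?thesis unfolding r l_def by (rule le_imp_power_dvd)
  qed
  define A where "A i = {(x, b). x < ?W \<and> b < ?W \<and> hit ?W x b j i}" for i
  have A: "A i \<subseteq> ?U" for i by (auto simp: A_def)
  have c1: "int (card (A i)) = int (?W * l)" for i
    using card_hit[OF lW, of i] by (simp add: A_def hit_def ldef)
  have c2: "int (card (A i \<inter> A i')) \<le> int (l * l)" if "i \<in> S" "i' \<in> S" "i \<noteq> i'" for i i'
  proof -
    have "A i \<inter> A i' = {(x, b). x < ?W \<and> b < ?W \<and> (x * i + b) mod ?W < l \<and> (x * i' + b) mod ?W < l}"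
      by (auto simp: A_def hit_def ldef)
    moreover have "card \<dots> \<le> l * l"
      by (rule card_hit2[where n = n]) (use that assms(1) g lW n_ge in auto)
    ultimately show ?thesis by (simp del: of_nat_mult)
  qed
  have "int s * int (?W * l) - int s * int s * int (l * l) \<le>
      int (card {p \<in> ?U. odd (card {i \<in> S. p \<in> A i})})"
    unfolding s_def by (rule isolation) (use fS A c1 c2 in auto)
  also have "{p \<in> ?U. odd (card {i \<in> S. p \<in> A i})} \<subseteq>
      {(x, b). x < ?W \<and> b < ?W \<and> (\<exists>j<\<nu> + 2. odd (card {i \<in> S. hit ?W x b j i}))}"
  proof
    fix p assume p: "p \<in> {p \<in> ?U. odd (card {i \<in> S. p \<in> A i})}"
    obtain x b where xb: "p = (x, b)" by (cases p)
    have "{i \<in> S. p \<in> A i} = {i \<in> S. hit ?W x b j i}" using p xb by (auto simp: A_def)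
    then show "p \<in> {(x, b). x < ?W \<and> b < ?W \<and> (\<exists>j<\<nu> + 2. odd (card {i \<in> S. hit ?W x b j i}))}"
      using p xb j2 by (auto intro!: exI[of _ j])
  qed
  then have "int (card {p \<in> ?U. odd (card {i \<in> S. p \<in> A i})}) \<le>
      int (card {(x, b). x < ?W \<and> b < ?W \<and> (\<exists>j<\<nu> + 2. odd (card {i \<in> S. hit ?W x b j i}))})"
    by (intro of_nat_mono card_mono) (auto intro: finite_subset[of _ ?U])
  finally have m: "int s * int (?W * l) - int s * int s * int (l * l) \<le>
      int (card {(x, b). x < ?W \<and> b < ?W \<and> (\<exists>j<\<nu> + 2. odd (card {i \<in> S. hit ?W x b j i}))})" .
  define P where "P = int (2 ^ j)"
  have "int (2 * s) \<le> P" "P < int (4 * s)"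
    unfolding P_def of_nat_le_iff of_nat_less_iff by (fact j1, fact j3)
  then have P: "2 * int s \<le> P" "P < 4 * int s" by simp_all
  have WP: "int ?W = P * int l" using Wl unfolding P_def by (simp only: of_nat_mult)
  \<comment> \<open>The expanded product is \<open>16 s P - 16 s^2 - 3 P^2\<close>, which is the
    bound \<open>3/16\<close> cleared of denominators.\<close>
  have "0 \<le> (4 * int s - P) * (3 * P - 4 * int s)" by (rule mult_nonneg_nonneg) (use P in auto)
  then have "3 * (P * P) \<le> 16 * (int s * P - int s * int s)" by (simp add: algebra_simps)
  then have "3 * (P * P) * (int l * int l) \<le> 16 * (int s * P - int s * int s) * (int l * int l)"
    by (rule mult_right_mono) simp
  then have "3 * int (?W * ?W) \<le> 16 * (int s * int (?W * l) - int s * int s * int (l * l))"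
    by (simp only: of_nat_mult WP) (simp add: algebra_simps)
  also have "\<dots> \<le> 16 * int (card {(x, b). x < ?W \<and> b < ?W \<and> (\<exists>j<\<nu> + 2. odd (card {i \<in> S. hit ?W x b j i}))})"
    by (rule mult_left_mono[OF m]) simp
  finally show ?thesis .
qed

text \<open>The sign sum of \<open>code\<close> is the sixteenth power of that of
  \<open>base_code\<close>, which lies between \<open>0\<close> and \<open>13/16\<close> of the
  length. Nonnegativity bounds the weight from above by half the length, smallness bounds it from
  below.\<close>

theorem code_balanced:
  assumes S: "S \<subseteq> {..<n}" "S \<noteq> {}"
  defines "w \<equiv> card {l. l < code_len n \<and> odd (\<Sum>i\<in>S. code n l i)}"
  shows "2 * w \<le> code_len n \<and> 9 * code_len n \<le> 20 * w"
proof -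
  have fS: "finite S" using S finite_subset by blast
  let ?B = "\<Sum>l<base_len n. chi (\<Sum>i\<in>S. base_code n l i)"
  let ?T = "\<Sum>l<code_len n. chi (\<Sum>i\<in>S. code n l i)"
  have L0: "0 < base_len n" using n_ge by (simp add: base_len_def)
  have lenW: "int (base_len n) = 4 * int n * int (n ^ 3 * n ^ 3)" by (simp add: base_len_def)
  let ?H = "{(x, b). x < n ^ 3 \<and> b < n ^ 3 \<and> (\<exists>j<\<nu> + 2. odd (card {i \<in> S. hit (n ^ 3) x b j i}))}"
  have "card ?H \<le> card ({..<n ^ 3} \<times> {..<n ^ 3})" by (rule card_mono) auto
  then have H: "int (card ?H) \<le> int (n ^ 3 * n ^ 3)" by (simp only: card_cartesian_product card_lessThan)
  have B0: "0 \<le> ?B" unfolding base_chi[OF S(1)] by (rule mult_nonneg_nonneg) (use H in auto)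
  have "16 * ?B = 4 * int n * (16 * int (n ^ 3 * n ^ 3) - 16 * int (card ?H))"
    unfolding base_chi[OF S(1)] by (simp add: algebra_simps)
  also have "\<dots> \<le> 4 * int n * (13 * int (n ^ 3 * n ^ 3))"
    by (rule mult_left_mono) (use base_hits[OF S] in auto)
  also have "\<dots> = 13 * int (base_len n)" by (simp add: lenW)
  finally have B1: "16 * ?B \<le> 13 * int (base_len n)" .
  have "chi (\<Sum>i\<in>S. code n l i) = (\<Prod>k<16. (\<lambda>d. chi (\<Sum>i\<in>S. base_code n d i)) (l div base_len n ^ k mod base_len n))" for l
  proof -
    have "chi (\<Sum>i\<in>S. code n l i) = chi (\<Sum>i\<in>S. \<Sum>k<16. base_code n (l div base_len n ^ k mod base_len n) i)"
      unfolding code_def by (rule chi_cong, rule odd_sum_mod2[OF fS])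
    also have "\<dots> = chi (\<Sum>k<16. \<Sum>i\<in>S. base_code n (l div base_len n ^ k mod base_len n) i)"
      by (simp only: sum.swap[of _ S])
    finally show ?thesis by (simp only: chi_sum[OF finite_lessThan])
  qed
  then have T: "?T = ?B ^ 16"
    using sum_power_digits[OF L0, of "\<lambda>d. chi (\<Sum>i\<in>S. base_code n d i)" 16] by (simp add: code_len_def)
  have T0: "0 \<le> ?T" unfolding T using B0 by (rule zero_le_power)
  have "16 ^ 16 * ?T = (16 * ?B) ^ 16" unfolding T by (simp add: power_mult_distrib)
  also have "\<dots> \<le> (13 * int (base_len n)) ^ 16" by (rule power_mono[OF B1]) (use B0 in simp)
  also have "\<dots> = 13 ^ 16 * int (code_len n)" by (simp add: code_len_def power_mult_distrib)
  finally have T1: "16 ^ 16 * ?T \<le> 13 ^ 16 * int (code_len n)" .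
  have "?T = (\<Sum>l<code_len n. 1 - 2 * of_bool (odd (\<Sum>i\<in>S. code n l i)))"
    by (rule sum.cong) (auto simp: chi_def)
  also have "\<dots> = int (code_len n) - 2 * (\<Sum>l<code_len n. of_bool (odd (\<Sum>i\<in>S. code n l i)))"
    by (simp add: sum_subtractf flip: sum_distrib_left)
  also have "(\<Sum>l<code_len n. of_bool (odd (\<Sum>i\<in>S. code n l i))) = int w"
    by (simp add: w_def sum.If_cases of_bool_def Int_def)
  finally have Tw: "?T = int (code_len n) - 2 * int w" .
  \<comment> \<open>Here \<open>10 * 13^16 \<le> 16^16\<close> enters; a bias of at most one tenth
    is the weight \<open>9/20\<close> of the length.\<close>
  have "10 * ?T \<le> int (code_len n)" using T0 T1 by simp
  then show ?thesis using T0 Tw by linarith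
qed

end

section \<open>Separating the two sides of a bipartite graph\<close>

text \<open>Lines \<open>y = m x + c\<close> modulo \<open>q = k * k\<close>, numbered by \<open>m * q + c\<close>, and points \<open>(x, y)\<close>, numbered
  by \<open>x * q + y\<close>. As \<open>m\<close> and \<open>x\<close> range below \<open>k\<close> only, \<open>(m - m') (x - x')\<close> is smaller than \<open>q\<close> and
  two lines share at most one point although \<open>q\<close> is not prime.\<close>

definition incident :: "nat \<Rightarrow> nat \<Rightarrow> nat \<Rightarrow> bool" where
  "incident q a p \<longleftrightarrow> (a div q * (p div q) + a mod q) mod q = p mod q"

lemma incident_dvd:
  assumes "incident q a p"
  shows "int q dvd int (a div q) * int (p div q) + int (a mod q) - int (p mod q)"
proof -
  have "int ((a div q * (p div q) + a mod q) mod q) = int (p mod q)"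
    using assms by (simp only: incident_def)
  then have "(int (a div q) * int (p div q) + int (a mod q)) mod int q = int (p mod q) mod int q"
    by (simp add: of_nat_mod)
  then show ?thesis by (simp only: mod_eq_dvd_iff)
qed

lemma dvd_small: "int q dvd w \<Longrightarrow> \<bar>w\<bar> < int q \<Longrightarrow> w = 0"
  using dvd_imp_le_int[of w "int q"] by linarith

lemma incident_unique:
  assumes q: "q = k * k" and b: "a < k * q" "a' < k * q" "p < k * q" "p' < k * q"
    and i: "incident q a p" "incident q a p'" "incident q a' p" "incident q a' p'"
  shows "a = a' \<or> p = p'"
proof -
  have k: "0 < k" using b(1) by (cases k) auto
  have q0: "0 < q" using k q by simp
  define m c m' c' x y x' y' where d: "m = int (a div q)" "c = int (a mod q)" "m' = int (a' div q)"
    "c' = int (a' mod q)" "x = int (p div q)" "y = int (p mod q)" "x' = int (p' div q)" "y' = int (p' mod q)"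
  have lt: "0 \<le> m" "m < int k" "0 \<le> m'" "m' < int k" "0 \<le> x" "x < int k" "0 \<le> x'" "x' < int k"
    unfolding d using b by (simp_all add: less_mult_imp_div_less)
  have lq: "\<bar>c - c'\<bar> < int q" "\<bar>y' - y\<bar> < int q"
  proof -
    have "0 \<le> c" "c < int q" "0 \<le> c'" "c' < int q" "0 \<le> y" "y < int q" "0 \<le> y'" "y' < int q"
      unfolding d using q0 by simp_all
    then show "\<bar>c - c'\<bar> < int q" "\<bar>y' - y\<bar> < int q" by linarith+
  qed
  have e: "int q dvd m * x + c - y" "int q dvd m * x' + c - y'" "int q dvd m' * x + c' - y"
    "int q dvd m' * x' + c' - y'"
    using i[THEN incident_dvd] unfolding d by simp_all
  \<comment> \<open>The alternating sum of the four incidences cancels both intercepts and both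
    ordinates.\<close>
  have "int q dvd ((m * x + c - y) - (m * x' + c - y')) - ((m' * x + c' - y) - (m' * x' + c' - y'))"
    by (intro dvd_diff e)
  also have "((m * x + c - y) - (m * x' + c - y')) - ((m' * x + c' - y) - (m' * x' + c' - y')) = (m - m') * (x - x')"
    by (simp add: algebra_simps)
  finally have dv: "int q dvd (m - m') * (x - x')" .
  have "\<bar>m - m'\<bar> * \<bar>x - x'\<bar> \<le> (int k - 1) * (int k - 1)"
    by (rule mult_mono) (use lt in linarith)+
  also have "\<dots> < int k * int k" using k by (simp add: algebra_simps)
  finally have "\<bar>(m - m') * (x - x')\<bar> < int q" by (simp add: q abs_mult)
  then have "(m - m') * (x - x') = 0" by (rule dvd_small[OF dv])
  then consider "m = m'" | "x = x'" by auto
  then show ?thesis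
  proof cases
    case 1
    have "int q dvd (m * x + c - y) - (m' * x + c' - y)" by (intro dvd_diff e)
    then have "int q dvd c - c'" using 1 by simp
    then have "c - c' = 0" by (rule dvd_small) (rule lq(1))
    then have "a div q = a' div q" "a mod q = a' mod q" using 1 d by simp_all
    then have "a div q * q + a mod q = a' div q * q + a' mod q" by (simp only:)
    then show ?thesis by simp
  next
    case 2
    have "int q dvd (m * x + c - y) - (m * x' + c - y')" by (intro dvd_diff e)
    then have "int q dvd y' - y" using 2 by simp
    then have "y' - y = 0" by (rule dvd_small) (rule lq(2))
    then have "p div q = p' div q" "p mod q = p' mod q" using 2 d by simp_all
    then have "p div q * q + p mod q = p' div q * q + p' mod q" by (simp only:)
    then show ?thesis by simp
  qed
qed

lemma div_mod_build:
  fixes q :: nat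
  assumes "y < q"
  shows "(x * q + y) div q = x" "(x * q + y) mod q = y"
  using assms by simp_all

lemma inj_build:
  fixes q :: nat
  assumes "\<And>x. c x < q"
  shows "inj_on (\<lambda>x. x * q + c x) A"
proof (rule inj_onI)
  fix x y assume "x * q + c x = y * q + c y"
  then have "(x * q + c x) div q = (y * q + c y) div q" by (simp only:)
  then show "x = y" by (simp only: div_mod_build(1)[OF assms])
qed

lemma card_line:
  assumes "0 < q"
  shows "k \<le> card {p. p < k * q \<and> incident q a p}"
proof -
  let ?f = "\<lambda>x. x * q + (a div q * x + a mod q) mod q"
  have m: "(a div q * x + a mod q) mod q < q" for x using assms by simp
  have inj: "inj_on ?f {..<k}"
    by (rule inj_build) (rule m)
  have im: "?f ` {..<k} \<subseteq> {p. p < k * q \<and> incident q a p}"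
  proof
    fix p assume "p \<in> ?f ` {..<k}"
    then obtain x where x: "x < k" "p = ?f x" by auto
    have "p < (x + 1) * q" using m[of x] x by simp
    also have "\<dots> \<le> k * q" using x by (intro mult_le_mono1) simp
    finally show "p \<in> {p. p < k * q \<and> incident q a p}"
      using x div_mod_build[OF m] by (simp add: incident_def)
  qed
  have "card {..<k} \<le> card {p. p < k * q \<and> incident q a p}"
    by (rule card_inj_on_le[OF inj im]) simp
  then show ?thesis by simp
qed

lemma card_point:
  assumes "0 < q"
  shows "k \<le> card {a. a < k * q \<and> incident q a p}"
proof -
  \<comment> \<open>The intercept \<open>y - m * x\<close> of the line of slope \<open>m\<close>
    through the point; the added multiple of \<open>q\<close> keeps the natural subtraction from
    truncating.\<close>
  let ?c = "\<lambda>m. (q * (m * (p div q)) + p mod q - m * (p div q)) mod q"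
  let ?f = "\<lambda>m. m * q + ?c m"
  have m: "?c x < q" for x using assms by simp
  have inj: "inj_on ?f {..<k}"
    by (rule inj_build) (rule m)
  have im: "?f ` {..<k} \<subseteq> {a. a < k * q \<and> incident q a p}"
  proof
    fix a assume "a \<in> ?f ` {..<k}"
    then obtain x where x: "x < k" "a = ?f x" by auto
    have "a < (x + 1) * q" using m[of x] x by simp
    also have "\<dots> \<le> k * q" using x by (intro mult_le_mono1) simp
    finally have "a < k * q" .
    moreover have "incident q a p"
    proof -
      have "x * (p div q) \<le> q * (x * (p div q))" using assms by simp
      then have "x * (p div q) + (q * (x * (p div q)) + p mod q - x * (p div q)) =
          q * (x * (p div q)) + p mod q" by linarith
      then have "(x * (p div q) + ?c x) mod q = (q * (x * (p div q)) + p mod q) mod q"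
        by (simp only: mod_add_right_eq)
      then show ?thesis using x div_mod_build[OF m] by (simp add: incident_def)
    qed
    ultimately show "a \<in> {a. a < k * q \<and> incident q a p}" by simp
  qed
  have "card {..<k} \<le> card {a. a < k * q \<and> incident q a p}"
    by (rule card_inj_on_le[OF inj im]) simp
  then show ?thesis by simp
qed

text \<open>Each \<open>d\<close> spoils at most one element of \<open>X\<close>. With
  \<open>X\<close> the neighbours of a chosen vertex in an incidence graph without 4-cycles,
  enlarging \<open>D\<close> by one vertex cancels at most one odd neighbour, so the total size
  cannot drop.\<close>

lemma card_untouched:
  assumes "finite X" "finite D" and one: "\<And>d x x'. d \<in> D \<Longrightarrow> x \<in> X \<Longrightarrow> x' \<in> X \<Longrightarrow> adj x d \<Longrightarrow> adj x' d \<Longrightarrow> x = x'"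
  shows "card X \<le> card {x \<in> X. \<forall>d \<in> D. \<not> adj x d} + card D"
proof -
  have one': "card {x \<in> X. adj x d} \<le> 1" if "d \<in> D" for d
    using one[OF that] assms(1) by (simp add: card_le_Suc0_iff_eq)
  have "X = {x \<in> X. \<forall>d \<in> D. \<not> adj x d} \<union> (\<Union>d\<in>D. {x \<in> X. adj x d})" by auto
  then have "card X \<le> card {x \<in> X. \<forall>d \<in> D. \<not> adj x d} + card (\<Union>d\<in>D. {x \<in> X. adj x d})"
    using card_Un_le[of "{x \<in> X. \<forall>d \<in> D. \<not> adj x d}" "\<Union>d\<in>D. {x \<in> X. adj x d}"] by simp
  also have "card (\<Union>d\<in>D. {x \<in> X. adj x d}) \<le> (\<Sum>d\<in>D. card {x \<in> X. adj x d})"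
    by (rule card_UN_le[OF assms(2)])
  also have "\<dots> \<le> (\<Sum>d\<in>D. 1)" by (rule sum_mono[OF one'])
  finally show ?thesis by simp
qed

text \<open>Rows \<open>u < R\<close>, then for each column \<open>b < C\<close> a copy of the point-line incidence graph with
  \<open>S\<close> lines and \<open>S\<close> points. The point \<open>(0, 0)\<close> of copy \<open>b\<close> is joined to the rows of column \<open>b\<close>.\<close>

definition arc :: "nat \<Rightarrow> nat \<Rightarrow> (nat \<Rightarrow> nat \<Rightarrow> bool) \<Rightarrow> nat \<Rightarrow> nat \<Rightarrow> bool" where
  "arc k R mc u v \<longleftrightarrow> (let q = k * k; S = k * q in
     R \<le> v \<and> S \<le> (v - R) mod (2 * S) \<and>
     (if u < R then (v - R) mod (2 * S) = S \<and> mc ((v - R) div (2 * S)) u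
      else (u - R) mod (2 * S) < S \<and> (u - R) div (2 * S) = (v - R) div (2 * S) \<and>
        incident q ((u - R) mod (2 * S)) ((v - R) mod (2 * S) - S)))"

definition gadget_size :: "nat \<Rightarrow> nat \<Rightarrow> nat \<Rightarrow> nat" where
  "gadget_size k R C = R + C * (2 * (k * (k * k)))"

definition gadget_graph :: "nat \<Rightarrow> nat \<Rightarrow> nat \<Rightarrow> (nat \<Rightarrow> nat \<Rightarrow> bool) \<Rightarrow> nat graph" where
  "gadget_graph k R C mc = \<lparr>verts = {..<gadget_size k R C},
     edges = {{u, v} | u v. u < gadget_size k R C \<and> v < gadget_size k R C \<and> arc k R mc u v}\<rparr>"

section \<open>Sizes of local sets in the gadget graph\<close>

context
  fixes k R C :: nat and mc :: "nat \<Rightarrow> nat \<Rightarrow> bool" and q S N :: nat and G :: "nat graph"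
  assumes k: "0 < k"
  defines "q \<equiv> k * k" and "S \<equiv> k * q" and "N \<equiv> gadget_size k R C" and "G \<equiv> gadget_graph k R C mc"
begin

definition "right v \<longleftrightarrow> R \<le> v \<and> S \<le> (v - R) mod (2 * S)"

lemma S_pos: "0 < S"
  using k by (simp add: S_def q_def)

lemma arc_right: "arc k R mc u v \<Longrightarrow> right v \<and> \<not> right u"
  by (auto simp: arc_def right_def Let_def S_def q_def split: if_splits)

lemma N_eq: "N = R + C * (2 * S)"
  by (simp add: N_def gadget_size_def S_def q_def)

lemma verts_G: "verts G = {..<N}"
  by (simp add: G_def N_def gadget_graph_def)

lemma simple_G: "simple_graph G"
proof -
  have "u \<noteq> v" if "arc k R mc u v" for u v using arc_right[OF that] by auto
  then show ?thesis by (fastforce simp: simple_graph_def G_def gadget_graph_def)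
qed

lemma bipartite_G: "bipartite G"
  unfolding bipartite_def
proof (intro exI conjI ballI)
  show "{v. v < N \<and> \<not> right v} \<union> {v. v < N \<and> right v} = verts G" by (auto simp: verts_G)
  fix e assume "e \<in> edges G"
  then obtain u v where "e = {u, v}" "u < N" "v < N" "arc k R mc u v"
    by (auto simp: G_def gadget_graph_def N_def)
  then show "\<exists>a \<in> {v. v < N \<and> \<not> right v}. \<exists>b \<in> {v. v < N \<and> right v}. e = {a, b}"
    using arc_right by blast
qed auto

lemma nb_G: "neighborhood G u = (if right u then {v. v < N \<and> u < N \<and> arc k R mc v u}
    else {v. v < N \<and> u < N \<and> arc k R mc u v})"
proof -
  have "v \<in> neighborhood G u \<longleftrightarrow> u < N \<and> v < N \<and> (arc k R mc u v \<or> arc k R mc v u)" for v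
    by (auto simp: neighborhood_def G_def gadget_graph_def N_def doubleton_eq_iff)
  then show ?thesis using arc_right by auto
qed

lemma odd_right:
  assumes "right v" "D \<subseteq> {..<N}"
  shows "v \<in> odd_nb G D \<longleftrightarrow> v < N \<and> odd (card {u \<in> D. arc k R mc u v})"
proof -
  have "neighborhood G v \<inter> D = (if v < N then {u \<in> D. arc k R mc u v} else {})"
    using assms by (auto simp: nb_G)
  then show ?thesis by (simp add: odd_nb_def)
qed

lemma odd_left:
  assumes "\<not> right v" "D \<subseteq> {..<N}"
  shows "v \<in> odd_nb G D \<longleftrightarrow> v < N \<and> odd (card {u \<in> D. arc k R mc v u})"
proof -
  have "neighborhood G v \<inter> D = (if v < N then {u \<in> D. arc k R mc v u} else {})"
    using assms by (auto simp: nb_G)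
  then show ?thesis by (simp add: odd_nb_def)
qed

definition "line_vertex b a = R + b * (2 * S) + a"

definition "point_vertex b p = R + b * (2 * S) + (S + p)"

lemma line_vertex_simps:
  assumes "a < S"
  shows "R \<le> line_vertex b a" "(line_vertex b a - R) div (2 * S) = b"
    "(line_vertex b a - R) mod (2 * S) = a" "\<not> right (line_vertex b a)"
proof -
  have "line_vertex b a - R = b * (2 * S) + a" by (simp add: line_vertex_def)
  moreover have "a < 2 * S" using assms by simp
  ultimately show 1: "(line_vertex b a - R) div (2 * S) = b" "(line_vertex b a - R) mod (2 * S) = a"
    using div_mod_build[of a "2 * S" b] by simp_all
  show "R \<le> line_vertex b a" by (simp add: line_vertex_def)
  show "\<not> right (line_vertex b a)" unfolding right_def 1 using assms by simp
qed

lemma point_vertex_simps: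
  assumes "p < S"
  shows "R \<le> point_vertex b p" "(point_vertex b p - R) div (2 * S) = b"
    "(point_vertex b p - R) mod (2 * S) = S + p" "right (point_vertex b p)"
proof -
  have "point_vertex b p - R = b * (2 * S) + (S + p)" by (simp add: point_vertex_def)
  moreover have "S + p < 2 * S" using assms by simp
  ultimately show 1: "(point_vertex b p - R) div (2 * S) = b" "(point_vertex b p - R) mod (2 * S) = S + p"
    using div_mod_build[of "S + p" "2 * S" b] by simp_all
  show "R \<le> point_vertex b p" by (simp add: point_vertex_def)
  then show "right (point_vertex b p)" unfolding right_def 1 by simp
qed

lemma block_less: "b < C \<Longrightarrow> r < 2 * S \<Longrightarrow> R + b * (2 * S) + r < N"
proof -
  assume "b < C" "r < 2 * S"
  then have "b * (2 * S) + r < (b + 1) * (2 * S)" by simp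
  also have "\<dots> \<le> C * (2 * S)" using \<open>b < C\<close> by (intro mult_le_mono1) simp
  finally show ?thesis by (simp add: N_eq)
qed

lemma line_vertex_less: "b < C \<Longrightarrow> a < S \<Longrightarrow> line_vertex b a < N"
  unfolding line_vertex_def by (rule block_less) simp_all

lemma point_vertex_less: "b < C \<Longrightarrow> p < S \<Longrightarrow> point_vertex b p < N"
  unfolding point_vertex_def by (rule block_less) simp_all

lemma block_split:
  assumes "v < N" "R \<le> v"
  shows "v = R + (v - R) div (2 * S) * (2 * S) + (v - R) mod (2 * S)" "(v - R) div (2 * S) < C"
proof -
  have "v - R < C * (2 * S)" using assms S_pos N_eq by linarith
  then show "(v - R) div (2 * S) < C" by (rule less_mult_imp_div_less)
  have "(v - R) div (2 * S) * (2 * S) + (v - R) mod (2 * S) = v - R" by (rule div_mult_mod_eq)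
  then show "v = R + (v - R) div (2 * S) * (2 * S) + (v - R) mod (2 * S)" using assms by linarith
qed

lemma right_cases:
  assumes "right v" "v < N"
  obtains b p where "v = point_vertex b p" "b < C" "p < S"
proof
  have R: "R \<le> v" and r: "S \<le> (v - R) mod (2 * S)" using assms(1) by (simp_all add: right_def)
  have l: "(v - R) mod (2 * S) < 2 * S" using S_pos by simp
  show "v = point_vertex ((v - R) div (2 * S)) ((v - R) mod (2 * S) - S)"
    using block_split(1)[OF assms(2) R] r by (simp add: point_vertex_def)
  show "(v - R) div (2 * S) < C" by (rule block_split(2)[OF assms(2) R])
  show "(v - R) mod (2 * S) - S < S" using l r by linarith
qed

lemma left_cases:
  assumes "\<not> right v" "v < N"
  obtains "v < R" | b a where "v = line_vertex b a" "b < C" "a < S"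
proof (cases "v < R")
  case False
  then have R: "R \<le> v" by simp
  show ?thesis
  proof (rule that(2))
    show "v = line_vertex ((v - R) div (2 * S)) ((v - R) mod (2 * S))"
      using block_split(1)[OF assms(2) R] by (simp add: line_vertex_def)
    show "(v - R) div (2 * S) < C" by (rule block_split(2)[OF assms(2) R])
    show "(v - R) mod (2 * S) < S" using assms(1) R by (simp add: right_def)
  qed
qed (rule that(1))

lemma arc_line_point:
  "a < S \<Longrightarrow> p < S \<Longrightarrow> arc k R mc (line_vertex b a) (point_vertex b' p) \<longleftrightarrow> b = b' \<and> incident q a p"
  unfolding arc_def Let_def S_def[symmetric] q_def[symmetric]
  by (simp add: line_vertex_simps point_vertex_simps leD[OF line_vertex_simps(1)])

lemma arc_row_point:
  "u < R \<Longrightarrow> p < S \<Longrightarrow> arc k R mc u (point_vertex b p) \<longleftrightarrow> p = 0 \<and> mc b u"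
  unfolding arc_def Let_def S_def[symmetric] q_def[symmetric]
  by (simp add: point_vertex_simps)

lemma row_left: "u < R \<Longrightarrow> \<not> right u"
  by (simp add: right_def)

lemma q_pos: "0 < q"
  using k by (simp add: q_def)

lemma finite_Un_odd:
  assumes "D \<subseteq> {..<N}"
  shows "finite (D \<union> odd_nb G D)"
proof -
  have "odd_nb G D \<subseteq> {..<N}" using odd_nb_subset[OF simple_G, of D] by (simp only: verts_G)
  then show ?thesis by (intro finite_subset[OF Un_least[OF assms]]) simp_all
qed

text \<open>The point \<open>v\<close> lies on at least \<open>k\<close> lines of its copy, and any
  other point of \<open>D\<close> meets at most one of them. The lines met by no other point of
  \<open>D\<close> have the single neighbour \<open>v\<close> in \<open>D\<close>, hence odd parity.
  Together with the points of \<open>D\<close> this makes at least \<open>k + 1\<close> vertices;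
  left members of \<open>D\<close> do not affect parities on the left.\<close>

lemma right_heavy:
  assumes D: "D \<subseteq> {..<N}" and v: "v \<in> D" "right v"
  shows "k < card (D \<union> odd_nb G D)"
proof -
  obtain b p where bp: "v = point_vertex b p" "b < C" "p < S"
    using right_cases[OF v(2)] v(1) D by blast
  define X where "X = line_vertex b ` {a. a < S \<and> incident q a p}"
  define D' where "D' = {d \<in> D. right d} - {v}"
  have fD: "finite D" using D finite_subset by blast
  have fX: "finite X" by (simp add: X_def)
  have cX: "k \<le> card X"
  proof -
    have "card X = card {a. a < S \<and> incident q a p}"
      unfolding X_def by (rule card_image) (simp add: inj_on_def line_vertex_def)
    then show ?thesis using card_point[OF q_pos, of k p] by (simp add: S_def)
  qed
  have "card X \<le> card {x \<in> X. \<forall>d \<in> D'. \<not> arc k R mc x d} + card D'"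
  proof (rule card_untouched[OF fX])
    show "finite D'" using fD by (simp add: D'_def)
    fix d x x' assume d: "d \<in> D'" and x: "x \<in> X" "x' \<in> X" "arc k R mc x d" "arc k R mc x' d"
    have dD: "right d" "d \<in> D" "d \<noteq> v" using d by (simp_all add: D'_def)
    obtain b' p' where d': "d = point_vertex b' p'" "p' < S"
      using right_cases[OF dD(1)] dD(2) D by blast
    obtain a a' where a: "x = line_vertex b a" "a < S" "incident q a p"
      "x' = line_vertex b a'" "a' < S" "incident q a' p"
      using x(1,2) unfolding X_def by blast
    have "b = b'" "incident q a p'" "incident q a' p'"
      using x(3,4) a d' by (simp_all add: arc_line_point)
    moreover have "p \<noteq> p'" using dD(3) bp(1) d'(1) \<open>b = b'\<close> by blast
    ultimately have "a = a'"
      using incident_unique[OF meta_eq_to_obj_eq[OF q_def], of a a' p p'] a d'(2) bp(3) by (simp add: S_def)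
    then show "x = x'" using a by simp
  qed
  moreover define X0 where "X0 = {x \<in> X. \<forall>d \<in> D'. \<not> arc k R mc x d}"
  moreover have "card X \<le> card X0 + card D'" using calculation by simp
  moreover have "X0 \<subseteq> odd_nb G D"
  proof
    fix x assume x: "x \<in> X0"
    then obtain a where a: "x = line_vertex b a" "a < S" "incident q a p" by (auto simp: X0_def X_def)
    have "arc k R mc x v" using a bp by (simp add: arc_line_point)
    then have "{d \<in> D. arc k R mc x d} = {v}"
      using x v arc_right by (auto simp: X0_def D'_def)
    moreover have "x < N" "\<not> right x" using a bp line_vertex_less line_vertex_simps(4) by simp_all
    ultimately show "x \<in> odd_nb G D" using odd_left[OF _ D, of x] by simp
  qed
  moreover have "card ({d \<in> D. right d} \<union> X0) = card {d \<in> D. right d} + card X0"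
    by (rule card_Un_disjoint)
      (use fD fX line_vertex_simps(4) in \<open>auto simp: X0_def X_def\<close>)
  moreover have "card {d \<in> D. right d} = card D' + 1"
    using fD v card_Suc_Diff1[of "{d \<in> D. right d}" v] by (simp add: D'_def)
  moreover have "card ({d \<in> D. right d} \<union> X0) \<le> card (D \<union> odd_nb G D)"
    by (rule card_mono[OF finite_Un_odd[OF D]]) (use calculation in auto)
  ultimately show ?thesis using cX by linarith
qed

text \<open>The dual count, for a set without points. A line of \<open>D\<close> has at least
  \<open>k - 1\<close> points other than the one joined to rows; rows touch none of these and
  another line at most one, so points of odd parity and \<open>D\<close> together number at least
  \<open>k\<close>.\<close>

lemma line_heavy:
  assumes D: "D \<subseteq> {..<N}" and l: "\<forall>d \<in> D. \<not> right d" and v: "v \<in> D" "R \<le> v"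
  shows "k \<le> card (D \<union> odd_nb G D)"
proof -
  obtain b a where ba: "v = line_vertex b a" "b < C" "a < S"
    using left_cases[of v] v l D by (metis lessThan_iff not_less subsetD)
  \<comment> \<open>Point \<open>0\<close> is left out because it also has rows as neighbours, and
    its parity is not controlled.\<close>
  define X where "X = point_vertex b ` ({p. p < S \<and> incident q a p} - {0})"
  define D' where "D' = D - {v}"
  have fD: "finite D" using D finite_subset by blast
  have fX: "finite X" by (simp add: X_def)
  have cX: "k \<le> card X + 1"
  proof -
    have "card X = card ({p. p < S \<and> incident q a p} - {0})"
      unfolding X_def by (rule card_image) (simp add: inj_on_def point_vertex_def)
    moreover have "card {p. p < S \<and> incident q a p} - card {0 :: nat} \<le> card ({p. p < S \<and> incident q a p} - {0})"
      by (rule diff_card_le_card_Diff) simp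
    ultimately show ?thesis using card_line[OF q_pos, of k a] by (simp add: S_def)
  qed
  have "card X \<le> card {x \<in> X. \<forall>d \<in> D'. \<not> arc k R mc d x} + card D'"
  proof (rule card_untouched[OF fX])
    show "finite D'" using fD by (simp add: D'_def)
    fix d x x' assume d: "d \<in> D'" and x: "x \<in> X" "x' \<in> X" "arc k R mc d x" "arc k R mc d x'"
    have dD: "\<not> right d" "d \<in> D" "d \<noteq> v" using d l by (auto simp: D'_def)
    obtain p p' where p: "x = point_vertex b p" "p < S" "incident q a p" "p \<noteq> 0"
      "x' = point_vertex b p'" "p' < S" "incident q a p'"
      using x(1,2) unfolding X_def by blast
    have dN: "d < N" using dD D by auto
    show "x = x'"
    proof (rule left_cases[OF dD(1) dN])
      assume "d < R"
      then show ?thesis using x(3) p by (simp add: arc_row_point)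
    next
      fix b' a' assume d': "d = line_vertex b' a'" "a' < S"
      have "b' = b" "incident q a' p" "incident q a' p'"
        using x(3,4) p d' by (simp_all add: arc_line_point)
      moreover have "a \<noteq> a'" using dD(3) ba(1) d'(1) \<open>b' = b\<close> by blast
      ultimately have "p = p'"
        using incident_unique[OF meta_eq_to_obj_eq[OF q_def], of a a' p p'] p d'(2) ba(3) by (simp add: S_def)
      then show ?thesis using p by simp
    qed
  qed
  moreover define X0 where "X0 = {x \<in> X. \<forall>d \<in> D'. \<not> arc k R mc d x}"
  moreover have "card X \<le> card X0 + card D'" using calculation by simp
  moreover have X0: "X0 \<subseteq> odd_nb G D"
  proof
    fix x assume x: "x \<in> X0"
    then obtain p where p: "x = point_vertex b p" "p < S" "incident q a p" by (auto simp: X0_def X_def)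
    have "arc k R mc v x" using p ba by (simp add: arc_line_point)
    then have "{d \<in> D. arc k R mc d x} = {v}"
      using x v by (auto simp: X0_def D'_def)
    moreover have "x < N" "right x" using p ba point_vertex_less point_vertex_simps(4) by simp_all
    ultimately show "x \<in> odd_nb G D" using odd_right[OF _ D, of x] by simp
  qed
  moreover have "card (D \<union> X0) = card D + card X0"
    by (rule card_Un_disjoint)
      (use fD fX l point_vertex_simps(4) in \<open>auto simp: X0_def X_def\<close>)
  moreover have "card D = card D' + 1"
    using fD v card_Suc_Diff1[of D v] by (simp add: D'_def)
  moreover have "card (D \<union> X0) \<le> card (D \<union> odd_nb G D)"
    by (rule card_mono[OF finite_Un_odd[OF D]]) (use X0 in auto)
  ultimately show ?thesis using cX by linarith
qed

lemma rows_weight: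
  assumes D: "D \<subseteq> {..<R}"
  shows "card (D \<union> odd_nb G D) = card D + card {b. b < C \<and> odd (card {u \<in> D. mc b u})}"
proof -
  have DN: "D \<subseteq> {..<N}" using D by (auto simp: N_eq)
  have fD: "finite D" using D finite_subset by blast
  let ?B = "{b. b < C \<and> odd (card {u \<in> D. mc b u})}"
  have "odd_nb G D = (\<lambda>b. point_vertex b 0) ` ?B"
  proof (intro equalityI subsetI)
    fix v assume v: "v \<in> odd_nb G D"
    have r: "right v"
    proof (rule ccontr)
      assume "\<not> right v"
      then have "odd (card {u \<in> D. arc k R mc v u})" using v odd_left[OF _ DN] by blast
      moreover have "{u \<in> D. arc k R mc v u} = {}" using D arc_right row_left by blast
      ultimately show False by simp
    qed
    then have o: "v < N" "odd (card {u \<in> D. arc k R mc u v})" using v odd_right[OF _ DN] by blast+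
    obtain b p where bp: "v = point_vertex b p" "b < C" "p < S" by (rule right_cases[OF r o(1)])
    have "{u \<in> D. arc k R mc u v} = {u \<in> D. p = 0 \<and> mc b u}"
      using D bp arc_row_point by auto
    then have "p = 0" "odd (card {u \<in> D. mc b u})" using o(2) by (cases "p = 0"; simp)+
    then show "v \<in> (\<lambda>b. point_vertex b 0) ` ?B" using bp by auto
  next
    fix v assume "v \<in> (\<lambda>b. point_vertex b 0) ` ?B"
    then obtain b where b: "v = point_vertex b 0" "b < C" "odd (card {u \<in> D. mc b u})" by auto
    have "{u \<in> D. arc k R mc u v} = {u \<in> D. mc b u}"
      using D b S_pos arc_row_point by auto
    then show "v \<in> odd_nb G D"
      using b S_pos odd_right[OF _ DN, of v] point_vertex_less[of b 0] point_vertex_simps(4)[of 0 b] by simp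
  qed
  moreover have "card ((\<lambda>b. point_vertex b 0) ` ?B) = card ?B"
    by (rule card_image) (use S_pos in \<open>simp add: inj_on_def point_vertex_def\<close>)
  moreover have "D \<inter> (\<lambda>b. point_vertex b 0) ` ?B = {}"
    using D by (auto simp: point_vertex_def)
  ultimately show ?thesis using fD by (simp add: card_Un_disjoint)
qed

text \<open>Large \<open>k\<close> rules out points by \<open>right_heavy\<close> and then lines by
  \<open>line_heavy\<close>. What remains is a set of rows, whose only odd neighbours are the points
  \<open>(0, 0)\<close> of the columns it hits oddly.\<close>

theorem gadget_local_set:
  assumes "K + 2 \<le> k"
  shows "local_set_le G K \<longleftrightarrow>
    (\<exists>D \<subseteq> {..<R}. D \<noteq> {} \<and> card D + card {b. b < C \<and> odd (card {u \<in> D. mc b u})} \<le> K)"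
proof
  assume "local_set_le G K"
  then obtain D where D: "D \<noteq> {}" "D \<subseteq> {..<N}" "card (D \<union> odd_nb G D) \<le> K"
    by (auto simp: local_set_le_def verts_G)
  have l: "\<forall>d \<in> D. \<not> right d"
  proof (rule ballI, rule notI)
    fix d assume "d \<in> D" "right d"
    then have "k < card (D \<union> odd_nb G D)" by (rule right_heavy[OF D(2)])
    then show False using D(3) assms by linarith
  qed
  have "D \<subseteq> {..<R}"
  proof (rule subsetI, rule ccontr)
    fix d assume "d \<in> D" "d \<notin> {..<R}"
    then have "k \<le> card (D \<union> odd_nb G D)" by (intro line_heavy[OF D(2) l]) auto
    then show False using D(3) assms by linarith
  qed
  then show "\<exists>D \<subseteq> {..<R}. D \<noteq> {} \<and> card D + card {b. b < C \<and> odd (card {u \<in> D. mc b u})} \<le> K"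
    using D rows_weight by auto
next
  assume "\<exists>D \<subseteq> {..<R}. D \<noteq> {} \<and> card D + card {b. b < C \<and> odd (card {u \<in> D. mc b u})} \<le> K"
  then obtain D where D: "D \<subseteq> {..<R}" "D \<noteq> {}"
    "card D + card {b. b < C \<and> odd (card {u \<in> D. mc b u})} \<le> K" by blast
  moreover have "D \<subseteq> {..<N}" using D(1) by (auto simp: N_eq)
  ultimately show "local_set_le G K"
    unfolding local_set_le_def verts_G using rows_weight[OF D(1)] by (intro exI[of _ D]) simp
qed

end

section \<open>Quadratic systems and light codewords\<close>

text \<open>\<open>Y\<close> collects the variables with value one. Variable \<open>0\<close> is the
  constant one, so linear terms and constants are products as well.\<close>

definition quadratic_solution :: "nat \<Rightarrow> (nat \<Rightarrow> nat \<Rightarrow> nat \<Rightarrow> bool) \<Rightarrow> nat set \<Rightarrow> bool" where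
  "quadratic_solution n Q Y \<longleftrightarrow> Y \<subseteq> {..<n} \<and> 0 \<in> Y \<and>
     (\<forall>g<n. g \<in> Y \<longleftrightarrow> odd (card {(i, j) \<in> Y \<times> Y. Q g i j}))"

text \<open>The linear constraints on an \<open>n \<times> n\<close> matrix \<open>M\<close>: symmetry, \<open>M 0 i = M i i\<close>, and the quadratic
  system with the monomial \<open>y i * y j\<close> replaced by \<open>M i j\<close>.\<close>

definition constr :: "nat \<Rightarrow> (nat \<Rightarrow> nat \<Rightarrow> nat \<Rightarrow> bool) \<Rightarrow> nat \<Rightarrow> nat \<Rightarrow> nat \<Rightarrow> bool" where
  "constr n Q e i j \<longleftrightarrow>
     (if e < n * n then i \<noteq> j \<and> (e = i * n + j \<or> e = j * n + i)
      else if e < n * n + n then (i = 0 \<and> j = e - n * n) \<noteq> (i = e - n * n \<and> j = e - n * n)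
      else Q (e - (n * n + n)) i j \<noteq> (i = e - (n * n + n) \<and> j = e - (n * n + n)))"

text \<open>An upper bound for rank one: at most \<open>L div 2\<close> odd positions in each
  direction of the tensor code, where \<open>L = code_len n\<close>, plus at most
  \<open>n * n\<close> entries of the matrix itself.\<close>

definition threshold :: "nat \<Rightarrow> nat" where
  "threshold n = code_len n div 2 * (code_len n div 2) + n * n"

text \<open>Each of the \<open>n * n + 2 * n\<close> constraints is repeated
  \<open>threshold n + 1\<close> times, so that violating a single one already exceeds the
  threshold.\<close>

definition num_columns :: "nat \<Rightarrow> nat" where
  "num_columns n = code_len n * code_len n + (threshold n + 1) * (n * n + 2 * n)"

definition column :: "nat \<Rightarrow> (nat \<Rightarrow> nat \<Rightarrow> nat \<Rightarrow> bool) \<Rightarrow> nat \<Rightarrow> nat \<Rightarrow> nat \<Rightarrow> bool" where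
  "column n Q b i j \<longleftrightarrow>
     (if b < code_len n * code_len n
      then code n (b mod code_len n) i = 1 \<and> code n (b div code_len n) j = 1
      else constr n Q ((b - code_len n * code_len n) mod (n * n + 2 * n)) i j)"

definition codeword :: "nat \<Rightarrow> nat set \<Rightarrow> nat set" where
  "codeword n S = {l. l < code_len n \<and> odd (card {i \<in> S. code n l i = 1})}"

lemma odd_card_xor:
  assumes "finite A"
  shows "odd (card {p \<in> A. P p \<noteq> R p}) \<longleftrightarrow> odd (card {p \<in> A. P p}) \<noteq> odd (card {p \<in> A. R p})"
proof -
  have "{p \<in> A. P p \<noteq> R p} = sym_diff {p \<in> A. P p} {p \<in> A. R p}" by auto
  then show ?thesis using odd_card_sym_diff[of "{p \<in> A. P p}" "{p \<in> A. R p}"] assms by simp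
qed

lemma finite_codeword: "finite (codeword n S)"
  by (simp add: codeword_def)

lemma codeword_sym_diff:
  assumes "finite S" "finite T"
  shows "codeword n (sym_diff S T) = sym_diff (codeword n S) (codeword n T)"
proof -
  have "odd (card {i \<in> sym_diff S T. code n l i = 1}) \<longleftrightarrow>
      odd (card {i \<in> S. code n l i = 1}) \<noteq> odd (card {i \<in> T. code n l i = 1})" for l
  proof -
    have "{i \<in> sym_diff S T. code n l i = 1} = sym_diff {i \<in> S. code n l i = 1} {i \<in> T. code n l i = 1}"
      by auto
    then show ?thesis
      using odd_card_sym_diff[of "{i \<in> S. code n l i = 1}" "{i \<in> T. code n l i = 1}"] assms by simp
  qed
  then show ?thesis by (auto simp: codeword_def)
qed

text \<open>Every element of the union lies in exactly two of \<open>A\<close>, \<open>B\<close> and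
  their symmetric difference. This is the source of the factor \<open>3/2\<close>.\<close>

lemma card_sym_diff_Un:
  assumes "finite A" "finite B"
  shows "card A + card B + card (sym_diff A B) = 2 * card (A \<union> B)"
proof -
  have "card (sym_diff A B) = card (A - B) + card (B - A)"
    by (rule card_Un_disjoint) (use assms in auto)
  moreover have "card A = card (A - B) + card (A \<inter> B)" "card B = card (B - A) + card (B \<inter> A)"
    using card_Int_Diff[OF assms(1), of B] card_Int_Diff[OF assms(2), of A] by simp_all
  moreover have "card A + card B = card (A \<union> B) + card (A \<inter> B)"
    by (rule card_Un_Int[OF assms])
  moreover have "B \<inter> A = A \<inter> B" by (rule Int_commute)
  ultimately show ?thesis by simp
qed

lemma card_div_mod:
  fixes L :: nat
  assumes "0 < L"
  shows "card {b. b < L * L \<and> P (b mod L) (b div L)} = card {(u, v). u < L \<and> v < L \<and> P u v}"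
proof (rule bij_betw_same_card)
  show "bij_betw (\<lambda>b. (b mod L, b div L)) {b. b < L * L \<and> P (b mod L) (b div L)}
      {(u, v). u < L \<and> v < L \<and> P u v}"
  proof (rule bij_betw_byWitness[where f' = "\<lambda>(u, v). u + v * L"])
    show "(\<lambda>(u, v). u + v * L) ` {(u, v). u < L \<and> v < L \<and> P u v} \<subseteq> {b. b < L * L \<and> P (b mod L) (b div L)}"
    proof
      fix b assume "b \<in> (\<lambda>(u, v). u + v * L) ` {(u, v). u < L \<and> v < L \<and> P u v}"
      then obtain u v where uv: "b = u + v * L" "u < L" "v < L" "P u v" by auto
      have "b < (v + 1) * L" using uv by simp
      also have "\<dots> \<le> L * L" using uv by (intro mult_le_mono1) simp
      finally show "b \<in> {b. b < L * L \<and> P (b mod L) (b div L)}" using uv by simp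
    qed
  qed (use assms in \<open>auto simp: less_mult_imp_div_less\<close>)
qed

lemma index_eq:
  fixes n :: nat
  assumes "b < n" "j < n"
  shows "a * n + b = i * n + j \<longleftrightarrow> a = i \<and> b = j"
proof
  assume h: "a * n + b = i * n + j"
  have "(a * n + b) div n = (i * n + j) div n" "(a * n + b) mod n = (i * n + j) mod n"
    by (simp_all only: h)
  then show "a = i \<and> b = j" using assms by simp
qed simp

lemma index_less:
  fixes n :: nat
  assumes "a < n" "b < n"
  shows "a * n + b < n * n"
proof -
  have "a * n + b < (a + 1) * n" using assms by simp
  also have "\<dots> \<le> n * n" by (rule mult_le_mono1) (use assms in simp)
  finally show ?thesis .
qed

lemma constr_symmetry:
  assumes "a < n" "b < n" "i < n" "j < n"
  shows "constr n Q (a * n + b) i j \<longleftrightarrow> i \<noteq> j \<and> ((i = a \<and> j = b) \<or> (i = b \<and> j = a))"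
  using index_less[OF assms(1,2)] index_eq[OF assms(2,4), of a i] index_eq[OF assms(2,3), of a j]
  by (auto simp: constr_def)

context
  fixes n \<nu> :: nat and Q :: "nat \<Rightarrow> nat \<Rightarrow> nat \<Rightarrow> bool"
  assumes n: "n = 2 ^ \<nu>" and \<nu>: "1 \<le> \<nu>"
begin

lemma codeword_balanced:
  assumes "S \<subseteq> {..<n}" "S \<noteq> {}"
  shows "2 * card (codeword n S) \<le> code_len n" "9 * code_len n \<le> 20 * card (codeword n S)"
proof -
  have fS: "finite S" using assms finite_subset by blast
  have "(\<Sum>i\<in>S. code n l i) = card {i \<in> S. code n l i = 1}" for l
  proof -
    have "(\<Sum>i\<in>S. code n l i) = (\<Sum>i\<in>S. of_bool (code n l i = 1))"
      by (rule sum.cong) (auto simp: code_def)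
    then show ?thesis using fS by (simp add: sum.If_cases of_bool_def Int_def)
  qed
  then have "codeword n S = {l. l < code_len n \<and> odd (\<Sum>i\<in>S. code n l i)}"
    by (simp add: codeword_def)
  then show "2 * card (codeword n S) \<le> code_len n" "9 * code_len n \<le> 20 * card (codeword n S)"
    using code_balanced[OF n \<nu> assms] by simp_all
qed

lemma n2: "2 \<le> n"
  by (rule n_ge[OF n \<nu>])

text \<open>Makes the surplus of matrices of larger rank outweigh the term \<open>n * n\<close> in
  the threshold.\<close>

lemma code_len_ge: "8 * n \<le> code_len n"
proof -
  have "2 * 2 * 2 \<le> n * n * n" by (intro mult_le_mono n2)
  then have "8 * n \<le> (n * n * n) * (4 * n)" by (intro mult_le_mono) simp_all
  also have "\<dots> \<le> base_len n" using n2 by (simp add: base_len_def power3_eq_cube)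
  also have "\<dots> \<le> base_len n ^ 16" using n2 by (intro self_le_power) (simp_all add: base_len_def)
  finally show ?thesis by (simp add: code_len_def)
qed

lemma code_len_pos: "0 < code_len n"
  using code_len_ge n2 by linarith

text \<open>On \<open>Y \<times> Y\<close> all constraints are even, and entry \<open>(u, v)\<close>
  of the tensor codeword is odd exactly if \<open>u\<close> and \<open>v\<close> both lie in
  \<open>codeword n Y\<close>, so the weight is a square.\<close>

lemma solution_light:
  assumes Y: "quadratic_solution n Q Y"
  defines "M \<equiv> Y \<times> Y"
  shows "card M + card {b. b < num_columns n \<and> odd (card {(i, j) \<in> M. column n Q b i j})} \<le> threshold n"
proof -
  let ?L = "code_len n"
  have Yn: "Y \<subseteq> {..<n}" and Y0: "0 \<in> Y" and YQ: "\<And>g. g < n \<Longrightarrow> g \<in> Y \<longleftrightarrow> odd (card {(i, j) \<in> Y \<times> Y. Q g i j})"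
    using Y by (auto simp: quadratic_solution_def)
  have fY: "finite Y" using Yn finite_subset by blast
  then have fM: "finite M" by (simp add: M_def)
  have "card Y \<le> n" using card_mono[OF _ Yn] by simp
  then have cM: "card M \<le> n * n" by (simp add: M_def card_cartesian_product mult_le_mono)
  have sat: "even (card {(i, j) \<in> M. constr n Q e i j})" if e: "e < n * n + 2 * n" for e
  proof -
    consider "e < n * n" | "n * n \<le> e" "e < n * n + n" | "n * n + n \<le> e" by linarith
    then show ?thesis
    proof cases
      case 1
      define a b where "a = e div n" and "b = e mod n"
      have ab: "a < n" "b < n" "e = a * n + b"
        using 1 n2 by (simp_all add: a_def b_def less_mult_imp_div_less)
      have c: "constr n Q e i j \<longleftrightarrow> i \<noteq> j \<and> ((i = a \<and> j = b) \<or> (i = b \<and> j = a))" if "(i, j) \<in> M" for i j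
        unfolding ab(3) by (rule constr_symmetry) (use that Yn ab in \<open>auto simp: M_def\<close>)
      have "{(i, j) \<in> M. constr n Q e i j} = {(i, j) \<in> M. i \<noteq> j \<and> ((i = a \<and> j = b) \<or> (i = b \<and> j = a))}"
        using c by blast
      also have "\<dots> = (if a \<noteq> b \<and> a \<in> Y \<and> b \<in> Y then {(a, b), (b, a)} else {})"
        by (auto simp: M_def)
      finally show ?thesis by simp
    next
      case 2
      define a where "a = e - n * n"
      \<comment> \<open>Since \<open>0 \<in> Y\<close>, the entries \<open>(0, a)\<close> and
        \<open>(a, a)\<close> are present together or not at all; for \<open>a = 0\<close> the
        constraint is empty.\<close>
      have "{(i, j) \<in> M. constr n Q e i j} = (if a \<noteq> 0 \<and> a \<in> Y then {(0, a), (a, a)} else {})"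
        using 2 Y0 by (auto simp: constr_def M_def a_def)
      then show ?thesis by auto
    next
      case 3
      define g where "g = e - (n * n + n)"
      have g: "g < n" using 3 e by (simp add: g_def)
      have "{(i, j) \<in> M. constr n Q e i j} = {p \<in> M. (case p of (i, j) \<Rightarrow> Q g i j) \<noteq> (p = (g, g))}"
        using 3 by (auto simp: constr_def g_def)
      moreover have "odd (card {p \<in> M. p = (g, g)}) \<longleftrightarrow> g \<in> Y"
      proof -
        have "{p \<in> M. p = (g, g)} = (if g \<in> Y then {(g, g)} else {})" by (auto simp: M_def)
        then show ?thesis by simp
      qed
      moreover have "{p \<in> M. case p of (i, j) \<Rightarrow> Q g i j} = {(i, j) \<in> Y \<times> Y. Q g i j}"
        by (auto simp: M_def)
      ultimately show ?thesis
        using odd_card_xor[OF fM, of "\<lambda>(i, j). Q g i j" "\<lambda>p. p = (g, g)"] YQ[OF g] by (simp only:) blast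
    qed
  qed
  have "{b. b < num_columns n \<and> odd (card {(i, j) \<in> M. column n Q b i j})} \<subseteq>
      {b. b < ?L * ?L \<and> b mod ?L \<in> codeword n Y \<and> b div ?L \<in> codeword n Y}"
  proof
    fix b assume "b \<in> {b. b < num_columns n \<and> odd (card {(i, j) \<in> M. column n Q b i j})}"
    then have b: "b < num_columns n" "odd (card {(i, j) \<in> M. column n Q b i j})" by simp_all
    have bL: "b < ?L * ?L"
    proof (rule ccontr)
      assume nb: "\<not> b < ?L * ?L"
      have "(b - ?L * ?L) mod (n * n + 2 * n) < n * n + 2 * n" using n2 by simp
      from sat[OF this] show False using b(2) nb by (simp add: column_def)
    qed
    have "{(i, j) \<in> M. column n Q b i j} = {i \<in> Y. code n (b mod ?L) i = 1} \<times> {i \<in> Y. code n (b div ?L) i = 1}"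
      using bL by (auto simp: column_def M_def)
    then have "odd (card {i \<in> Y. code n (b mod ?L) i = 1})" "odd (card {i \<in> Y. code n (b div ?L) i = 1})"
      using b(2) by (simp_all add: card_cartesian_product)
    then show "b \<in> {b. b < ?L * ?L \<and> b mod ?L \<in> codeword n Y \<and> b div ?L \<in> codeword n Y}"
      using bL code_len_pos by (simp add: codeword_def less_mult_imp_div_less)
  qed
  then have "card {b. b < num_columns n \<and> odd (card {(i, j) \<in> M. column n Q b i j})} \<le>
      card {b. b < ?L * ?L \<and> b mod ?L \<in> codeword n Y \<and> b div ?L \<in> codeword n Y}"
    by (intro card_mono) simp_all
  also have "\<dots> = card {(u, v). u < ?L \<and> v < ?L \<and> u \<in> codeword n Y \<and> v \<in> codeword n Y}"
    by (rule card_div_mod[OF code_len_pos])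
  also have "\<dots> = card (codeword n Y \<times> codeword n Y)"
    by (rule arg_cong[of _ _ card]) (auto simp: codeword_def)
  also have "\<dots> \<le> ?L div 2 * (?L div 2)"
  proof -
    have "card (codeword n Y) \<le> ?L div 2" using codeword_balanced(1)[OF Yn] Y0 by fastforce
    then show ?thesis by (simp add: card_cartesian_product mult_le_mono)
  qed
  finally show ?thesis using cM by (simp add: threshold_def)
qed

text \<open>Lightness forces the linear constraints through their repetition, and then equality of
  all nonzero columns through the weight gap. With symmetry this leaves only
  \<open>Y \<times> Y\<close>, for which the linearized equations are the original ones.\<close>

lemma light_solution:
  assumes M: "M \<subseteq> {..<n} \<times> {..<n}" "M \<noteq> {}"
    and light: "card M + card {b. b < num_columns n \<and> odd (card {(i, j) \<in> M. column n Q b i j})} \<le> threshold n"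
  shows "\<exists>Y. quadratic_solution n Q Y"
proof -
  let ?L = "code_len n" and ?E = "n * n + 2 * n"
  let ?odd = "{b. b < num_columns n \<and> odd (card {(i, j) \<in> M. column n Q b i j})}"
  have fM: "finite M" using M(1) finite_subset by blast
  have E: "0 < ?E" using n2 by simp
  have sat: "even (card {(i, j) \<in> M. constr n Q e i j})" if e: "e < ?E" for e
  proof (rule ccontr)
    assume o: "odd (card {(i, j) \<in> M. constr n Q e i j})"
    \<comment> \<open>The number of the column holding copy \<open>t\<close> of constraint
      \<open>e\<close>.\<close>
    let ?f = "\<lambda>t. ?L * ?L + (t * ?E + e)"
    have "inj_on ?f {..<threshold n + 1}" using E by (simp add: inj_on_def)
    moreover have "?f ` {..<threshold n + 1} \<subseteq> ?odd"
    proof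
      fix b assume "b \<in> ?f ` {..<threshold n + 1}"
      then obtain t where t: "t < threshold n + 1" "b = ?f t" by auto
      have "t * ?E + e < (t + 1) * ?E" using e by simp
      also have "\<dots> \<le> (threshold n + 1) * ?E" by (rule mult_le_mono1) (use t in simp)
      finally have "b < num_columns n" using t by (simp add: num_columns_def)
      moreover have "(b - ?L * ?L) mod ?E = e" using t e by (simp only: diff_add_inverse mod_mult_self3 mod_less)
      ultimately show "b \<in> ?odd" using o t(2) by (simp add: column_def)
    qed
    ultimately have "card {..<threshold n + 1} \<le> card ?odd"
      by (rule card_inj_on_le) simp
    then show False using light by simp
  qed
  have sym: "(i, j) \<in> M \<longleftrightarrow> (j, i) \<in> M" if "i < n" "j < n" "i \<noteq> j" for i j
  proof -
    note e = index_less[OF that(1,2)]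
    have c: "constr n Q (i * n + j) i' j' \<longleftrightarrow> ((i', j') = (i, j)) \<noteq> ((i', j') = (j, i))" if "(i', j') \<in> M" for i' j'
      using constr_symmetry[OF \<open>i < n\<close> \<open>j < n\<close>, of i' j' Q] that M(1) \<open>i \<noteq> j\<close> by auto
    have "{(i', j') \<in> M. constr n Q (i * n + j) i' j'} = {p \<in> M. (p = (i, j)) \<noteq> (p = (j, i))}"
      using c by auto
    moreover have "odd (card {p \<in> M. p = x}) \<longleftrightarrow> x \<in> M" for x
    proof -
      have "{p \<in> M. p = x} = (if x \<in> M then {x} else {})" by auto
      then show ?thesis by simp
    qed
    ultimately show ?thesis
      using sat[of "i * n + j"] e odd_card_xor[OF fM, of "\<lambda>p. p = (i, j)" "\<lambda>p. p = (j, i)"] by simp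
  qed
  define c where "c j = {i. (i, j) \<in> M}" for j
  have cn: "c j \<subseteq> {..<n}" for j using M(1) by (auto simp: c_def)
  have fc: "finite (c j)" for j using cn finite_subset by blast
  have rank1: "c j = c j'" if ne: "c j \<noteq> {}" "c j' \<noteq> {}" for j j'
  proof (rule ccontr)
    assume neq: "c j \<noteq> c j'"
    \<comment> \<open>Row \<open>u\<close> of the code generator applied to \<open>M\<close> from
      the left. Row \<open>u\<close> of the tensor codeword is then the codeword of
      \<open>z u\<close>, and \<open>z u\<close> is nonempty once the codeword of some column
      contains \<open>u\<close>.\<close>
    define z where "z u = {j. j < n \<and> odd (card {i \<in> c j. code n u i = 1})}" for u
    have par: "odd (card {(i, j) \<in> M. code n u i = 1 \<and> code n v j = 1}) \<longleftrightarrow>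
        odd (card {j \<in> z u. code n v j = 1})" for u v
    proof -
      let ?J = "{j. j < n \<and> code n v j = 1}"
      have "{(i, j) \<in> M. code n u i = 1 \<and> code n v j = 1} =
          (\<lambda>(j, i). (i, j)) ` (SIGMA j:?J. {i \<in> c j. code n u i = 1})"
        using M(1) by (auto simp: c_def image_iff)
      then have "card {(i, j) \<in> M. code n u i = 1 \<and> code n v j = 1} =
          (\<Sum>j\<in>?J. card {i \<in> c j. code n u i = 1})"
        using fc by (simp add: card_image inj_on_def)
      then have "odd (card {(i, j) \<in> M. code n u i = 1 \<and> code n v j = 1}) \<longleftrightarrow>
          odd (card {j \<in> ?J. odd (card {i \<in> c j. code n u i = 1})})"
        by (simp add: even_sum_iff)
      moreover have "{j \<in> ?J. odd (card {i \<in> c j. code n u i = 1})} = {j \<in> z u. code n v j = 1}"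
        by (auto simp: z_def)
      ultimately show ?thesis by simp
    qed
    define U where "U = codeword n (c j) \<union> codeword n (c j')"
    have jn: "j < n" "j' < n" using ne M(1) by (auto simp: c_def)
    have zU: "z u \<noteq> {}" if "u \<in> U" for u
      using that jn by (auto simp: U_def z_def codeword_def)
    have "sym_diff (c j) (c j') \<noteq> {}" using neq by auto
    moreover have "sym_diff (c j) (c j') \<subseteq> {..<n}" using cn[of j] cn[of j'] by auto
    ultimately have "9 * ?L \<le> 20 * card (codeword n (sym_diff (c j) (c j')))"
      by (intro codeword_balanced(2))
    moreover have "9 * ?L \<le> 20 * card (codeword n (c j))" "9 * ?L \<le> 20 * card (codeword n (c j'))"
      by (rule codeword_balanced(2)[OF cn ne(1)], rule codeword_balanced(2)[OF cn ne(2)])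
    \<comment> \<open>Three codewords of weight at least \<open>9/20\<close> of the length each, for
      the two columns and their sum, cover the union twice.\<close>
    ultimately have U: "27 * ?L \<le> 40 * card U"
      using card_sym_diff_Un[OF finite_codeword[of n "c j"] finite_codeword[of n "c j'"]]
      unfolding U_def codeword_sym_diff[OF fc fc] by linarith
    have "card U * (9 * ?L) \<le> (\<Sum>u\<in>U. 20 * card (codeword n (z u)))"
    proof -
      have "(\<Sum>u\<in>U. 9 * ?L) \<le> (\<Sum>u\<in>U. 20 * card (codeword n (z u)))"
        by (rule sum_mono, rule codeword_balanced(2)) (use zU in \<open>auto simp: z_def\<close>)
      then show ?thesis by simp
    qed
    also have "\<dots> \<le> (\<Sum>u<?L. 20 * card (codeword n (z u)))"
      by (rule sum_mono2) (auto simp: U_def codeword_def)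
    also have "\<dots> = 20 * (\<Sum>u<?L. card {v. v < ?L \<and> odd (card {(i, j) \<in> M. code n u i = 1 \<and> code n v j = 1})})"
      by (simp only: sum_distrib_left par codeword_def)
    also have "\<dots> = 20 * card {b. b < ?L * ?L \<and>
        odd (card {(i, j) \<in> M. code n (b mod ?L) i = 1 \<and> code n (b div ?L) j = 1})}"
      by (simp only: card_div_mod[OF code_len_pos, of "\<lambda>u v. odd (card {(i, j) \<in> M. code n u i = 1 \<and> code n v j = 1})"]
          card_sigma_nat)
    also have "\<dots> \<le> 20 * card ?odd"
    proof -
      have "{b. b < ?L * ?L \<and> odd (card {(i, j) \<in> M. code n (b mod ?L) i = 1 \<and> code n (b div ?L) j = 1})} \<subseteq> ?odd"
        by (auto simp: column_def num_columns_def)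
      then show ?thesis by (intro mult_le_mono2 card_mono) simp_all
    qed
    also have "\<dots> \<le> 20 * threshold n" using light by simp
    finally have h: "card U * (9 * ?L) \<le> 20 * threshold n" .
    \<comment> \<open>Everything is scaled by \<open>800\<close>: the left side is
      \<open>243\<close> times the squared length and the threshold gives \<open>200\<close> times
      it plus \<open>800 * (n * n)\<close>, whereas the squared length is at least
      \<open>64 * (n * n)\<close>.\<close>
    have "27 * ?L * (9 * ?L) \<le> 40 * card U * (9 * ?L)" by (rule mult_le_mono1[OF U])
    also have "\<dots> \<le> 800 * threshold n" using h by simp
    also have "\<dots> \<le> 200 * (?L * ?L) + 800 * (n * n)"
    proof -
      have "(2 * (?L div 2)) * (2 * (?L div 2)) \<le> ?L * ?L" by (rule mult_le_mono) simp_all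
      then show ?thesis unfolding threshold_def by simp
    qed
    finally have "43 * (?L * ?L) \<le> 800 * (n * n)" by simp
    moreover have "(8 * n) * (8 * n) \<le> ?L * ?L" by (rule mult_le_mono[OF code_len_ge code_len_ge])
    moreover have "0 < n * n" using n2 by simp
    ultimately show False by linarith
  qed
  obtain i0 j0 where ij0: "(i0, j0) \<in> M" using M(2) by auto
  define Y where "Y = c j0"
  have Yn: "Y \<subseteq> {..<n}" unfolding Y_def by (rule cn)
  have cY: "c j = Y" if "c j \<noteq> {}" for j
    unfolding Y_def by (rule rank1[OF that]) (use ij0 in \<open>auto simp: c_def\<close>)
  have swap: "(j, i) \<in> M" if "(i, j) \<in> M" for i j
  proof (cases "i = j")
    case False
    then show ?thesis using sym[of i j] that M(1) by blast
  qed (use that in simp)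
  have MY: "M = Y \<times> Y"
  proof (intro equalityI subrelI)
    fix i j assume ij: "(i, j) \<in> M"
    have "c j = Y" "c i = Y" using ij swap[OF ij] by (intro cY; auto simp: c_def)+
    then show "(i, j) \<in> Y \<times> Y" using ij swap[OF ij] by (auto simp: c_def)
  next
    fix i j assume ij: "(i, j) \<in> Y \<times> Y"
    then have "(j0, j) \<in> M" using swap by (auto simp: Y_def c_def)
    then have "c j = Y" by (intro cY) (auto simp: c_def)
    then show "(i, j) \<in> M" using ij by (auto simp: c_def)
  qed
  have i0: "i0 \<in> Y" "i0 < n" using ij0 M(1) by (auto simp: Y_def c_def)
  have mem: "odd (card {p \<in> M. p = x}) \<longleftrightarrow> x \<in> M" for x
  proof -
    have "{p \<in> M. p = x} = (if x \<in> M then {x} else {})" by auto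
    then show ?thesis by simp
  qed
  have "{(i, j) \<in> M. constr n Q (n * n + i0) i j} = {p \<in> M. (p = (0, i0)) \<noteq> (p = (i0, i0))}"
    using i0 by (auto simp: constr_def)
  then have "even (card {p \<in> M. (p = (0, i0)) \<noteq> (p = (i0, i0))})"
    using sat[of "n * n + i0"] i0 by simp
  then have "(0, i0) \<in> M \<longleftrightarrow> (i0, i0) \<in> M"
    using odd_card_xor[OF fM, of "\<lambda>p. p = (0, i0)" "\<lambda>p. p = (i0, i0)"] unfolding mem by blast
  \<comment> \<open>The constraint for row \<open>0\<close> against the diagonal serves this
    purpose: a nonzero rank-one matrix cannot have the constant one set to zero.\<close>
  then have Y0: "0 \<in> Y" using i0 by (simp add: MY)
  have "g \<in> Y \<longleftrightarrow> odd (card {(i, j) \<in> Y \<times> Y. Q g i j})" if g: "g < n" for g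
  proof -
    have "{(i, j) \<in> M. constr n Q (n * n + n + g) i j} = {p \<in> M. (case p of (i, j) \<Rightarrow> Q g i j) \<noteq> (p = (g, g))}"
      by (auto simp: constr_def)
    then have "even (card {p \<in> M. (case p of (i, j) \<Rightarrow> Q g i j) \<noteq> (p = (g, g))})"
      using sat[of "n * n + n + g"] g by simp
    moreover have "{(i, j) \<in> M. Q g i j} = {p \<in> M. case p of (i, j) \<Rightarrow> Q g i j}" by auto
    ultimately have "odd (card {(i, j) \<in> M. Q g i j}) \<longleftrightarrow> (g, g) \<in> M"
      using odd_card_xor[OF fM, of "\<lambda>(i, j). Q g i j" "\<lambda>p. p = (g, g)"] unfolding mem by (simp only:) blast
    then show ?thesis by (simp add: MY)
  qed
  then show ?thesis using Yn Y0 unfolding quadratic_solution_def by blast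
qed

theorem quadratic_solution_iff:
  "(\<exists>Y. quadratic_solution n Q Y) \<longleftrightarrow>
    (\<exists>D \<subseteq> {..<n * n}. D \<noteq> {} \<and>
      card D + card {b. b < num_columns n \<and> odd (card {r \<in> D. column n Q b (r div n) (r mod n)})} \<le> threshold n)"
proof -
  let ?g = "\<lambda>r. (r div n, r mod n)"
  have n0: "0 < n" using n2 by simp
  have gg: "?g (i * n + j) = (i, j)" if "j < n" for i j using that by simp
  have inj: "inj ?g"
  proof (rule injI)
    fix x y assume "?g x = ?g y"
    then have "x div n * n + x mod n = y div n * n + y mod n" by simp
    then show "x = y" by simp
  qed
  have tr: "card (?g ` D) = card D" "card {(i, j) \<in> ?g ` D. P i j} = card {r \<in> D. P (r div n) (r mod n)}" for D P
  proof -
    show "card (?g ` D) = card D" by (rule card_image, rule inj_on_subset[OF inj]) simp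
    have "{(i, j) \<in> ?g ` D. P i j} = ?g ` {r \<in> D. P (r div n) (r mod n)}" by auto
    then show "card {(i, j) \<in> ?g ` D. P i j} = card {r \<in> D. P (r div n) (r mod n)}"
      by (simp only:) (rule card_image, rule inj_on_subset[OF inj], simp)
  qed
  show ?thesis
  proof
    assume "\<exists>Y. quadratic_solution n Q Y"
    then obtain Y where Y: "quadratic_solution n Q Y" by blast
    then have Yn: "Y \<subseteq> {..<n}" "0 \<in> Y" by (simp_all add: quadratic_solution_def)
    define D where "D = (\<lambda>(i, j). i * n + j) ` (Y \<times> Y)"
    have D: "?g ` D = Y \<times> Y"
      unfolding D_def image_image using Yn(1) gg by (force simp: image_iff)
    have Dn: "D \<subseteq> {..<n * n}"
    proof
      fix r assume "r \<in> D"
      then obtain i j where r: "r = i * n + j" "i < n" "j < n" using Yn(1) by (auto simp: D_def)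
      then have "r < (i + 1) * n" by simp
      also have "\<dots> \<le> n * n" by (rule mult_le_mono1) (use r in simp)
      finally show "r \<in> {..<n * n}" by simp
    qed
    have "D \<noteq> {}" using Yn by (auto simp: D_def)
    moreover have "card D + card {b. b < num_columns n \<and> odd (card {r \<in> D. column n Q b (r div n) (r mod n)})} \<le> threshold n"
      using solution_light[OF Y] unfolding D[symmetric] tr .
    ultimately show "\<exists>D \<subseteq> {..<n * n}. D \<noteq> {} \<and>
      card D + card {b. b < num_columns n \<and> odd (card {r \<in> D. column n Q b (r div n) (r mod n)})} \<le> threshold n"
      using Dn by blast
  next
    assume "\<exists>D \<subseteq> {..<n * n}. D \<noteq> {} \<and>
      card D + card {b. b < num_columns n \<and> odd (card {r \<in> D. column n Q b (r div n) (r mod n)})} \<le> threshold n"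
    then obtain D where D: "D \<subseteq> {..<n * n}" "D \<noteq> {}"
      "card D + card {b. b < num_columns n \<and> odd (card {r \<in> D. column n Q b (r div n) (r mod n)})} \<le> threshold n"
      by blast
    have "?g ` D \<subseteq> {..<n} \<times> {..<n}" using D(1) n0 by (auto simp: less_mult_imp_div_less)
    moreover have "?g ` D \<noteq> {}" using D(2) by simp
    ultimately show "\<exists>Y. quadratic_solution n Q Y"
      by (rule light_solution) (use D(3) in \<open>simp only: tr\<close>)
  qed
qed

end

section \<open>Computations as quadratic systems\<close>

type_synonym gate = "nat \<times> nat \<times> nat \<times> nat \<times> nat"

text \<open>The state is the leading part and each scanned symbol a further digit in base
  \<open>\<Gamma>\<close>, so reading one more tape multiplies by \<open>\<Gamma>\<close> and adds,
  which one product of two gates can test.\<close>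

definition enc :: "nat \<Rightarrow> nat \<Rightarrow> nat list \<Rightarrow> nat" where
  "enc \<Gamma> q rs = foldl (\<lambda>v a. v * \<Gamma> + a) q rs"

lemma enc_snoc: "enc \<Gamma> q (rs @ [a]) = enc \<Gamma> q rs * \<Gamma> + a"
  by (simp add: enc_def)

lemma enc_bound:
  "q < N \<Longrightarrow> \<forall>r \<in> set rs. r < \<Gamma> \<Longrightarrow> enc \<Gamma> q rs < N * \<Gamma> ^ length rs"
proof (induction rs rule: rev_induct)
  case (snoc a rs)
  then have "enc \<Gamma> q rs + 1 \<le> N * \<Gamma> ^ length rs" "a < \<Gamma>" by auto
  have "enc \<Gamma> q (rs @ [a]) < (enc \<Gamma> q rs + 1) * \<Gamma>" using \<open>a < \<Gamma>\<close> by (simp add: enc_snoc)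
  also have "\<dots> \<le> N * \<Gamma> ^ length rs * \<Gamma>" by (rule mult_le_mono1) fact
  finally show ?case by (simp add: mult.commute mult.left_commute)
qed (simp add: enc_def)

lemma enc_inj:
  "length rs = length rs' \<Longrightarrow> \<forall>r \<in> set rs. r < \<Gamma> \<Longrightarrow> \<forall>r \<in> set rs'. r < \<Gamma> \<Longrightarrow>
    enc \<Gamma> q rs = enc \<Gamma> q' rs' \<Longrightarrow> q = q' \<and> rs = rs'"
proof (induction rs arbitrary: rs' rule: rev_induct)
  case Nil
  then show ?case by (simp add: enc_def)
next
  case (snoc a rs)
  obtain b rs'' where rs': "rs' = rs'' @ [b]"
    using snoc.prems(1) by (cases rs' rule: rev_cases) auto
  have ab: "a < \<Gamma>" "b < \<Gamma>" using snoc.prems rs' by auto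
  have e: "enc \<Gamma> q rs * \<Gamma> + a = enc \<Gamma> q' rs'' * \<Gamma> + b"
    using snoc.prems(4) by (simp add: rs' enc_snoc)
  have "(enc \<Gamma> q rs * \<Gamma> + a) div \<Gamma> = (enc \<Gamma> q' rs'' * \<Gamma> + b) div \<Gamma>"
    "(enc \<Gamma> q rs * \<Gamma> + a) mod \<Gamma> = (enc \<Gamma> q' rs'' * \<Gamma> + b) mod \<Gamma>"
    by (simp_all only: e)
  then have "enc \<Gamma> q rs = enc \<Gamma> q' rs''" "a = b" using ab by simp_all
  then show ?case using snoc.IH[of rs''] snoc.prems rs' by simp
qed

text \<open>Absorbs the halting state into the transition table, so that a step needs no case
  distinction.\<close>

definition tot :: "tm \<Rightarrow> nat \<Rightarrow> nat list \<Rightarrow> nat \<times> (nat \<times> move) list" where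
  "tot M q rs = (if q = 1 then (1, idle rs) else trans M q rs)"

text \<open>The transition table indexed by \<open>enc\<close> codes. The choice is unambiguous on
  valid codes by \<open>enc_inj\<close>; other codes get an arbitrary entry and never occur in a
  run.\<close>

definition dec_rule :: "tm \<Rightarrow> nat \<Rightarrow> nat \<times> (nat \<times> move) list" where
  "dec_rule M r = (SOME v. \<exists>q rs. length rs = num_tapes M \<and> (\<forall>r \<in> set rs. r < num_symbols M) \<and>
     enc (num_symbols M) q rs = r \<and> v = tot M q rs)"

lemma dec_rule_enc:
  assumes "length rs = num_tapes M" "\<forall>r \<in> set rs. r < num_symbols M"
  shows "dec_rule M (enc (num_symbols M) q rs) = tot M q rs"
  unfolding dec_rule_def
proof (rule some_equality)
  fix v assume "\<exists>q' rs'. length rs' = num_tapes M \<and> (\<forall>r \<in> set rs'. r < num_symbols M) \<and>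
     enc (num_symbols M) q' rs' = enc (num_symbols M) q rs \<and> v = tot M q' rs'"
  then obtain q' rs' where h: "length rs' = num_tapes M" "\<forall>r \<in> set rs'. r < num_symbols M"
     "enc (num_symbols M) q' rs' = enc (num_symbols M) q rs" "v = tot M q' rs'" by blast
  have "q' = q \<and> rs' = rs" by (rule enc_inj) (use h assms in simp_all)
  then show "v = tot M q rs" using h(4) by simp
qed (use assms in blast)

definition rule_count :: "tm \<Rightarrow> nat" where
  "rule_count M = num_states M * num_symbols M ^ num_tapes M"

definition next_state :: "tm \<Rightarrow> nat \<Rightarrow> nat" where
  "next_state M r = fst (dec_rule M r)"

definition write_sym :: "tm \<Rightarrow> nat \<Rightarrow> nat \<Rightarrow> nat" where
  "write_sym M r l = fst (snd (dec_rule M r) ! l)"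

text \<open>Head moves are shifted by one so that they are natural numbers.\<close>

definition move_sym :: "tm \<Rightarrow> nat \<Rightarrow> nat \<Rightarrow> nat" where
  "move_sym M r l = nat (shift (snd (snd (dec_rule M r) ! l)) + 1)"

text \<open>Gates: \<open>(0, 0, 0, 0, 0)\<close> is the constant one, and its equation states acceptance; \<open>(1, i, \<dots>)\<close> and \<open>(2, i, \<dots>)\<close> are free and tell whether
  the certificate has an \<open>i\<close>-th bit and which one; \<open>(3, i, \<dots>)\<close>: all bits up to \<open>i\<close> are present;
  \<open>(4, t, l, c, 0)\<close>: \<open>c\<close> encodes the state and the first \<open>l\<close> scanned symbols at time \<open>t\<close>;
  \<open>(5, t, l, c, 0)\<close>: tape \<open>l\<close> scans symbol \<open>c\<close>; \<open>(6, t, l, c, a)\<close>: cell \<open>c - T\<close> of tape \<open>l\<close> contains \<open>a\<close>;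
  \<open>(7, t, l, c, 0)\<close>: the head of tape \<open>l\<close> is at cell \<open>c - T\<close>.\<close>

definition init_rule :: "bool list \<Rightarrow> nat \<Rightarrow> nat \<Rightarrow> nat \<Rightarrow> nat \<Rightarrow> nat \<Rightarrow> gate \<Rightarrow> gate \<Rightarrow> bool" where
  "init_rule x B T l c a I J \<longleftrightarrow>
     (if l = 0 \<and> T + length x < c \<and> c \<le> T + length x + B
      then a = 2 \<and> I = (3, c - (T + length x + 1), 0, 0, 0) \<and> J = (2, c - (T + length x + 1), 0, 0, 0) \<or>
        a = 1 \<and> I = (3, c - (T + length x + 1), 0, 0, 0) \<and>
          (J = (0, 0, 0, 0, 0) \<or> J = (2, c - (T + length x + 1), 0, 0, 0)) \<or>
        a = 0 \<and> (I = (0, 0, 0, 0, 0) \<and> J = (0, 0, 0, 0, 0) \<or>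
          I = (3, c - (T + length x + 1), 0, 0, 0) \<and> J = (3, c - (T + length x + 1), 0, 0, 0))
      else I = (0, 0, 0, 0, 0) \<and> J = (0, 0, 0, 0, 0) \<and>
        a = (if l = 0 \<and> T \<le> c \<and> c < T + length x then (if x ! (c - T) then 2 else 1)
          else if l = 0 \<and> c = T + length x then 3 else 0))"

text \<open>Holds if the product of \<open>I\<close> and \<open>J\<close> occurs in the equation of
  \<open>G\<close>. The quantifiers over \<open>r\<close> and over \<open>l'\<close> with
  \<open>l = l'\<close> range below constants of the machine, so its tables are consulted at fixed
  arguments only and can be hard-wired into the program for the reduction.\<close>

definition gate_rule :: "tm \<Rightarrow> bool list \<Rightarrow> nat \<Rightarrow> nat \<Rightarrow> gate \<Rightarrow> gate \<Rightarrow> gate \<Rightarrow> bool" where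
  "gate_rule M x B T G I J = (case G of (k, t, l, c, a) \<Rightarrow>
     k = 0 \<and> t = 0 \<and> l = 0 \<and> c = 0 \<and> a = 0 \<and> I = (6, T, 1, T, 2) \<and> J = (6, T, 1, T, 2) \<or>
     (k = 1 \<or> k = 2) \<and> l = 0 \<and> c = 0 \<and> a = 0 \<and> I = G \<and> J = G \<or>
     k = 3 \<and> l = 0 \<and> c = 0 \<and> a = 0 \<and>
       (if t = 0 then I = (1, 0, 0, 0, 0) \<and> J = (1, 0, 0, 0, 0)
        else I = (3, t - 1, 0, 0, 0) \<and> J = (1, t, 0, 0, 0)) \<or>
     k = 4 \<and> a = 0 \<and> t \<le> T \<and>
       (if l = 0 then
          (if t = 0 then c = 0 \<and> I = (0, 0, 0, 0, 0) \<and> J = (0, 0, 0, 0, 0)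
           else (\<exists>r<rule_count M. next_state M r = c \<and>
             I = (4, t - 1, num_tapes M, r, 0) \<and> J = (4, t - 1, num_tapes M, r, 0)))
        else l \<le> num_tapes M \<and> I = (4, t, l - 1, c div num_symbols M, 0) \<and>
          J = (5, t, l - 1, c mod num_symbols M, 0)) \<or>
     k = 5 \<and> a = 0 \<and> (\<exists>c'<2 * T + 1. I = (7, t, l, c', 0) \<and> J = (6, t, l, c', c)) \<or>
     k = 6 \<and> t \<le> T \<and> (\<exists>l'<num_tapes M. l = l' \<and>
       (if t = 0 then c < 2 * T + 1 \<and> init_rule x B T l c a I J
        else (\<exists>r<rule_count M. write_sym M r l' = a \<and>
            I = (7, t - 1, l, c, 0) \<and> J = (4, t - 1, num_tapes M, r, 0)) \<or>
          I = (6, t - 1, l, c, a) \<and> J = (6, t - 1, l, c, a) \<or>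
          I = (7, t - 1, l, c, 0) \<and> J = (6, t - 1, l, c, a))) \<or>
     k = 7 \<and> a = 0 \<and> t \<le> T \<and> (\<exists>l'<num_tapes M. l = l' \<and>
       (if t = 0 then c = T \<and> I = (0, 0, 0, 0, 0) \<and> J = (0, 0, 0, 0, 0)
        else (\<exists>r<rule_count M. I = (4, t - 1, num_tapes M, r, 0) \<and>
          (\<exists>c'<2 * T + 1. J = (7, t - 1, l, c', 0) \<and> c' + move_sym M r l' = c + 1)))))"

section \<open>Runs of the verifying machine\<close>

definition cfg :: "tm \<Rightarrow> nat list \<Rightarrow> nat \<Rightarrow> config" where
  "cfg M w t = (step M ^^ t) (init_config M w)"

lemma step_tot: "step M (q, ts) = (fst (tot M q (reads ts)), map2 act ts (snd (tot M q (reads ts))))"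
  using act_idle[of ts]
  by (simp add: step_def tot_def reads_def[symmetric] case_prod_beta)

context
  fixes M :: tm and w :: "nat list"
  assumes M: "wf_tm M" and w: "\<forall>s \<in> set w. s < 4"
begin

lemma tapes2: "2 \<le> num_tapes M" and states2: "2 \<le> num_states M" and symbols4: "4 \<le> num_symbols M"
  using M by (simp_all add: wf_tm_def)

lemma tot_wf:
  assumes "q < num_states M" "length rs = num_tapes M" "\<forall>r \<in> set rs. r < num_symbols M"
  shows "fst (tot M q rs) < num_states M" "length (snd (tot M q rs)) = num_tapes M"
    "l < num_tapes M \<Longrightarrow> fst (snd (tot M q rs) ! l) < num_symbols M"
proof -
  have *: "fst (tot M q rs) < num_states M \<and> length (snd (tot M q rs)) = num_tapes M \<and>
      (\<forall>am \<in> set (snd (tot M q rs)). fst am < num_symbols M)"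
  proof (cases "q = 1")
    case True
    then show ?thesis using assms states2 by (auto simp: tot_def idle_def)
  next
    case False
    have "case trans M q rs of (q', acts) \<Rightarrow> q' < num_states M \<and> length acts = num_tapes M \<and>
        (\<forall>(a, m) \<in> set acts. a < num_symbols M)"
    proof -
      have W: "\<forall>q rs. q < num_states M \<and> length rs = num_tapes M \<and> (\<forall>r \<in> set rs. r < num_symbols M) \<longrightarrow>
        (case trans M q rs of (q', acts) \<Rightarrow> q' < num_states M \<and> length acts = num_tapes M \<and>
          (\<forall>(a, m) \<in> set acts. a < num_symbols M))"
        using M unfolding wf_tm_def by (elim conjE)
      show ?thesis by (rule spec[OF spec[OF W], THEN mp]) (intro conjI assms)
    qed
    then show ?thesis using False by (simp add: tot_def case_prod_beta)
  qed
  then show "fst (tot M q rs) < num_states M" "length (snd (tot M q rs)) = num_tapes M" by simp_all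
  assume "l < num_tapes M"
  then show "fst (snd (tot M q rs) ! l) < num_symbols M" using * nth_mem by metis
qed

definition "state_at t = fst (cfg M w t)"
definition "tape_at t l = snd (cfg M w t) ! l"
definition "scan t = reads (snd (cfg M w t))"

lemma fst_act: "fst (act tp am) = (fst tp)(snd tp := fst am)" and snd_act: "snd (act tp am) = snd tp + shift (snd am)"
  by (cases tp; cases am; simp)+

lemma shift_bound: "\<bar>shift m\<bar> \<le> 1"
  by (cases m) auto

text \<open>A head moves at most one cell per step, so up to time \<open>T\<close> the
  \<open>2 * T + 1\<close> cells around the origin suffice.\<close>

lemma cfg_inv:
  "state_at t < num_states M \<and> length (snd (cfg M w t)) = num_tapes M \<and>
    (\<forall>l < num_tapes M. (\<forall>i. fst (tape_at t l) i < num_symbols M) \<and> \<bar>snd (tape_at t l)\<bar> \<le> int t)"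
proof (induction t)
  case 0
  have tp: "tape_at 0 l = (if l = 0 then (written w, 0) else (written [], 0))" if "l < num_tapes M" for l
    using that by (auto simp: tape_at_def cfg_def init_config_def nth_Cons split: nat.splits)
  have "written w i < num_symbols M" for i
  proof -
    have "written w i < 4" using w by (auto simp: written_def)
    then show ?thesis using symbols4 by linarith
  qed
  moreover have "written [] i < num_symbols M" for i using symbols4 by (simp add: written_def)
  ultimately show ?case
    using tp states2 tapes2 by (simp add: state_at_def cfg_def init_config_def)
next
  case (Suc t)
  let ?q = "state_at t" and ?ts = "snd (cfg M w t)"
  have len: "length ?ts = num_tapes M" using Suc by simp
  have rs: "\<forall>r \<in> set (reads ?ts). r < num_symbols M"
  proof
    fix r assume "r \<in> set (reads ?ts)"
    then obtain l where "l < num_tapes M" "r = fst (?ts ! l) (snd (?ts ! l))"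
      using len by (auto simp: reads_def in_set_conv_nth case_prod_beta)
    then show "r < num_symbols M" using Suc by (simp add: tape_at_def)
  qed
  have lr: "length (reads ?ts) = num_tapes M" using len by (simp add: reads_def)
  note wf = tot_wf[of ?q "reads ?ts", OF _ lr rs]
  have c: "cfg M w (Suc t) = (fst (tot M ?q (reads ?ts)), map2 act ?ts (snd (tot M ?q (reads ?ts))))"
    using step_tot[of M ?q ?ts] by (simp add: cfg_def state_at_def)
  have tp: "tape_at (Suc t) l = act (tape_at t l) (snd (tot M ?q (reads ?ts)) ! l)" if "l < num_tapes M" for l
    using that wf(2) len Suc by (simp add: tape_at_def c)
  show ?case
  proof (intro conjI allI impI)
    show "state_at (Suc t) < num_states M" using wf(1) Suc by (simp add: state_at_def c)
    show "length (snd (cfg M w (Suc t))) = num_tapes M" using wf(2) len Suc by (simp add: c)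
    fix l assume l: "l < num_tapes M"
    show "fst (tape_at (Suc t) l) i < num_symbols M" for i
      using Suc wf(3)[OF _ l] l by (simp add: tp fst_act)
    show "\<bar>snd (tape_at (Suc t) l)\<bar> \<le> int (Suc t)"
      using Suc l shift_bound[of "snd (snd (tot M ?q (reads ?ts)) ! l)"] by (fastforce simp: tp snd_act)
  qed
qed

lemma length_scan: "length (scan t) = num_tapes M"
  using cfg_inv by (simp add: scan_def reads_def)

lemma scan_nth: "l < num_tapes M \<Longrightarrow> scan t ! l = fst (tape_at t l) (snd (tape_at t l))"
  using cfg_inv[of t] by (simp add: scan_def reads_def tape_at_def case_prod_beta)

lemma scan_less: "\<forall>r \<in> set (scan t). r < num_symbols M"
  using cfg_inv[of t] by (auto simp: in_set_conv_nth length_scan scan_nth)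

definition "rule_at t = enc (num_symbols M) (state_at t) (scan t)"

lemma rule_at_less: "rule_at t < rule_count M"
  using enc_bound[of "state_at t" "num_states M" "scan t" "num_symbols M"] cfg_inv[of t] scan_less
  by (simp add: rule_at_def rule_count_def length_scan)

lemma dec_rule_at: "dec_rule M (rule_at t) = tot M (state_at t) (scan t)"
  unfolding rule_at_def by (rule dec_rule_enc[OF length_scan scan_less])

lemma state_Suc: "state_at (Suc t) = next_state M (rule_at t)"
  using step_tot[of M "state_at t" "snd (cfg M w t)"]
  by (simp add: next_state_def dec_rule_at) (simp add: state_at_def cfg_def scan_def)

lemma tape_Suc:
  assumes "l < num_tapes M"
  shows "fst (tape_at (Suc t) l) = (fst (tape_at t l))(snd (tape_at t l) := write_sym M (rule_at t) l)"
    "snd (tape_at (Suc t) l) + 1 = snd (tape_at t l) + int (move_sym M (rule_at t) l)"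
proof -
  have len: "length (snd (tot M (state_at t) (scan t))) = num_tapes M"
    using tot_wf(2)[OF _ length_scan scan_less] cfg_inv[of t] by simp
  have "snd (cfg M w (Suc t)) = map2 act (snd (cfg M w t)) (snd (tot M (state_at t) (scan t)))"
    using step_tot[of M "state_at t" "snd (cfg M w t)"] by (simp add: state_at_def cfg_def scan_def)
  then have tp: "tape_at (Suc t) l = act (tape_at t l) (snd (tot M (state_at t) (scan t)) ! l)"
    using assms cfg_inv[of t] len by (simp add: tape_at_def)
  show "fst (tape_at (Suc t) l) = (fst (tape_at t l))(snd (tape_at t l) := write_sym M (rule_at t) l)"
    by (simp add: tp fst_act write_sym_def dec_rule_at)
  have "0 \<le> shift (snd (snd (tot M (state_at t) (scan t)) ! l)) + 1"
    using shift_bound[of "snd (snd (tot M (state_at t) (scan t)) ! l)"] by linarith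
  then show "snd (tape_at (Suc t) l) + 1 = snd (tape_at t l) + int (move_sym M (rule_at t) l)"
    by (simp add: tp snd_act move_sym_def dec_rule_at)
qed

end


lemma written_pair:
  "written (pair (x, y)) (int i) =
    (if i < length x then (if x ! i then 2 else 1) else if i = length x then 3
     else if i < length x + 1 + length y then (if y ! (i - (length x + 1)) then 2 else 1) else 0)"
proof -
  have "length (pair (x, y)) = length x + 1 + length y" by (simp add: pair_def bits_def)
  then have len: "written (pair (x, y)) (int i) =
      (if i < length x + 1 + length y then (bits x @ 3 # bits y) ! i else 0)"
    by (simp add: written_def pair_def)
  consider "i < length x" | "i = length x" | d where "i = length x + 1 + d"
  proof (cases "length x < i")
    case True
    then have "i = length x + 1 + (i - (length x + 1))" by simp
    then show ?thesis by (rule that(3))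
  qed (use that(1,2) in linarith)
  then show ?thesis
    unfolding len by cases (simp_all add: nth_append bits_def)
qed

lemma pair_less_4: "\<forall>s \<in> set (pair (x, y)). s < 4"
  by (auto simp: pair_def bits_def)

lemma single_pair: "{(I, J). P I \<and> Q J \<and> I = i \<and> J = j} = (if P i \<and> Q j then {(i, j)} else {})"
  by auto

text \<open>The free presence bits \<open>e\<close> need not form an initial segment. The
  certificate ends at the first absent bit, and whatever follows is ignored, so every assignment of
  the free gates yields a certificate.\<close>

definition cert :: "nat \<Rightarrow> (nat \<Rightarrow> bool) \<Rightarrow> (nat \<Rightarrow> bool) \<Rightarrow> bool list" where
  "cert B e b = map b [0..<(LEAST i. B \<le> i \<or> \<not> e i)]"

lemma length_cert_le: "length (cert B e b) \<le> B"
  by (auto simp: cert_def intro: Least_le)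

lemma less_length_cert: "d < B \<Longrightarrow> d < length (cert B e b) \<longleftrightarrow> (\<forall>i\<le>d. e i)"
proof -
  assume d: "d < B"
  let ?L = "LEAST i. B \<le> i \<or> \<not> e i"
  have L: "B \<le> ?L \<or> \<not> e ?L" by (rule LeastI[of _ B]) simp
  have "d < ?L \<longleftrightarrow> (\<forall>i\<le>d. e i)"
  proof
    assume "d < ?L"
    then show "\<forall>i\<le>d. e i" using not_less_Least[of _ "\<lambda>i. B \<le> i \<or> \<not> e i"] by (meson le_less_trans)
  next
    assume "\<forall>i\<le>d. e i"
    then show "d < ?L" using L d by (meson not_less le_less_trans not_le)
  qed
  then show ?thesis by (simp add: cert_def)
qed

section \<open>The intended gate values satisfy the equations\<close>

context
  fixes M :: tm and x :: "bool list" and B T :: nat and e b :: "nat \<Rightarrow> bool"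
  assumes M: "wf_tm M"
begin

abbreviation (input) "inp \<equiv> pair (x, cert B e b)"

definition sem :: "gate \<Rightarrow> bool" where
  "sem G = (case G of (k, t, l, c, a) \<Rightarrow>
     k = 0 \<and> t = 0 \<and> l = 0 \<and> c = 0 \<and> a = 0 \<or>
     k = 1 \<and> l = 0 \<and> c = 0 \<and> a = 0 \<and> e t \<or>
     k = 2 \<and> l = 0 \<and> c = 0 \<and> a = 0 \<and> b t \<or>
     k = 3 \<and> l = 0 \<and> c = 0 \<and> a = 0 \<and> (\<forall>i\<le>t. e i) \<or>
     k = 4 \<and> a = 0 \<and> t \<le> T \<and> l \<le> num_tapes M \<and>
       c = enc (num_symbols M) (state_at M inp t) (take l (scan M inp t)) \<or>
     k = 5 \<and> a = 0 \<and> t \<le> T \<and> l < num_tapes M \<and> c = scan M inp t ! l \<or>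
     k = 6 \<and> t \<le> T \<and> l < num_tapes M \<and> c < 2 * T + 1 \<and> a = fst (tape_at M inp t l) (int c - int T) \<or>
     k = 7 \<and> a = 0 \<and> t \<le> T \<and> l < num_tapes M \<and> int c = snd (tape_at M inp t l) + int T)"

text \<open>The products in the equation of \<open>G\<close> that have value one; the equation asks
  whether their number is odd.\<close>

definition "pairs G = {(I, J). sem I \<and> sem J \<and> gate_rule M x B T G I J}"

lemmas inv = cfg_inv[OF M pair_less_4[of x "cert B e b"]]
lemmas scan_less_W = scan_less[OF M pair_less_4[of x "cert B e b"]]
lemmas length_scan_W = length_scan[OF M pair_less_4[of x "cert B e b"]]
lemmas scan_nth_W = scan_nth[OF M pair_less_4[of x "cert B e b"]]

lemma sem_one: "sem (0, 0, 0, 0, 0)"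
  by (simp add: sem_def)

lemma sem_rule: "t \<le> T \<Longrightarrow> sem (4, t, num_tapes M, r, 0) \<longleftrightarrow> r = rule_at M inp t"
  by (simp add: sem_def rule_at_def[OF M pair_less_4] length_scan_W)

lemma head_cell:
  assumes "t \<le> T" "l < num_tapes M"
  defines "h \<equiv> nat (snd (tape_at M inp t l) + int T)"
  shows "int h = snd (tape_at M inp t l) + int T" "h < 2 * T + 1"
    "sem (7, t, l, c, 0) \<longleftrightarrow> c = h" "sem (6, t, l, h, a) \<longleftrightarrow> a = scan M inp t ! l"
proof -
  have "\<bar>snd (tape_at M inp t l)\<bar> \<le> int t" using inv[of t] assms by blast
  then show h: "int h = snd (tape_at M inp t l) + int T" "h < 2 * T + 1"
    using assms(1) unfolding h_def by linarith+
  show "sem (7, t, l, c, 0) \<longleftrightarrow> c = h"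
    using assms(1,2) h(1) by (auto simp: sem_def simp del: h_def)
  have "int h - int T = snd (tape_at M inp t l)" using h(1) by simp
  then show "sem (6, t, l, h, a) \<longleftrightarrow> a = scan M inp t ! l"
    using assms(1,2) h(2) by (simp add: sem_def scan_nth_W)
qed

lemma sem_scan: "sem (5, t, l, c, a) \<longleftrightarrow> a = 0 \<and> t \<le> T \<and> l < num_tapes M \<and> c = scan M inp t ! l"
  by (simp add: sem_def)

text \<open>The head is in exactly one cell, so among the products over all cells at most the one
  for that cell survives.\<close>

lemma pairs_scan: "odd (card (pairs (5, t, l, c, a))) \<longleftrightarrow> sem (5, t, l, c, a)"
proof (cases "a = 0 \<and> t \<le> T \<and> l < num_tapes M")
  case True
  define h where "h = nat (snd (tape_at M inp t l) + int T)"
  note h = head_cell[of t l, folded h_def]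
  have s: "sem (5, t, l, c, a) \<longleftrightarrow> sem (6, t, l, h, c)"
    using True h(4)[of c] by (simp add: sem_scan)
  have "pairs (5, t, l, c, a) = (if sem (5, t, l, c, a) then {((7, t, l, h, 0), (6, t, l, h, c))} else {})"
    unfolding s pairs_def gate_rule_def using True h(2) h(3) by auto
  then show ?thesis by simp
next
  case False
  have "\<not> sem (7, t, l, c', 0)" if "a = 0" for c' using that False by (auto simp: sem_def)
  then have "pairs (5, t, l, c, a) = {}"
    unfolding pairs_def gate_rule_def by auto
  moreover have "\<not> sem (5, t, l, c, a)" using False by (auto simp: sem_def)
  ultimately show ?thesis by simp
qed

lemma sem_prefix: "sem (4, t, l, c, a) \<longleftrightarrow> a = 0 \<and> t \<le> T \<and> l \<le> num_tapes M \<and>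
    c = enc (num_symbols M) (state_at M inp t) (take l (scan M inp t))"
  by (simp add: sem_def)

text \<open>For \<open>l > 0\<close>, quotient and remainder of \<open>c\<close> name the shorter
  prefix and the last symbol. For \<open>l = 0\<close> and \<open>t > 0\<close>, the sum runs over
  all table entries leading to state \<open>c\<close>, and exactly one table entry is
  current.\<close>

lemma pairs_prefix: "odd (card (pairs (4, t, l, c, a))) \<longleftrightarrow> sem (4, t, l, c, a)"
proof (cases "a = 0 \<and> t \<le> T")
  case True
  show ?thesis
  proof (cases l)
    case 0
    show ?thesis
    proof (cases t)
      case 0
      have "state_at M inp 0 = 0" by (simp add: state_at_def[OF M pair_less_4] cfg_def init_config_def)
      then have "pairs (4, t, l, c, a) = (if sem (4, t, l, c, a) then {((0, 0, 0, 0, 0), (0, 0, 0, 0, 0))} else {})"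
        using True \<open>l = 0\<close> 0 sem_one by (auto simp: pairs_def gate_rule_def) (auto simp: sem_def enc_def)
      then show ?thesis by simp
    next
      case (Suc t')
      let ?r = "rule_at M inp t'"
      have s: "sem (4, t, l, c, a) \<longleftrightarrow> c = next_state M ?r"
        using True Suc \<open>l = 0\<close> state_Suc[OF M pair_less_4, of x "cert B e b" t'] by (simp add: sem_def enc_def)
      have "pairs (4, t, l, c, a) = (if sem (4, t, l, c, a)
          then {((4, t', num_tapes M, ?r, 0), (4, t', num_tapes M, ?r, 0))} else {})"
        unfolding s using True Suc \<open>l = 0\<close> sem_rule[of t'] rule_at_less[OF M pair_less_4, of x "cert B e b" t']
        by (auto simp: pairs_def gate_rule_def)
      then show ?thesis by simp
    qed
  next
    case (Suc l')
    let ?G = "num_symbols M"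
    have G: "0 < ?G" using symbols4[OF M pair_less_4] by simp
    have "sem (4, t, l, c, a) \<longleftrightarrow> l \<le> num_tapes M \<and> sem (4, t, l', c div ?G, 0) \<and> sem (5, t, l', c mod ?G, 0)"
    proof (cases "l \<le> num_tapes M")
      case l: True
      have tk: "take l (scan M inp t) = take l' (scan M inp t) @ [scan M inp t ! l']"
        using l Suc by (simp add: take_Suc_conv_app_nth length_scan_W)
      have lt: "scan M inp t ! l' < ?G" 
        by (rule bspec[OF scan_less_W nth_mem]) (use l Suc in \<open>simp add: length_scan_W\<close>)
      have "c = v * ?G + u \<longleftrightarrow> c div ?G = v \<and> c mod ?G = u" if "u < ?G" for u v
        using that by auto
      note dm = this[OF lt, of "enc ?G (state_at M inp t) (take l' (scan M inp t))"]
      have "enc ?G (state_at M inp t) (take l (scan M inp t)) =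
          enc ?G (state_at M inp t) (take l' (scan M inp t)) * ?G + scan M inp t ! l'"
        by (simp only: tk enc_snoc)
      then have "sem (4, t, l, c, a) \<longleftrightarrow> c = enc ?G (state_at M inp t) (take l' (scan M inp t)) * ?G + scan M inp t ! l'"
        using True l by (simp only: sem_prefix simp_thms)
      then show ?thesis unfolding dm using True l Suc by (simp add: sem_prefix sem_scan)
    qed (simp add: sem_prefix)
    then have "pairs (4, t, l, c, a) = (if sem (4, t, l, c, a)
        then {((4, t, l', c div ?G, 0), (5, t, l', c mod ?G, 0))} else {})"
      using True Suc by (auto simp: pairs_def gate_rule_def)
    then show ?thesis by simp
  qed
next
  case False
  then have "pairs (4, t, l, c, a) = {}" unfolding pairs_def gate_rule_def by auto
  moreover have "\<not> sem (4, t, l, c, a)" using False by (auto simp: sem_prefix)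
  ultimately show ?thesis by simp
qed

lemma sem_head: "sem (7, t, l, c, a) \<longleftrightarrow> a = 0 \<and> t \<le> T \<and> l < num_tapes M \<and>
    int c = snd (tape_at M inp t l) + int T"
  by (simp add: sem_def)

lemma sem_cell: "sem (6, t, l, c, a) \<longleftrightarrow> t \<le> T \<and> l < num_tapes M \<and> c < 2 * T + 1 \<and>
    a = fst (tape_at M inp t l) (int c - int T)"
  by (simp add: sem_def)

lemma sem_present: "sem (3, i, 0, 0, 0) \<longleftrightarrow> (\<forall>j\<le>i. e j)" and sem_bit: "sem (2, i, 0, 0, 0) \<longleftrightarrow> b i"
  and sem_exists: "sem (1, i, 0, 0, 0) \<longleftrightarrow> e i"
  by (simp_all add: sem_def)

lemma pairs_head: "odd (card (pairs (7, t, l, c, a))) \<longleftrightarrow> sem (7, t, l, c, a)"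
proof (cases "a = 0 \<and> t \<le> T \<and> l < num_tapes M")
  case True
  show ?thesis
  proof (cases t)
    case 0
    have "snd (tape_at M inp 0 l) = 0"
      using True by (auto simp: tape_at_def[OF M pair_less_4] cfg_def init_config_def nth_Cons split: nat.splits)
    then have "sem (7, t, l, c, a) \<longleftrightarrow> c = T" using True 0 by (simp add: sem_def)
    then have "pairs (7, t, l, c, a) = (if sem (7, t, l, c, a) then {((0, 0, 0, 0, 0), (0, 0, 0, 0, 0))} else {})"
      using True 0 sem_one by (auto simp: pairs_def gate_rule_def)
    then show ?thesis by simp
  next
    case (Suc t')
    let ?r = "rule_at M inp t'"
    define h where "h = nat (snd (tape_at M inp t' l) + int T)"
    have tl: "t' \<le> T" "l < num_tapes M" using True Suc by simp_all
    note cc = head_cell(1,2)[OF tl, folded h_def]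
    note s7 = head_cell(3)[OF tl, folded h_def]
    have "snd (tape_at M inp t l) + 1 = snd (tape_at M inp t' l) + int (move_sym M ?r l)"
      using tape_Suc(2)[OF M pair_less_4, of l x "cert B e b" t'] True Suc by simp
    then have "int c = snd (tape_at M inp t l) + int T \<longleftrightarrow> int (h + move_sym M ?r l) = int (c + 1)"
      using cc(1) by (simp only: of_nat_add of_nat_1) linarith
    then have s: "sem (7, t, l, c, a) \<longleftrightarrow> h + move_sym M ?r l = c + 1"
      using True by (simp only: sem_head of_nat_eq_iff simp_thms)
    have "pairs (7, t, l, c, a) = (if sem (7, t, l, c, a)
        then {((4, t', num_tapes M, ?r, 0), (7, t', l, h, 0))} else {})"
      unfolding s using True Suc sem_rule[of t'] rule_at_less[OF M pair_less_4, of x "cert B e b" t'] s7 cc(2)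
      by (auto simp: pairs_def gate_rule_def)
    then show ?thesis by simp
  qed
next
  case False
  then have "pairs (7, t, l, c, a) = {}" unfolding pairs_def gate_rule_def by auto
  moreover have "\<not> sem (7, t, l, c, a)" using False by (auto simp: sem_head)
  ultimately show ?thesis by simp
qed

lemma init_tape:
  "l < num_tapes M \<Longrightarrow> fst (tape_at M inp 0 l) i = (if l = 0 then written inp i else 0)"
  by (auto simp: tape_at_def[OF M pair_less_4] cfg_def init_config_def nth_Cons written_def[of "[]"]
      split: nat.splits)

text \<open>For a certificate cell let \<open>P\<close> say that its bit is present and
  \<open>Q\<close> be the bit. Over the two-element field the symbols \<open>2\<close>,
  \<open>1\<close> and \<open>0\<close> are then recognized by \<open>P Q\<close>,
  \<open>P + P Q\<close> and \<open>1 + P P\<close>. All other cells are constants.\<close>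

lemma pairs_init:
  assumes l: "l < num_tapes M"
  shows "odd (card (pairs (6, 0, l, c, a))) \<longleftrightarrow> sem (6, 0, l, c, a)"
proof (cases "c < 2 * T + 1")
  case c: True
  have s: "sem (6, 0, l, c, a) \<longleftrightarrow> a = (if l = 0 then written inp (int c - int T) else 0)"
    using c l by (simp add: sem_cell init_tape)
  have p: "pairs (6, 0, l, c, a) = {(I, J). sem I \<and> sem J \<and> init_rule x B T l c a I J}"
    unfolding pairs_def gate_rule_def using c l by auto
  show ?thesis
  proof (cases "l = 0 \<and> T + length x < c \<and> c \<le> T + length x + B")
    case True
    define d where "d = c - (T + length x + 1)"
    have d: "d < B" "int c - int T = int (length x + 1 + d)" using True unfolding d_def by linarith+
    have wr: "written inp (int c - int T) = (if sem (3, d, 0, 0, 0) then (if sem (2, d, 0, 0, 0) then 2 else 1) else 0)"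
      unfolding d(2) written_pair
      using less_length_cert[OF d(1), of e b] by (auto simp: sem_present sem_bit cert_def)
    define P Q where "P \<longleftrightarrow> sem (3, d, 0, 0, 0)" and "Q \<longleftrightarrow> sem (2, d, 0, 0, 0)"
    have ir: "init_rule x B T l c a I J \<longleftrightarrow> a = 2 \<and> I = (3, d, 0, 0, 0) \<and> J = (2, d, 0, 0, 0) \<or>
        a = 1 \<and> I = (3, d, 0, 0, 0) \<and> (J = (0, 0, 0, 0, 0) \<or> J = (2, d, 0, 0, 0)) \<or>
        a = 0 \<and> (I = (0, 0, 0, 0, 0) \<and> J = (0, 0, 0, 0, 0) \<or> I = (3, d, 0, 0, 0) \<and> J = (3, d, 0, 0, 0))" for I J
      unfolding init_rule_def if_P[OF True] d_def[symmetric] ..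
    consider "a = 0" | "a = 1" | "a = 2" | "2 < a" by linarith
    then show ?thesis
    proof cases
      case 1
      have "pairs (6, 0, l, c, a) = insert ((0, 0, 0, 0, 0), (0, 0, 0, 0, 0))
          (if P then {((3, d, 0, 0, 0), (3, d, 0, 0, 0))} else {})"
        unfolding p ir using 1 sem_one by (auto simp: P_def)
      then show ?thesis unfolding s wr using 1 True by (simp add: P_def)
    next
      case 2
      have "pairs (6, 0, l, c, a) = (if P then insert ((3, d, 0, 0, 0), (0, 0, 0, 0, 0))
          (if Q then {((3, d, 0, 0, 0), (2, d, 0, 0, 0))} else {}) else {})"
        unfolding p ir using 2 sem_one by (auto simp: P_def Q_def)
      then show ?thesis unfolding s wr using 2 True by (simp add: P_def Q_def)
    next
      case 3
      have "pairs (6, 0, l, c, a) = (if P \<and> Q then {((3, d, 0, 0, 0), (2, d, 0, 0, 0))} else {})"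
      proof -
        have "init_rule x B T l c a I J \<longleftrightarrow> I = (3, d, 0, 0, 0) \<and> J = (2, d, 0, 0, 0)" for I J
          unfolding ir using 3 by simp
        then show ?thesis unfolding p P_def Q_def by (simp only: single_pair)
      qed
      then show ?thesis unfolding s wr using 3 True by (simp add: P_def Q_def)
    next
      case 4
      then have "pairs (6, 0, l, c, a) = {}"
        unfolding p ir by auto
      then show ?thesis unfolding s wr using 4 True by simp
    qed
  next
    case False
    let ?v = "if l = 0 \<and> T \<le> c \<and> c < T + length x then (if x ! (c - T) then 2 else 1)
          else if l = 0 \<and> c = T + length x then 3 else 0"
    have "(if l = 0 then written inp (int c - int T) else 0) = ?v"
    proof (cases "l = 0")
      case l0: True
      show ?thesis
      proof (cases "T \<le> c")
        case True
        have i: "int c - int T = int (c - T)" using True by simp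
        show ?thesis
          unfolding i written_pair using l0 True False length_cert_le[of B e b] by auto
      next
        case False
        then show ?thesis using l0 by (simp add: written_def)
      qed
    qed simp
    then have "pairs (6, 0, l, c, a) = (if sem (6, 0, l, c, a) then {((0, 0, 0, 0, 0), (0, 0, 0, 0, 0))} else {})"
      unfolding s p init_rule_def if_not_P[OF False] using sem_one by auto
    then show ?thesis by simp
  qed
next
  case False
  then have "pairs (6, 0, l, c, a) = {}" unfolding pairs_def gate_rule_def by auto
  moreover have "\<not> sem (6, 0, l, c, a)" using False by (simp add: sem_cell)
  ultimately show ?thesis by simp
qed

text \<open>With \<open>A\<close> for the head being on the cell, \<open>w\<close> for
  \<open>a\<close> being written and \<open>X\<close> for the cell containing \<open>a\<close>
  before, the equation is \<open>A w + X + A X\<close>, which is \<open>w\<close> under the head and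
  \<open>X\<close> elsewhere.\<close>

lemma pairs_cell: "odd (card (pairs (6, t, l, c, a))) \<longleftrightarrow> sem (6, t, l, c, a)"
proof (cases "t \<le> T \<and> l < num_tapes M")
  case True
  show ?thesis
  proof (cases t)
    case 0
    then show ?thesis using pairs_init True by simp
  next
    case (Suc t')
    let ?r = "rule_at M inp t'"
    define h where "h = nat (snd (tape_at M inp t' l) + int T)"
    have tl: "t' \<le> T" "l < num_tapes M" using True Suc by simp_all
    note h = head_cell[OF tl, folded h_def]
    define A X w where "A \<longleftrightarrow> c = h" and "X \<longleftrightarrow> sem (6, t', l, c, a)" and "w \<longleftrightarrow> write_sym M ?r l = a"
    have "fst (tape_at M inp t l) (int c - int T) =
        (if int c - int T = snd (tape_at M inp t' l) then write_sym M ?r l else fst (tape_at M inp t' l) (int c - int T))"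
      using tape_Suc(1)[OF M pair_less_4, of l x "cert B e b" t'] tl(2) Suc by simp
    moreover have "int c - int T = snd (tape_at M inp t' l) \<longleftrightarrow> A" unfolding A_def using h(1) by linarith
    ultimately have s: "sem (6, t, l, c, a) \<longleftrightarrow> (if A then w else X)"
      using True tl h(2) by (auto simp: sem_cell A_def X_def w_def)
    have gr: "gate_rule M x B T (6, t, l, c, a) I J \<longleftrightarrow>
        (\<exists>r<rule_count M. write_sym M r l = a \<and> I = (7, t', l, c, 0) \<and> J = (4, t', num_tapes M, r, 0)) \<or>
        I = (6, t', l, c, a) \<and> J = (6, t', l, c, a) \<or> I = (7, t', l, c, 0) \<and> J = (6, t', l, c, a)" for I J
      unfolding gate_rule_def using True Suc by simp
    have "pairs (6, t, l, c, a) =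
        {((7, t', l, c, 0), (4, t', num_tapes M, r, 0)) | r. r < rule_count M \<and> write_sym M r l = a \<and>
          sem (7, t', l, c, 0) \<and> sem (4, t', num_tapes M, r, 0)} \<union>
        (if X then {((6, t', l, c, a), (6, t', l, c, a))} else {}) \<union>
        (if sem (7, t', l, c, 0) \<and> X then {((7, t', l, c, 0), (6, t', l, c, a))} else {})"
      unfolding pairs_def gr X_def by auto
    also have "\<dots> = (if A \<and> w then {((7, t', l, c, 0), (4, t', num_tapes M, ?r, 0))} else {}) \<union>
        (if X then {((6, t', l, c, a), (6, t', l, c, a))} else {}) \<union>
        (if A \<and> X then {((7, t', l, c, 0), (6, t', l, c, a))} else {})"
      unfolding sem_rule[OF tl(1)] h(3) A_def[symmetric] w_def
      using rule_at_less[OF M pair_less_4, of x "cert B e b" t'] by auto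
    finally have "pairs (6, t, l, c, a) = (if A \<and> w then {((7, t', l, c, 0), (4, t', num_tapes M, ?r, 0))} else {}) \<union>
        (if X then {((6, t', l, c, a), (6, t', l, c, a))} else {}) \<union>
        (if A \<and> X then {((7, t', l, c, 0), (6, t', l, c, a))} else {})" .
    then show ?thesis unfolding s by (cases A; cases w; cases X) simp_all
  qed
next
  case False
  then have "pairs (6, t, l, c, a) = {}" unfolding pairs_def gate_rule_def by auto
  moreover have "\<not> sem (6, t, l, c, a)" using False by (auto simp: sem_cell)
  ultimately show ?thesis by simp
qed

text \<open>The equation of a free gate is \<open>y = y * y\<close>, which both values
  satisfy.\<close>

lemma pairs_free:
  assumes "k = 1 \<or> k = 2"
  shows "odd (card (pairs (k, t, l, c, a))) \<longleftrightarrow> sem (k, t, l, c, a)"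
proof (cases "l = 0 \<and> c = 0 \<and> a = 0")
  case True
  have "gate_rule M x B T (k, t, l, c, a) I J \<longleftrightarrow> I = (k, t, l, c, a) \<and> J = (k, t, l, c, a)" for I J
    unfolding gate_rule_def prod.case using assms True by (elim disjE) simp_all
  then have "pairs (k, t, l, c, a) = (if sem (k, t, l, c, a) then {((k, t, l, c, a), (k, t, l, c, a))} else {})"
    unfolding pairs_def by (simp only: single_pair simp_thms)
  then show ?thesis by simp
next
  case False
  have "\<not> gate_rule M x B T (k, t, l, c, a) I J" for I J
    unfolding gate_rule_def prod.case using assms False by (elim disjE; simp; blast)
  then have "pairs (k, t, l, c, a) = {}" unfolding pairs_def by simp
  moreover have "\<not> sem (k, t, l, c, a)"
    unfolding sem_def prod.case using assms False by (elim disjE; simp; blast)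
  ultimately show ?thesis by simp
qed

lemma pairs_present: "odd (card (pairs (3, t, l, c, a))) \<longleftrightarrow> sem (3, t, l, c, a)"
proof (cases "l = 0 \<and> c = 0 \<and> a = 0")
  case True
  show ?thesis
  proof (cases t)
    case 0
    then have "pairs (3, t, l, c, a) = (if sem (3, t, l, c, a) then {((1, 0, 0, 0, 0), (1, 0, 0, 0, 0))} else {})"
      unfolding pairs_def gate_rule_def using True by (auto simp: sem_present sem_exists sem_exists[unfolded One_nat_def])
    then show ?thesis by simp
  next
    case (Suc t')
    then have "sem (3, t, l, c, a) \<longleftrightarrow> sem (3, t', 0, 0, 0) \<and> sem (1, t, 0, 0, 0)"
      using True by (auto simp: sem_present sem_exists sem_exists[unfolded One_nat_def] le_Suc_eq)
    then have "pairs (3, t, l, c, a) = (if sem (3, t, l, c, a) then {((3, t', 0, 0, 0), (1, t, 0, 0, 0))} else {})"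
    proof -
      have "gate_rule M x B T (3, t, l, c, a) I J \<longleftrightarrow> I = (3, t', 0, 0, 0) \<and> J = (1, t, 0, 0, 0)" for I J
        unfolding gate_rule_def using True Suc by simp
      then show ?thesis
        unfolding pairs_def \<open>sem (3, t, l, c, a) \<longleftrightarrow> _\<close> by (simp only: single_pair)
    qed
    then show ?thesis by simp
  qed
next
  case False
  then have "pairs (3, t, l, c, a) = {}" unfolding pairs_def gate_rule_def by auto
  moreover have "\<not> sem (3, t, l, c, a)" using False by (auto simp: sem_def)
  ultimately show ?thesis by simp
qed

lemma sem_iff_pairs:
  assumes "fst G \<noteq> 0"
  shows "sem G \<longleftrightarrow> odd (card (pairs G))"
proof -
  obtain k t l c a where G: "G = (k, t, l, c, a)" by (cases G) auto
  consider "k = 1 \<or> k = 2" | "k = 3" | "k = 4" | "k = 5" | "k = 6" | "k = 7" | "7 < k"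
    using assms G by fastforce
  then show ?thesis
  proof cases
    case 7
    then have "pairs G = {}" unfolding pairs_def gate_rule_def G by auto
    then show ?thesis using 7 by (simp add: G sem_def)
  qed (simp_all only: G pairs_free pairs_present pairs_prefix pairs_scan pairs_cell pairs_head)
qed

end


section \<open>Numbering the gates and uniqueness of the computation\<close>

definition gate_num :: "nat \<Rightarrow> gate \<Rightarrow> nat" where
  "gate_num R G = (case G of (k, t, l, c, a) \<Rightarrow> k + 8 * (t + R * (l + R * (c + R * a))))"

definition gate_of :: "nat \<Rightarrow> nat \<Rightarrow> gate" where
  "gate_of R g = (g mod 8, g div 8 mod R, g div 8 div R mod R, g div 8 div R div R mod R,
     g div 8 div R div R div R)"

definition valid_gate :: "nat \<Rightarrow> gate \<Rightarrow> bool" where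
  "valid_gate R G = (case G of (k, t, l, c, a) \<Rightarrow> k < 8 \<and> t < R \<and> l < R \<and> c < R \<and> a < R)"

definition machine_quadratics :: "tm \<Rightarrow> bool list \<Rightarrow> nat \<Rightarrow> nat \<Rightarrow> nat \<Rightarrow> nat \<Rightarrow> nat \<Rightarrow> nat \<Rightarrow> bool" where
  "machine_quadratics M x B T R g i j = gate_rule M x B T (gate_of R g) (gate_of R i) (gate_of R j)"

lemma digit_less: "u < (A :: nat) \<Longrightarrow> v < C \<Longrightarrow> u + A * v < A * C"
proof -
  assume "u < A" "v < C"
  then have "u + A * v < A * (v + 1)" by simp
  also have "\<dots> \<le> A * C" using \<open>v < C\<close> by (intro mult_le_mono2) simp
  finally show ?thesis .
qed

lemma gate_of_num: "valid_gate R G \<Longrightarrow> gate_of R (gate_num R G) = G"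
  by (cases G) (simp add: valid_gate_def gate_of_def gate_num_def del: distrib_left_numeral)

lemma gate_num_of: "gate_num R (gate_of R g) = g"
  by (simp add: gate_of_def gate_num_def del: distrib_left_numeral)

lemma gate_num_less: "valid_gate R G \<Longrightarrow> gate_num R G < 8 * (R * (R * (R * R)))"
  by (cases G) (simp only: valid_gate_def gate_num_def prod.case, intro digit_less; blast)

lemma valid_gate_of: "g < 8 * (R * (R * (R * R))) \<Longrightarrow> valid_gate R (gate_of R g)"
proof -
  assume g: "g < 8 * (R * (R * (R * R)))"
  then have "0 < R" by (cases R) auto
  have "g div 8 < R * (R * (R * R))" using g by (simp add: less_mult_imp_div_less mult.commute)
  then have "g div 8 div R < R * (R * R)" by (simp add: less_mult_imp_div_less mult.commute)
  then have "g div 8 div R div R < R * R" by (simp add: less_mult_imp_div_less mult.commute)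
  then have "g div 8 div R div R div R < R" by (simp add: less_mult_imp_div_less)
  then show ?thesis using \<open>0 < R\<close> by (simp add: valid_gate_def gate_of_def)
qed

lemma rule_one_iff: "gate_rule M x B T (0, 0, 0, 0, 0) I J \<longleftrightarrow> I = (6, T, 1, T, 2) \<and> J = (6, T, 1, T, 2)"
  by (simp add: gate_rule_def)

context
  fixes M :: tm and x :: "bool list" and B T R :: nat
  assumes M: "wf_tm M"
    and R: "2 * T + 1 < R" "rule_count M \<le> R" "num_tapes M < R" "num_symbols M \<le> R" "B \<le> R"
begin

abbreviation (input) "cert_tape e b \<equiv> tape_at M (pair (x, cert B e b))"

text \<open>No true gate falls outside the numbered range. The critical case is kind
  \<open>4\<close>, where a prefix code is bounded by \<open>rule_count M\<close>.\<close>

lemma sem_valid: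
  assumes "\<And>i. e i \<Longrightarrow> i < R" "\<And>i. b i \<Longrightarrow> i < R" "sem M x B T e b G"
  shows "valid_gate R G"
proof -
  note inv = cfg_inv[OF M pair_less_4[of x "cert B e b"]]
  obtain k t l c a where G: "G = (k, t, l, c, a)" by (cases G) auto
  have R0: "0 < R" using R by linarith
  consider "k = 0" | "k = 1" | "k = 2" | "k = 3" | "k = 4" | "k = 5" | "k = 6" | "k = 7" | "7 < k" by linarith
  then show ?thesis
  proof cases
    case 5
    then have h: "a = 0" "t \<le> T" "l \<le> num_tapes M"
      "c = enc (num_symbols M) (state_at M (pair (x, cert B e b)) t) (take l (scan M (pair (x, cert B e b)) t))"
      using assms(3) sem_prefix[OF M] by (simp_all add: G)
    let ?s = "scan M (pair (x, cert B e b)) t"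
    have "c < num_states M * num_symbols M ^ length (take l ?s)"
      unfolding h(4) using inv[of t] scan_less[OF M pair_less_4[of x "cert B e b"], of t]
      by (intro enc_bound) (auto dest: in_set_takeD)
    also have "\<dots> \<le> rule_count M"
      unfolding rule_count_def using h(3) symbols4[OF M pair_less_4[of x "cert B e b"]]
      by (intro mult_le_mono2 power_increasing) (simp_all add: length_scan[OF M pair_less_4])
    finally show ?thesis using 5 h R by (simp add: valid_gate_def G)
  next
    case 6
    then have h: "a = 0" "t \<le> T" "l < num_tapes M" "c = scan M (pair (x, cert B e b)) t ! l"
      using assms(3) sem_scan[OF M] by (simp_all add: G)
    have "c < num_symbols M" unfolding h(4) using h(3)
      by (intro bspec[OF scan_less[OF M pair_less_4] nth_mem]) (simp add: length_scan[OF M pair_less_4])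
    then show ?thesis using 6 h R by (simp add: valid_gate_def G)
  next
    case 7
    then have h: "t \<le> T" "l < num_tapes M" "c < 2 * T + 1" "a = fst (cert_tape e b t l) (int c - int T)"
      using assms(3) sem_cell[OF M] by (simp_all add: G)
    have "a < num_symbols M" unfolding h(4) using inv[of t] h(2) by blast
    then show ?thesis using 7 h R by (simp add: valid_gate_def G)
  next
    case 8
    then have h: "a = 0" "t \<le> T" "l < num_tapes M" "int c = snd (cert_tape e b t l) + int T"
      using assms(3) sem_head[OF M] by (simp_all add: G)
    have "\<bar>snd (cert_tape e b t l)\<bar> \<le> int t" using inv[of t] h(3) by blast
    then have "c < R" using h(2,4) R by linarith
    then show ?thesis using 8 h R by (simp add: valid_gate_def G)
  qed (use assms R0 in \<open>auto simp: G sem_def[OF M] valid_gate_def\<close>)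
qed

end

context
  fixes M :: tm and x :: "bool list" and B T R :: nat
  assumes M: "wf_tm M"
    and R: "2 * T + 1 < R" "rule_count M \<le> R" "num_tapes M < R" "num_symbols M \<le> R" "B \<le> R"
begin

context
  fixes y :: "gate \<Rightarrow> bool" and e b :: "nat \<Rightarrow> bool"
  assumes one: "y (0, 0, 0, 0, 0)"
    and y: "\<And>G. fst G \<noteq> 0 \<Longrightarrow>
      y G \<longleftrightarrow> valid_gate R G \<and> odd (card {(I, J). y I \<and> y J \<and> gate_rule M x B T G I J})"
    and e: "\<And>i. e i \<longleftrightarrow> y (1, i, 0, 0, 0)" and b: "\<And>i. b i \<longleftrightarrow> y (2, i, 0, 0, 0)"
begin

abbreviation (input) "sm \<equiv> sem M x B T e b"

lemma y_valid: "fst G \<noteq> 0 \<Longrightarrow> y G \<Longrightarrow> valid_gate R G"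
  using y by blast

text \<open>One step of the induction showing that the free gates determine a solution: if
  \<open>y\<close> agrees with the intended values on all gates occurring in the equation of
  \<open>G\<close>, it agrees on \<open>G\<close>.\<close>

lemma determined:
  assumes "fst G \<noteq> 0" and eq: "\<And>I J. gate_rule M x B T G I J \<Longrightarrow> (y I \<longleftrightarrow> sm I) \<and> (y J \<longleftrightarrow> sm J)"
  shows "y G \<longleftrightarrow> sm G"
proof -
  have ev: "i < R" if "e i" for i
    using y_valid[of "(1, i, 0, 0, 0)"] that by (simp add: e valid_gate_def)
  have bv: "i < R" if "b i" for i
    using y_valid[of "(2, i, 0, 0, 0)"] that by (simp add: b valid_gate_def)
  have "{(I, J). y I \<and> y J \<and> gate_rule M x B T G I J} = pairs M x B T e b G"
    unfolding pairs_def[OF M] using eq by blast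
  then have "y G \<longleftrightarrow> valid_gate R G \<and> sm G"
    using y[OF assms(1)] sem_iff_pairs[OF M assms(1), of x B T e b] by simp
  then show ?thesis using sem_valid[OF M R, of e b x G] ev bv by blast
qed

lemma y_one: "y (0, 0, 0, 0, 0) \<longleftrightarrow> sm (0, 0, 0, 0, 0)"
  using one sem_one[OF M] by simp

lemma y_exists: "y (1, i, 0, 0, 0) \<longleftrightarrow> sm (1, i, 0, 0, 0)" and y_bit: "y (2, i, 0, 0, 0) \<longleftrightarrow> sm (2, i, 0, 0, 0)"
  by (simp_all only: sem_exists[OF M] sem_bit[OF M] e b)

lemma y_present: "y (3, i, 0, 0, 0) \<longleftrightarrow> sm (3, i, 0, 0, 0)"
proof (induction i)
  case 0
  show ?case
  proof (rule determined)
    fix I J assume "gate_rule M x B T (3, 0, 0, 0, 0) I J"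
    then have "I = (1, 0, 0, 0, 0)" "J = (1, 0, 0, 0, 0)" by (simp_all add: gate_rule_def)
    then show "(y I \<longleftrightarrow> sm I) \<and> (y J \<longleftrightarrow> sm J)" using y_exists by (simp only: simp_thms)
  qed simp
next
  case (Suc i)
  show ?case
  proof (rule determined)
    fix I J assume "gate_rule M x B T (3, Suc i, 0, 0, 0) I J"
    then have "I = (3, i, 0, 0, 0)" "J = (1, Suc i, 0, 0, 0)" by (simp_all add: gate_rule_def)
    then show "(y I \<longleftrightarrow> sm I) \<and> (y J \<longleftrightarrow> sm J)" using y_exists Suc by (simp only: simp_thms)
  qed simp
qed

text \<open>The induction hypothesis for time \<open>t\<close> lists only cells, heads and the
  state; scanned symbols and longer prefixes follow from these within the same time.\<close>

definition "agree t \<longleftrightarrow> (\<forall>l c a. y (6, t, l, c, a) = sm (6, t, l, c, a)) \<and>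
  (\<forall>l c. y (7, t, l, c, 0) = sm (7, t, l, c, 0)) \<and> (\<forall>c. y (4, t, 0, c, 0) = sm (4, t, 0, c, 0))"

lemma agree_scan:
  assumes "agree t"
  shows "y (5, t, l, c, 0) \<longleftrightarrow> sm (5, t, l, c, 0)"
proof (rule determined)
  fix I J assume "gate_rule M x B T (5, t, l, c, 0) I J"
  then obtain c' where "I = (7, t, l, c', 0)" "J = (6, t, l, c', c)" by (auto simp: gate_rule_def)
  then show "(y I \<longleftrightarrow> sm I) \<and> (y J \<longleftrightarrow> sm J)" using assms by (simp only: agree_def simp_thms)
qed simp

lemma agree_prefix:
  assumes "agree t"
  shows "y (4, t, l, c, 0) \<longleftrightarrow> sm (4, t, l, c, 0)"
proof (induction l arbitrary: c)
  case 0
  then show ?case using assms by (simp only: agree_def)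
next
  case (Suc l)
  show ?case
  proof (rule determined)
    fix I J assume "gate_rule M x B T (4, t, Suc l, c, 0) I J"
    then have "I = (4, t, l, c div num_symbols M, 0)" "J = (5, t, l, c mod num_symbols M, 0)"
      by (simp_all add: gate_rule_def)
    then show "(y I \<longleftrightarrow> sm I) \<and> (y J \<longleftrightarrow> sm J)" using Suc agree_scan[OF assms] by (simp only: simp_thms)
  qed simp
qed

lemma agree_0: "agree 0"
  unfolding agree_def
proof (intro conjI allI)
  fix l c a
  show "y (6, 0, l, c, a) = sm (6, 0, l, c, a)"
  proof (rule determined)
    fix I J assume "gate_rule M x B T (6, 0, l, c, a) I J"
    then have "init_rule x B T l c a I J" by (auto simp: gate_rule_def)
    then have "(I = (0, 0, 0, 0, 0) \<or> (\<exists>i. I = (3, i, 0, 0, 0))) \<and>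
        (J = (0, 0, 0, 0, 0) \<or> (\<exists>i. J = (3, i, 0, 0, 0)) \<or> (\<exists>i. J = (2, i, 0, 0, 0)))"
      unfolding init_rule_def by (auto split: if_splits)
    then show "(y I \<longleftrightarrow> sm I) \<and> (y J \<longleftrightarrow> sm J)"
      using y_one y_present y_bit by (elim conjE disjE exE) (simp_all only: simp_thms)
  qed simp
  show "y (7, 0, l, c, 0) = sm (7, 0, l, c, 0)"
  proof (rule determined)
    fix I J assume "gate_rule M x B T (7, 0, l, c, 0) I J"
    then have "I = (0, 0, 0, 0, 0)" "J = (0, 0, 0, 0, 0)" by (auto simp: gate_rule_def)
    then show "(y I \<longleftrightarrow> sm I) \<and> (y J \<longleftrightarrow> sm J)" using y_one by (simp only: simp_thms)
  qed simp
  show "y (4, 0, 0, c, 0) = sm (4, 0, 0, c, 0)"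
  proof (rule determined)
    fix I J assume "gate_rule M x B T (4, 0, 0, c, 0) I J"
    then have "I = (0, 0, 0, 0, 0)" "J = (0, 0, 0, 0, 0)" by (auto simp: gate_rule_def)
    then show "(y I \<longleftrightarrow> sm I) \<and> (y J \<longleftrightarrow> sm J)" using y_one by (simp only: simp_thms)
  qed simp
qed

lemma agree_Suc:
  assumes t: "agree t"
  shows "agree (Suc t)"
proof -
  have t': "y (6, t, l, c, a) = sm (6, t, l, c, a)" "y (7, t, l, c, 0) = sm (7, t, l, c, 0)" for l c a
    using t by (simp_all only: agree_def)
  show ?thesis
    unfolding agree_def
  proof (intro conjI allI)
    fix l c a
    show "y (6, Suc t, l, c, a) = sm (6, Suc t, l, c, a)"
    proof (rule determined)
      fix I J assume "gate_rule M x B T (6, Suc t, l, c, a) I J"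
      then have "(I = (7, t, l, c, 0) \<or> I = (6, t, l, c, a)) \<and>
          ((\<exists>r. J = (4, t, num_tapes M, r, 0)) \<or> J = (6, t, l, c, a))"
        by (auto simp: gate_rule_def)
      then show "(y I \<longleftrightarrow> sm I) \<and> (y J \<longleftrightarrow> sm J)"
        using t' agree_prefix[OF t] by (elim conjE disjE exE) (simp_all only: simp_thms)
    qed simp
    show "y (7, Suc t, l, c, 0) = sm (7, Suc t, l, c, 0)"
    proof (rule determined)
      fix I J assume "gate_rule M x B T (7, Suc t, l, c, 0) I J"
      then obtain r c' where "I = (4, t, num_tapes M, r, 0)" "J = (7, t, l, c', 0)"
        by (auto simp: gate_rule_def)
      then show "(y I \<longleftrightarrow> sm I) \<and> (y J \<longleftrightarrow> sm J)"
        using t' agree_prefix[OF t] by (simp only: simp_thms)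
    qed simp
    show "y (4, Suc t, 0, c, 0) = sm (4, Suc t, 0, c, 0)"
    proof (rule determined)
      fix I J assume "gate_rule M x B T (4, Suc t, 0, c, 0) I J"
      then obtain r where "I = (4, t, num_tapes M, r, 0)" "J = (4, t, num_tapes M, r, 0)"
        by (auto simp: gate_rule_def)
      then show "(y I \<longleftrightarrow> sm I) \<and> (y J \<longleftrightarrow> sm J)"
        using agree_prefix[OF t] by (simp only: simp_thms)
    qed simp
  qed
qed

lemma agree_all: "agree t"
  by (induction t) (rule agree_0, rule agree_Suc)

lemma y_cell: "y (6, t, l, c, a) = sm (6, t, l, c, a)"
  using agree_all[of t] by (simp only: agree_def)

end

lemma sem_accept:
  "sem M x B T e b (6, T, 1, T, 2) \<longleftrightarrow> fst (tape_at M (pair (x, cert B e b)) T 1) 0 = 2"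
  using tapes2[OF M pair_less_4] by (auto simp: sem_cell[OF M])

text \<open>A solution must follow the run on the certificate that its free gates describe, and the
  equation of the constant gate is \<open>1 = y * y\<close> for the accepting gate \<open>y\<close>.
  Conversely, the intended values for an accepted certificate solve the system.\<close>

theorem machine_quadratics_iff:
  "(\<exists>Y. quadratic_solution (8 * (R * (R * (R * R)))) (machine_quadratics M x B T R) Y) \<longleftrightarrow>
    (\<exists>z. length z \<le> B \<and> fst (tape_at M (pair (x, z)) T 1) 0 = 2)"
proof
  let ?n = "8 * (R * (R * (R * R)))"
  assume "\<exists>Y. quadratic_solution ?n (machine_quadratics M x B T R) Y"
  then obtain Y where Y: "Y \<subseteq> {..<?n}" "0 \<in> Y"
    "\<And>g. g < ?n \<Longrightarrow> g \<in> Y \<longleftrightarrow> odd (card {(i, j) \<in> Y \<times> Y. machine_quadratics M x B T R g i j})"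
    by (auto simp: quadratic_solution_def)
  define y where "y G \<longleftrightarrow> valid_gate R G \<and> gate_num R G \<in> Y" for G
  have R0: "0 < R" using R by linarith
  have one: "y (0, 0, 0, 0, 0)" using Y(2) R0 by (simp add: y_def valid_gate_def gate_num_def)
  have yg: "g \<in> Y \<longleftrightarrow> g < ?n \<and> y (gate_of R g)" for g
    using Y(1) valid_gate_of[of g R] by (auto simp: y_def gate_num_of)
  have "y G \<longleftrightarrow> valid_gate R G \<and> odd (card {(I, J). y I \<and> y J \<and> gate_rule M x B T G I J})" for G
  proof (cases "valid_gate R G")
    case True
    let ?f = "\<lambda>(i, j). (gate_of R i, gate_of R j)"
    have "{(I, J). y I \<and> y J \<and> gate_rule M x B T G I J} =
        ?f ` {(i, j) \<in> Y \<times> Y. machine_quadratics M x B T R (gate_num R G) i j}"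
    proof (intro equalityI subsetI)
      fix p assume "p \<in> {(I, J). y I \<and> y J \<and> gate_rule M x B T G I J}"
      then obtain I J where p: "p = (I, J)" "y I" "y J" "gate_rule M x B T G I J" by blast
      have "I = gate_of R (gate_num R I)" "J = gate_of R (gate_num R J)"
        using p by (simp_all add: y_def gate_of_num)
      moreover have "gate_num R I \<in> Y" "gate_num R J \<in> Y" using p by (simp_all add: y_def)
      moreover have "machine_quadratics M x B T R (gate_num R G) (gate_num R I) (gate_num R J)"
        using p True by (simp add: machine_quadratics_def gate_of_num y_def)
      ultimately show "p \<in> ?f ` {(i, j) \<in> Y \<times> Y. machine_quadratics M x B T R (gate_num R G) i j}"
        using p(1) by (intro image_eqI[of _ _ "(gate_num R I, gate_num R J)"]) auto
    next
      fix p assume "p \<in> ?f ` {(i, j) \<in> Y \<times> Y. machine_quadratics M x B T R (gate_num R G) i j}"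
      then obtain i j where "p = (gate_of R i, gate_of R j)" "i \<in> Y" "j \<in> Y"
        "machine_quadratics M x B T R (gate_num R G) i j" by auto
      then show "p \<in> {(I, J). y I \<and> y J \<and> gate_rule M x B T G I J}"
        using True yg by (simp add: machine_quadratics_def gate_of_num)
    qed
    moreover have "inj_on ?f A" for A
      by (rule inj_onI) (metis (no_types, lifting) case_prod_beta gate_num_of prod.inject prod.collapse)
    ultimately have "card {(I, J). y I \<and> y J \<and> gate_rule M x B T G I J} =
        card {(i, j) \<in> Y \<times> Y. machine_quadratics M x B T R (gate_num R G) i j}"
      by (simp only: card_image)
    then show ?thesis using Y(3)[OF gate_num_less[OF True]] True by (simp add: y_def)
  qed (simp add: y_def)
  note yG = this
  define e b where "e i \<longleftrightarrow> y (1, i, 0, 0, 0)" and "b i \<longleftrightarrow> y (2, i, 0, 0, 0)" for i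
  have "y (6, T, 1, T, 2) = sem M x B T e b (6, T, 1, T, 2)"
    by (rule y_cell[OF one yG e_def b_def])
  moreover have "y (6, T, 1, T, 2)"
  proof -
    have o: "odd (card {(I, J). y I \<and> y J \<and> I = (6, T, 1, T, 2) \<and> J = (6, T, 1, T, 2)})"
      using yG[of "(0, 0, 0, 0, 0)"] one unfolding rule_one_iff by blast
    have "{(I, J). y I \<and> y J \<and> I = (6, T, 1, T, 2) \<and> J = (6, T, 1, T, 2)} =
        (if y (6, T, 1, T, 2) \<and> y (6, T, 1, T, 2) then {((6, T, 1, T, 2), (6, T, 1, T, 2))} else {})"
      by (rule single_pair)
    then show ?thesis using o by (cases "y (6, T, 1, T, 2)") (simp_all only: if_False simp_thms if_True card.empty even_zero)
  qed
  ultimately have "fst (tape_at M (pair (x, cert B e b)) T 1) 0 = 2" using sem_accept by blast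
  then show "\<exists>z. length z \<le> B \<and> fst (tape_at M (pair (x, z)) T 1) 0 = 2"
    using length_cert_le by blast
next
  let ?n = "8 * (R * (R * (R * R)))"
  assume "\<exists>z. length z \<le> B \<and> fst (tape_at M (pair (x, z)) T 1) 0 = 2"
  then obtain z where z: "length z \<le> B" "fst (tape_at M (pair (x, z)) T 1) 0 = 2" by blast
  \<comment> \<open>The value bits beyond the certificate are set to false so that only gates in the
    numbered range are true.\<close>
  define e b where "e i \<longleftrightarrow> i < length z" and "b i \<longleftrightarrow> i < length z \<and> z ! i" for i
  have "(LEAST i. B \<le> i \<or> \<not> e i) = length z"
    by (rule Least_equality) (use z(1) in \<open>auto simp: e_def\<close>)
  then have cert: "cert B e b = z"
    by (intro nth_equalityI) (simp_all add: cert_def b_def)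
  let ?s = "sem M x B T e b"
  have eR: "i < R" if "e i" for i using that z(1) R(5) by (simp add: e_def)
  have bR: "i < R" if "b i" for i using that z(1) R(5) by (simp add: b_def)
  note valid = sem_valid[OF M R, of e b x, OF eR bR]
  define Y where "Y = gate_num R ` {G. ?s G}"
  have R0: "0 < R" using R by linarith
  have memY: "gate_num R G \<in> Y \<longleftrightarrow> ?s G" if "valid_gate R G" for G
  proof
    assume "gate_num R G \<in> Y"
    then obtain G' where "?s G'" "gate_num R G = gate_num R G'" by (auto simp: Y_def)
    then show "?s G" using gate_of_num[OF that] gate_of_num[OF valid] by metis
  qed (simp add: Y_def)
  have one: "?s (0, 0, 0, 0, 0)" by (rule sem_one[OF M])
  have eq: "?s G \<longleftrightarrow> odd (card (pairs M x B T e b G))" if "valid_gate R G" for G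
  proof (cases "fst G = 0")
    case True
    have sG: "?s G \<longleftrightarrow> G = (0, 0, 0, 0, 0)" using True by (cases G) (simp add: sem_def[OF M])
    show ?thesis
    proof (cases "G = (0, 0, 0, 0, 0)")
      case G: True
      have "?s (6, T, 1, T, 2)" using z(2) sem_accept cert by simp
      then show ?thesis
        unfolding G pairs_def[OF M] rule_one_iff single_pair using one by simp
    next
      case False
      have "pairs M x B T e b G = {}"
        using True False by (cases G) (auto simp: pairs_def[OF M] gate_rule_def)
      then show ?thesis using False sG by simp
    qed
  next
    case False
    then show ?thesis by (rule sem_iff_pairs[OF M])
  qed
  have "quadratic_solution ?n (machine_quadratics M x B T R) Y"
    unfolding quadratic_solution_def
  proof (intro conjI allI impI)
    show "Y \<subseteq> {..<?n}" using valid gate_num_less by (auto simp: Y_def)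
    show "0 \<in> Y" using memY[of "(0, 0, 0, 0, 0)"] one R0 by (simp add: valid_gate_def gate_num_def)
    fix g assume g: "g < ?n"
    let ?G = "gate_of R g"
    let ?f = "\<lambda>(I, J). (gate_num R I, gate_num R J)"
    have "{(i, j) \<in> Y \<times> Y. machine_quadratics M x B T R g i j} = ?f ` pairs M x B T e b ?G"
    proof (intro equalityI subsetI)
      fix p assume "p \<in> {(i, j) \<in> Y \<times> Y. machine_quadratics M x B T R g i j}"
      then obtain I J where p: "p = (gate_num R I, gate_num R J)" "?s I" "?s J"
        "machine_quadratics M x B T R g (gate_num R I) (gate_num R J)" by (auto simp: Y_def)
      then have "(I, J) \<in> pairs M x B T e b ?G"
        by (simp add: pairs_def[OF M] machine_quadratics_def gate_of_num[OF valid])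
      then show "p \<in> ?f ` pairs M x B T e b ?G" using p(1) by (intro image_eqI[of _ _ "(I, J)"]) auto
    next
      fix p assume "p \<in> ?f ` pairs M x B T e b ?G"
      then obtain I J where p: "p = (gate_num R I, gate_num R J)" "?s I" "?s J" "gate_rule M x B T ?G I J"
        by (auto simp: pairs_def[OF M])
      then show "p \<in> {(i, j) \<in> Y \<times> Y. machine_quadratics M x B T R g i j}"
        by (simp add: Y_def machine_quadratics_def gate_of_num[OF valid])
    qed
    moreover have "inj_on ?f (pairs M x B T e b ?G)"
    proof (rule inj_onI)
      fix p p' assume pp: "p \<in> pairs M x B T e b ?G" "p' \<in> pairs M x B T e b ?G" "?f p = ?f p'"
      obtain I J I' J' where IJ: "p = (I, J)" "p' = (I', J')" by (cases p, cases p')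
      have s: "?s I" "?s J" "?s I'" "?s J'" using pp(1,2) IJ by (simp_all add: pairs_def[OF M])
      have "gate_of R (gate_num R I) = gate_of R (gate_num R I')" "gate_of R (gate_num R J) = gate_of R (gate_num R J')"
        using pp(3) IJ by simp_all
      then show "p = p'" using s IJ by (simp add: gate_of_num[OF valid])
    qed
    ultimately have "card {(i, j) \<in> Y \<times> Y. machine_quadratics M x B T R g i j} = card (pairs M x B T e b ?G)"
      by (simp only: card_image)
    then show "g \<in> Y \<longleftrightarrow> odd (card {(i, j) \<in> Y \<times> Y. machine_quadratics M x B T R g i j})"
      using eq[OF valid_gate_of[OF g]] memY[OF valid_gate_of[OF g]] by (simp add: gate_num_of)
  qed
  then show "\<exists>Y. quadratic_solution ?n (machine_quadratics M x B T R) Y" by blast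
qed

end

text \<open>In contrast to \<open>pf_ex\<close>, \<open>P\<close> need only be computable for each
  fixed \<open>r\<close>; the program is a disjunction of constant length. This is how the
  transition table, defined by a choice operator, enters the program.\<close>

lemma pf_ex_const:
  fixes N :: nat
  assumes "\<And>r. r < N \<Longrightarrow> pf vs W (\<lambda>a. of_bool (P a r))"
  shows "pf vs W (\<lambda>a. of_bool (\<exists>r<N. P a r))"
  using assms
proof (induction N)
  case (Suc N)
  have "pf vs W (\<lambda>a. of_bool ((\<exists>r<N. P a r) \<or> P a N))"
    by (rule pf_disj, rule Suc.IH, rule Suc.prems, simp, rule Suc.prems, simp)
  then show ?case by (simp only: less_Suc_eq ex_disj_distrib conj_disj_distribR) simp
qed (simp add: pf_const)

lemma pf_sum_const:
  fixes N :: nat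
  assumes "\<And>r. r < N \<Longrightarrow> pf vs W (\<lambda>a. F a r)"
  shows "pf vs W (\<lambda>a. \<Sum>r<N. F a r)"
  using assms by (induction N) (simp_all add: pf_const pf_add)

lemma pf_if_bool:
  assumes "pf vs W (\<lambda>a. of_bool (P a))" "pf vs W (\<lambda>a. of_bool (Q a))" "pf vs W (\<lambda>a. of_bool (R a))"
  shows "pf vs W (\<lambda>a. of_bool (if P a then Q a else R a))"
proof -
  have "pf vs W (\<lambda>a. if P a then of_bool (Q a) else of_bool (R a))" by (rule pf_if) (rule assms)+
  then show ?thesis by (simp only: if_distrib)
qed

text \<open>Halves repeatedly, because \<open>2 ^ I a\<close> may be too large to be held in
  unary.\<close>

lemma pf_halve:
  assumes "pf vs W A" "pf vs W I"
  shows "pf vs W (\<lambda>a. A a div 2 ^ I a)"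
proof -
  have eq: "((\<lambda>z. z div 2) ^^ i) m = m div 2 ^ i" for i m :: nat
    by (induction i) (simp_all add: div_mult2_eq[symmetric] mult.commute)
  have "pf vs W (\<lambda>a. ((\<lambda>z. z div 2) ^^ I a) (A a))"
  proof (rule pf_funpow[where f = "\<lambda>a z. z div 2" and B = A])
    show "pf (snd # map (\<lambda>v p. v (fst p)) vs) (\<lambda>p. W (fst p)) (\<lambda>p. snd p div 2)"
      by (rule pf_div, rule pf_var, simp, rule pf_const)
  qed (simp_all add: assms eq)
  then show ?thesis by (simp only: eq)
qed

lemmas pf_all_rules = pf_const pf_Suc pf_add pf_mult pf_diff pf_not pf_conj pf_disj pf_imp pf_le pf_less
  pf_eq pf_iff pf_if_bool pf_if pf_sum_const pf_sum pf_ex_const pf_ex pf_all pf_sym pf_length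
  pf_halve pf_div pf_mod pf_odd pf_power pf_poly

lemma pf_bit_at: "pf vs W A \<Longrightarrow> pf vs W B \<Longrightarrow> pf vs W (\<lambda>a. bit_at (A a) (B a))"
  unfolding bit_at_def by (rule pf_mod, rule pf_halve, assumption, assumption, rule pf_const)

lemma pf_hit:
  assumes "pf vs W A" "pf vs W X" "pf vs W B" "pf vs W J" "pf vs W I"
  shows "pf vs W (\<lambda>a. of_bool (hit (A a) (X a) (B a) (J a) (I a)))"
  unfolding hit_def by (rule assms pf_all_rules)+

lemma pf_base_len: "pf vs W N \<Longrightarrow> pf vs W (\<lambda>a. base_len (N a))"
  unfolding base_len_def by (assumption | rule pf_all_rules)+

lemma pf_base_code:
  assumes "pf vs W N" "pf vs W L" "pf vs W I"
  shows "pf vs W (\<lambda>a. base_code (N a) (L a) (I a))"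
  unfolding base_code_def
  by (rule assms pf_bit_at pf_hit pf_all_rules | (rule pf_var, simp; fail) | rule pf_lift)+

lemma pf_code_len: "pf vs W N \<Longrightarrow> pf vs W (\<lambda>a. code_len (N a))"
  unfolding code_len_def by (rule pf_power, rule pf_base_len)

lemma pf_code:
  assumes "pf vs W N" "pf vs W L" "pf vs W I"
  shows "pf vs W (\<lambda>a. code (N a) (L a) (I a))"
  unfolding code_def by (rule assms pf_base_code pf_base_len pf_all_rules)+

lemma pf_threshold: "pf vs W N \<Longrightarrow> pf vs W (\<lambda>a. threshold (N a))"
  unfolding threshold_def by (assumption | rule pf_code_len pf_all_rules)+

lemma pf_num_columns: "pf vs W N \<Longrightarrow> pf vs W (\<lambda>a. num_columns (N a))"
  unfolding num_columns_def by (assumption | rule pf_code_len pf_threshold pf_all_rules)+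

lemma pf_constr:
  assumes Q: "\<And>A B C. pf vs W A \<Longrightarrow> pf vs W B \<Longrightarrow> pf vs W C \<Longrightarrow> pf vs W (\<lambda>a. of_bool (Q a (A a) (B a) (C a)))"
    and "pf vs W N" "pf vs W E" "pf vs W I" "pf vs W J"
  shows "pf vs W (\<lambda>a. of_bool (constr (N a) (Q a) (E a) (I a) (J a)))"
  unfolding constr_def by (rule assms(2-5) pf_all_rules Q)+

lemma pf_column:
  assumes Q: "\<And>A B C. pf vs W A \<Longrightarrow> pf vs W B \<Longrightarrow> pf vs W C \<Longrightarrow> pf vs W (\<lambda>a. of_bool (Q a (A a) (B a) (C a)))"
    and "pf vs W N" "pf vs W E" "pf vs W I" "pf vs W J"
  shows "pf vs W (\<lambda>a. of_bool (column (N a) (Q a) (E a) (I a) (J a)))"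
  unfolding column_def by (rule assms(2-5) pf_code_len pf_code pf_constr pf_all_rules Q | assumption)+

lemma pf_arc:
  assumes mc: "\<And>A B. pf vs W A \<Longrightarrow> pf vs W B \<Longrightarrow> pf vs W (\<lambda>a. of_bool (mc a (A a) (B a)))"
    and "pf vs W K" "pf vs W R" "pf vs W U" "pf vs W V"
  shows "pf vs W (\<lambda>a. of_bool (arc (K a) (R a) (mc a) (U a) (V a)))"
  unfolding arc_def Let_def incident_def by (rule assms(2-5) pf_all_rules mc)+

lemma pf_gadget_size:
  "pf vs W K \<Longrightarrow> pf vs W R \<Longrightarrow> pf vs W C \<Longrightarrow> pf vs W (\<lambda>a. gadget_size (K a) (R a) (C a))"
  unfolding gadget_size_def by (assumption | rule pf_all_rules)+

lemma length_bits: "length (bits x) = length x"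
  by (simp add: bits_def)

lemma symb_bits: "i < length x \<Longrightarrow> symb (bits x) i = (if x ! i then 2 else 1)"
  by (simp add: symb_def bits_def)

text \<open>States the rule through the symbols on the input tape, which programs can read, instead
  of the list \<open>x\<close>.\<close>

lemma init_rule_symb:
  "init_rule x B T l c a I J \<longleftrightarrow>
     (if l = 0 \<and> T + length (bits x) < c \<and> c \<le> T + length (bits x) + B
      then a = 2 \<and> I = (3, c - (T + length (bits x) + 1), 0, 0, 0) \<and> J = (2, c - (T + length (bits x) + 1), 0, 0, 0) \<or>
        a = 1 \<and> I = (3, c - (T + length (bits x) + 1), 0, 0, 0) \<and>
          (J = (0, 0, 0, 0, 0) \<or> J = (2, c - (T + length (bits x) + 1), 0, 0, 0)) \<or>
        a = 0 \<and> (I = (0, 0, 0, 0, 0) \<and> J = (0, 0, 0, 0, 0) \<or>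
          I = (3, c - (T + length (bits x) + 1), 0, 0, 0) \<and> J = (3, c - (T + length (bits x) + 1), 0, 0, 0))
      else I = (0, 0, 0, 0, 0) \<and> J = (0, 0, 0, 0, 0) \<and>
        a = (if l = 0 \<and> T \<le> c \<and> c < T + length (bits x) then symb (bits x) (c - T)
          else if l = 0 \<and> c = T + length (bits x) then 3 else 0))"
proof -
  have "(if l = 0 \<and> T \<le> c \<and> c < T + length x then symb (bits x) (c - T) else z) =
      (if l = 0 \<and> T \<le> c \<and> c < T + length x then (if x ! (c - T) then 2 else 1) else z)" for z
    using symb_bits[of "c - T" x] by auto
  then show ?thesis unfolding init_rule_def length_bits by (simp only:)
qed

lemma pf_gate_rule:
  assumes "pf vs (\<lambda>a. bits (X a)) B" "pf vs (\<lambda>a. bits (X a)) T"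
    "pf vs (\<lambda>a. bits (X a)) G1" "pf vs (\<lambda>a. bits (X a)) G2" "pf vs (\<lambda>a. bits (X a)) G3"
    "pf vs (\<lambda>a. bits (X a)) G4" "pf vs (\<lambda>a. bits (X a)) G5"
    "pf vs (\<lambda>a. bits (X a)) I1" "pf vs (\<lambda>a. bits (X a)) I2" "pf vs (\<lambda>a. bits (X a)) I3"
    "pf vs (\<lambda>a. bits (X a)) I4" "pf vs (\<lambda>a. bits (X a)) I5"
    "pf vs (\<lambda>a. bits (X a)) J1" "pf vs (\<lambda>a. bits (X a)) J2" "pf vs (\<lambda>a. bits (X a)) J3"
    "pf vs (\<lambda>a. bits (X a)) J4" "pf vs (\<lambda>a. bits (X a)) J5"
  shows "pf vs (\<lambda>a. bits (X a)) (\<lambda>a. of_bool (gate_rule M (X a) (B a) (T a)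
    (G1 a, G2 a, G3 a, G4 a, G5 a) (I1 a, I2 a, I3 a, I4 a, I5 a) (J1 a, J2 a, J3 a, J4 a, J5 a)))"
  unfolding gate_rule_def prod.case init_rule_symb prod.inject
  by (rule assms pf_all_rules | (rule pf_var, simp; fail) | rule pf_lift)+

lemma pf_machine_quadratics:
  assumes "pf vs (\<lambda>a. bits (X a)) B" "pf vs (\<lambda>a. bits (X a)) T" "pf vs (\<lambda>a. bits (X a)) R"
    "pf vs (\<lambda>a. bits (X a)) G" "pf vs (\<lambda>a. bits (X a)) I" "pf vs (\<lambda>a. bits (X a)) J"
  shows "pf vs (\<lambda>a. bits (X a)) (\<lambda>a. of_bool (machine_quadratics M (X a) (B a) (T a) (R a) (G a) (I a) (J a)))"
  unfolding machine_quadratics_def gate_of_def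
  by (rule pf_gate_rule; (rule assms pf_all_rules)+)

text \<open>Rounds up to a power of two. Each round below \<open>m\<close> gains at least one, so
  \<open>m\<close> rounds suffice, and stopping at \<open>m\<close> keeps the values linear in
  \<open>m\<close>.\<close>

definition pow2ge :: "nat \<Rightarrow> nat" where
  "pow2ge m = ((\<lambda>s. if s < m then 2 * s else s) ^^ m) 1"

lemma pow2ge_iter:
  fixes m :: nat
  defines "f \<equiv> \<lambda>s. if s < m then 2 * s else s"
  shows "(f ^^ i) 1 \<le> 2 * m + 1 \<and> min m (Suc i) \<le> (f ^^ i) 1 \<and> (\<exists>r. (f ^^ i) 1 = 2 ^ r)"
proof (induction i)
  case 0
  then show ?case by (auto intro: exI[of _ 0])
next
  case (Suc i)
  let ?s = "(f ^^ i) 1"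
  have "\<exists>r. 2 * ?s = 2 ^ r" using Suc by (metis power_Suc)
  then show ?case using Suc by (auto simp: f_def)
qed

lemma pow2ge: "m \<le> pow2ge m" "\<exists>r. pow2ge m = 2 ^ r"
  using pow2ge_iter[of m m] by (simp_all add: pow2ge_def)

lemma pf_pow2ge:
  assumes "pf vs W A"
  shows "pf vs W (\<lambda>a. pow2ge (A a))"
  unfolding pow2ge_def
proof (rule pf_funpow[where f = "\<lambda>a s. if s < A a then 2 * s else s" and z = "\<lambda>_. 1" and n = A
      and B = "\<lambda>a. 2 * A a + 1"])
  show "pf (snd # map (\<lambda>v p. v (fst p)) vs) (\<lambda>p. W (fst p)) (\<lambda>p. if snd p < A (fst p) then 2 * snd p else snd p)"
    by (rule assms pf_all_rules | (rule pf_var, simp; fail) | rule pf_lift)+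
  show "pf vs W (\<lambda>a. 2 * A a + 1)" by (rule assms pf_all_rules)+
qed (use pow2ge_iter assms pf_const in \<open>blast+\<close>)

section \<open>Encodings of instances\<close>

lemma encode_nat_rec: "0 < n \<Longrightarrow> encode_nat n = odd n # encode_nat (n div 2)"
  and encode_nat_0: "encode_nat 0 = []"
  by (simp_all add: encode_nat.simps)

lemma encode_nat_nth: "i < length (encode_nat d) \<Longrightarrow> encode_nat d ! i = odd (d div 2 ^ i)"
proof (induction d arbitrary: i rule: less_induct)
  case (less d)
  then have "0 < d" by (cases "d = 0") (simp_all add: encode_nat_0)
  then show ?case
    using less.prems less.IH[of "d div 2" "i - 1"]
    by (cases i) (simp_all add: encode_nat_rec div_mult2_eq)
qed

text \<open>Turns the recursion into a bounded sum; taking \<open>N = d\<close> makes the length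
  computable by the rules for sums.\<close>

lemma length_encode_nat: "d \<le> N \<Longrightarrow> length (encode_nat d) = (\<Sum>i<N. of_bool (d div 2 ^ i \<noteq> 0))"
proof (induction d arbitrary: N rule: less_induct)
  case (less d)
  show ?case
  proof (cases "d = 0")
    case True
    then show ?thesis by (simp add: encode_nat_0)
  next
    case False
    then obtain N' where N: "N = Suc N'" using less.prems by (cases N) auto
    have "(\<Sum>i<N. of_bool (d div 2 ^ i \<noteq> 0)) = 1 + (\<Sum>i<N'. of_bool (d div 2 div 2 ^ i \<noteq> 0))"
      using False unfolding N by (simp only: sum.lessThan_Suc_shift) (simp add: div_mult2_eq)
    also have "\<dots> = 1 + length (encode_nat (d div 2))"
    proof -
      have "d div 2 \<le> N'" using less.prems N False by linarith
      then show ?thesis using less.IH[of "d div 2" N'] False by simp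
    qed
    finally show ?thesis using False by (simp add: encode_nat_rec)
  qed
qed

lemma encode_nat_inj: "encode_nat d = encode_nat d' \<Longrightarrow> d = d'"
proof (induction d arbitrary: d' rule: less_induct)
  case (less d)
  show ?case
  proof (cases "d = 0")
    case True
    then show ?thesis using less.prems encode_nat_rec[of d'] by (cases "d' = 0") (simp_all add: encode_nat_0)
  next
    case False
    then have d': "0 < d'" using less.prems encode_nat_rec[of d] by (cases "d' = 0") (simp_all add: encode_nat_0)
    then have "odd d = odd d'" "encode_nat (d div 2) = encode_nat (d' div 2)"
      using less.prems False by (simp_all add: encode_nat_rec)
    moreover have "d div 2 = d' div 2" using less.IH[of "d div 2" "d' div 2"] False calculation(2) by simp
    ultimately show ?thesis by (metis odd_two_times_div_two_succ even_two_times_div_two)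
  qed
qed

definition inst_len :: "nat \<Rightarrow> nat \<Rightarrow> nat" where
  "inst_len n d = n + 2 + n * n + length (encode_nat d)"

text \<open>Position \<open>n\<close> ends the unary part and position \<open>n + 1 + n * n\<close>
  is the sign, false because the bound is a natural number here.\<close>

definition inst_bit :: "nat \<Rightarrow> (nat \<Rightarrow> nat \<Rightarrow> bool) \<Rightarrow> nat \<Rightarrow> nat \<Rightarrow> bool" where
  "inst_bit n adj d i \<longleftrightarrow>
     (if i < n then True else if i = n then False
      else if i < n + 1 + n * n then adj ((i - (n + 1)) div n) ((i - (n + 1)) mod n)
      else if i = n + 1 + n * n then False else odd (d div 2 ^ (i - (n + 2 + n * n))))"

lemma length_matrix: "length (concat (map (\<lambda>i. map (f i) [0..<n]) [0..<m])) = m * n"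
  by (induction m) simp_all

lemma nth_matrix:
  "k < m * n \<Longrightarrow> concat (map (\<lambda>i. map (f i) [0..<n]) [0..<m]) ! k = f (k div n) (k mod n)"
proof (induction m)
  case (Suc m)
  show ?case
  proof (cases "k < m * n")
    case True
    then show ?thesis using Suc by (simp add: nth_append length_matrix)
  next
    case False
    then have k: "k = m * n + (k - m * n)" "k - m * n < n" using Suc.prems by simp_all
    have "k div n = m" "k mod n = k - m * n"
      using div_mod_build[OF k(2), of m] k(1) by simp_all
    then show ?thesis using False k(2) by (simp add: nth_append length_matrix)
  qed
qed simp

lemma encode_instance_eq:
  assumes "verts G = {..<n}" "\<And>i j. i < n \<Longrightarrow> j < n \<Longrightarrow> {i, j} \<in> edges G \<longleftrightarrow> adj i j"
  shows "encode_instance G (int d) = map (inst_bit n adj d) [0..<inst_len n d]"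
proof (rule nth_equalityI)
  let ?m = "concat (map (\<lambda>i. map (\<lambda>j. {i, j} \<in> edges G) [0..<n]) [0..<n])"
  have e: "encode_instance G (int d) = replicate n True @ False # ?m @ False # encode_nat d"
    using assms(1) by (simp add: encode_instance_def encode_graph_def encode_int_def)
  show len: "length (encode_instance G (int d)) = length (map (inst_bit n adj d) [0..<inst_len n d])"
    by (simp add: e length_matrix inst_len_def)
  fix i assume "i < length (encode_instance G (int d))"
  then have i: "i < inst_len n d" using len by simp
  consider "i \<le> n" | k where "i = n + 1 + k" "k < n * n" | k where "i = n + 1 + n * n + k"
    by (metis add.assoc le_Suc_ex not_le_imp_less nat_le_linear add_less_cancel_left less_eq_Suc_le Suc_eq_plus1)
  then have "(replicate n True @ False # ?m @ False # encode_nat d) ! i = inst_bit n adj d i"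
  proof cases
    case 1
    then show ?thesis by (cases "i = n") (simp_all add: nth_append inst_bit_def)
  next
    case 2
    have "0 < n" using 2(2) by (cases n) simp_all
    then have "k div n < n" "k mod n < n" using 2(2) by (simp_all add: less_mult_imp_div_less)
    then show ?thesis using 2 assms(2)
      by (simp add: nth_append length_matrix nth_matrix inst_bit_def del: nth_Cons_Suc)
  next
    case 3
    show ?thesis
    proof (cases k)
      case 0
      then show ?thesis using 3 by (simp add: nth_append length_matrix inst_bit_def)
    next
      case (Suc k')
      have "k' < length (encode_nat d)" using 3 Suc i by (simp add: inst_len_def)
      then show ?thesis using 3 Suc by (simp add: nth_append length_matrix inst_bit_def encode_nat_nth)
    qed
  qed
  then show "encode_instance G (int d) ! i = map (inst_bit n adj d) [0..<inst_len n d] ! i"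
    using i by (simp add: e)
qed


text \<open>The unary prefix is self-delimiting and fixes \<open>n\<close>, hence where the matrix
  ends. The matrix fixes the edges because both vertex sets are \<open>{..<n}\<close>, and the rest
  is an injective encoding of the bound.\<close>

lemma encode_instance_inj:
  assumes G: "simple_graph G" "verts G = {..<n}" and G': "simple_graph G'" "verts G' = {..<n'}"
    and eq: "encode_instance G d = encode_instance (G' :: nat graph) d'"
  shows "G = G' \<and> d = d'"
proof -
  let ?m = "\<lambda>n G. concat (map (\<lambda>i. map (\<lambda>j. {i, j} \<in> edges G) [0..<n]) [0..<n])"
  have e: "replicate n True @ False # ?m n G @ encode_int d = replicate n' True @ False # ?m n' G' @ encode_int d'"
    using eq G(2) G'(2) by (simp add: encode_instance_def encode_graph_def)
  have tw: "takeWhile id (replicate m True @ False # r) = replicate m True" for m r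
    by (induction m) simp_all
  have "takeWhile id (replicate n True @ False # ?m n G @ encode_int d) =
      takeWhile id (replicate n' True @ False # ?m n' G' @ encode_int d')" by (simp only: e)
  then have "length (replicate n True) = length (replicate n' True)" by (simp only: tw)
  then have n: "n' = n" by simp
  have "?m n G @ encode_int d = ?m n G' @ encode_int d'" using e unfolding n by simp
  then have m: "?m n G = ?m n G'" and i: "encode_int d = encode_int d'"
    using append_eq_append_conv[of "?m n G" "?m n G'"] by (simp_all add: length_matrix)
  have adj: "{i, j} \<in> edges G \<longleftrightarrow> {i, j} \<in> edges G'" if "i < n" "j < n" for i j
  proof -
    have "?m n G ! (i * n + j) = ?m n G' ! (i * n + j)" by (simp only: m)
    moreover have "?m n H ! (i * n + j) \<longleftrightarrow> {i, j} \<in> edges H" for H :: "nat graph"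
      using nth_matrix[OF index_less[OF that], of "\<lambda>i j. {i, j} \<in> edges H"] that by simp
    ultimately show ?thesis by (simp only:)
  qed
  have "edges G = edges G'"
  proof (intro equalityI subsetI)
    fix e assume "e \<in> edges G"
    moreover obtain u v where "u < n" "v < n" "e = {u, v}"
      using G \<open>e \<in> edges G\<close> by (auto simp: simple_graph_def)
    ultimately show "e \<in> edges G'" using adj by blast
  next
    fix e assume "e \<in> edges G'"
    moreover obtain u v where "u < n" "v < n" "e = {u, v}"
      using G' n \<open>e \<in> edges G'\<close> by (auto simp: simple_graph_def)
    ultimately show "e \<in> edges G" using adj by blast
  qed
  then have "G = G'" using G(2) G'(2) n by (intro graph.equality) simp_all
  moreover have "d = d'"
  proof -
    have "(d < 0) = (d' < 0)" "nat \<bar>d\<bar> = nat \<bar>d'\<bar>"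
      using i encode_nat_inj by (auto simp: encode_int_def)
    then show ?thesis by linarith
  qed
  ultimately show ?thesis by blast
qed

section \<open>The reduction\<close>

definition red_B :: "nat poly \<Rightarrow> bool list \<Rightarrow> nat" where
  "red_B p x = poly p (length x)"

text \<open>The time bound for the longest admissible certificate; shorter runs idle in the halting
  state up to this time.\<close>

definition red_T :: "nat poly \<Rightarrow> nat poly \<Rightarrow> bool list \<Rightarrow> nat" where
  "red_T p pt x = poly pt (length x + 1 + red_B p x)"

text \<open>The sum of all lower bounds that the gate numbering imposes, rounded up so that the
  number \<open>red_n\<close> of gates is a power of two, as the code requires.\<close>

definition red_R :: "tm \<Rightarrow> nat poly \<Rightarrow> nat poly \<Rightarrow> bool list \<Rightarrow> nat" where
  "red_R M p pt x = pow2ge (2 * red_T p pt x + 2 + rule_count M + (num_tapes M + 1) + num_symbols M + red_B p x)"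

definition red_n :: "tm \<Rightarrow> nat poly \<Rightarrow> nat poly \<Rightarrow> bool list \<Rightarrow> nat" where
  "red_n M p pt x = 8 * (red_R M p pt x * (red_R M p pt x * (red_R M p pt x * red_R M p pt x)))"

definition red_col :: "tm \<Rightarrow> nat poly \<Rightarrow> nat poly \<Rightarrow> bool list \<Rightarrow> nat \<Rightarrow> nat \<Rightarrow> bool" where
  "red_col M p pt x b r = column (red_n M p pt x)
     (machine_quadratics M x (red_B p x) (red_T p pt x) (red_R M p pt x)) b
     (r div red_n M p pt x) (r mod red_n M p pt x)"

definition red_k :: "tm \<Rightarrow> nat poly \<Rightarrow> nat poly \<Rightarrow> bool list \<Rightarrow> nat" where
  "red_k M p pt x = threshold (red_n M p pt x) + 2"

definition red_graph :: "tm \<Rightarrow> nat poly \<Rightarrow> nat poly \<Rightarrow> bool list \<Rightarrow> nat graph" where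
  "red_graph M p pt x = gadget_graph (red_k M p pt x) (red_n M p pt x * red_n M p pt x)
     (num_columns (red_n M p pt x)) (red_col M p pt x)"

definition red_size :: "tm \<Rightarrow> nat poly \<Rightarrow> nat poly \<Rightarrow> bool list \<Rightarrow> nat" where
  "red_size M p pt x = gadget_size (red_k M p pt x) (red_n M p pt x * red_n M p pt x)
     (num_columns (red_n M p pt x))"

definition red_arc :: "tm \<Rightarrow> nat poly \<Rightarrow> nat poly \<Rightarrow> bool list \<Rightarrow> nat \<Rightarrow> nat \<Rightarrow> bool" where
  "red_arc M p pt x = arc (red_k M p pt x) (red_n M p pt x * red_n M p pt x) (red_col M p pt x)"

text \<open>One less than the threshold, since a local set of size \<open>d + 1\<close> corresponds
  to degree \<open>d\<close>.\<close>

definition red_d :: "tm \<Rightarrow> nat poly \<Rightarrow> nat poly \<Rightarrow> bool list \<Rightarrow> nat" where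
  "red_d M p pt x = threshold (red_n M p pt x) - 1"

lemma pf_red_B: "pf vs (\<lambda>a. bits (X a)) (\<lambda>a. red_B p (X a))"
  unfolding red_B_def length_bits[symmetric] by (rule pf_poly, rule pf_length)

lemma pf_red_T: "pf vs (\<lambda>a. bits (X a)) (\<lambda>a. red_T p pt (X a))"
  unfolding red_T_def length_bits[symmetric] by (rule pf_red_B pf_all_rules)+

lemma pf_red_R: "pf vs (\<lambda>a. bits (X a)) (\<lambda>a. red_R M p pt (X a))"
  unfolding red_R_def by (rule pf_pow2ge pf_red_B pf_red_T pf_all_rules)+

lemma pf_red_n: "pf vs (\<lambda>a. bits (X a)) (\<lambda>a. red_n M p pt (X a))"
  unfolding red_n_def by (rule pf_red_R pf_all_rules)+

lemma pf_red_k: "pf vs (\<lambda>a. bits (X a)) (\<lambda>a. red_k M p pt (X a))"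
  unfolding red_k_def by (rule pf_threshold pf_red_n pf_all_rules)+

lemma pf_red_size: "pf vs (\<lambda>a. bits (X a)) (\<lambda>a. red_size M p pt (X a))"
  unfolding red_size_def by (rule pf_gadget_size pf_num_columns pf_red_n pf_red_k pf_all_rules)+

lemma pf_red_d: "pf vs (\<lambda>a. bits (X a)) (\<lambda>a. red_d M p pt (X a))"
  unfolding red_d_def by (rule pf_threshold pf_red_n pf_all_rules)+

lemma pf_red_col:
  assumes "pf vs (\<lambda>a. bits (X a)) A" "pf vs (\<lambda>a. bits (X a)) B"
  shows "pf vs (\<lambda>a. bits (X a)) (\<lambda>a. of_bool (red_col M p pt (X a) (A a) (B a)))"
  unfolding red_col_def
  by (rule pf_column pf_machine_quadratics pf_red_n pf_red_B pf_red_T pf_red_R assms pf_all_rules | assumption)+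

lemma pf_red_arc:
  assumes "pf vs (\<lambda>a. bits (X a)) A" "pf vs (\<lambda>a. bits (X a)) B"
  shows "pf vs (\<lambda>a. bits (X a)) (\<lambda>a. of_bool (red_arc M p pt (X a) (A a) (B a)))"
  unfolding red_arc_def
  by (rule pf_arc pf_red_col pf_red_n pf_red_k assms pf_all_rules | assumption)+

lemma pf_inst_bit:
  assumes adj: "\<And>A B. pf vs W A \<Longrightarrow> pf vs W B \<Longrightarrow> pf vs W (\<lambda>a. of_bool (adj a (A a) (B a)))"
    and "pf vs W N" "pf vs W D" "pf vs W I"
  shows "pf vs W (\<lambda>a. of_bool (inst_bit (N a) (adj a) (D a) (I a)))"
  unfolding inst_bit_def by (rule assms(2-4) adj pf_all_rules)+

lemma pf_inst_len:
  assumes "pf vs W N" "pf vs W D"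
  shows "pf vs W (\<lambda>a. inst_len (N a) (D a))"
  unfolding inst_len_def length_encode_nat[OF order_refl]
  by (rule assms pf_all_rules | (rule pf_var, simp; fail) | rule pf_lift)+

definition reduction :: "tm \<Rightarrow> nat poly \<Rightarrow> nat poly \<Rightarrow> bool list \<Rightarrow> bool list" where
  "reduction M p pt x = encode_instance (red_graph M p pt x) (int (red_d M p pt x))"

lemma red_k_pos: "0 < red_k M p pt x"
  by (simp add: red_k_def)

lemma red_graph_props:
  "simple_graph (red_graph M p pt x)" "bipartite (red_graph M p pt x)"
  "verts (red_graph M p pt x) = {..<red_size M p pt x}"
  unfolding red_graph_def red_size_def
  by (rule simple_G[OF red_k_pos], rule bipartite_G[OF red_k_pos], rule verts_G[OF red_k_pos])

lemma red_size_pos: "0 < red_size M p pt x"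
proof -
  have "0 < 2 * red_T p pt x + 2 + rule_count M + (num_tapes M + 1) + num_symbols M + red_B p x" by simp
  also have "\<dots> \<le> red_R M p pt x" unfolding red_R_def by (rule pow2ge(1))
  finally show ?thesis by (simp add: red_size_def gadget_size_def red_n_def)
qed

lemma reduction_polytime: "polytime_fun (reduction M p pt)"
proof -
  let ?bt = "\<lambda>x. inst_bit (red_size M p pt x) (\<lambda>i j. red_arc M p pt x i j \<or> red_arc M p pt x j i) (red_d M p pt x)"
  let ?len = "\<lambda>x. inst_len (red_size M p pt x) (red_d M p pt x)"
  have red: "reduction M p pt x = map (?bt x) [0..<?len x]" for x
    unfolding reduction_def
  proof (rule encode_instance_eq[OF red_graph_props(3)])
    fix i j assume "i < red_size M p pt x" "j < red_size M p pt x"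
    then show "{i, j} \<in> edges (red_graph M p pt x) \<longleftrightarrow> red_arc M p pt x i j \<or> red_arc M p pt x j i"
      by (auto simp: red_graph_def gadget_graph_def red_size_def red_arc_def doubleton_eq_iff)
  qed
  have okw: "okw (bits x)" for x by (auto simp: okw_def bits_def)
  have "polytime bits (\<lambda>x. map (\<lambda>i. if ?bt x i then 2 else 1) [0..<?len x])"
  proof (rule polytimeI[OF _ _ okw])
    show "pf [] bits ?len"
      using pf_inst_len[OF pf_red_size[of "[]" "\<lambda>x. x"] pf_red_d[of "[]" "\<lambda>x. x"]] .
    show "pf [snd] (\<lambda>p. bits (fst p)) (\<lambda>q. of_bool (?bt (fst q) (snd q)))"
      by (rule pf_inst_bit pf_red_size pf_red_d pf_red_arc pf_disj | assumption | (rule pf_var, simp; fail))+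
  qed
  moreover have "bits (reduction M p pt x) = map (\<lambda>i. if ?bt x i then 2 else 1) [0..<?len x]" for x
    by (simp add: red bits_def)
  ultimately show ?thesis by (simp add: polytime_fun_def)
qed

text \<open>The halted configuration persists until time \<open>T\<close>, and the answer true is
  written as the symbol \<open>2\<close> in cell \<open>0\<close> of the output tape.\<close>

lemma accepts_iff:
  assumes M: "wf_tm M" and out: "outputs_within M (pair (x, z)) t (bits [r])" and t: "t \<le> T"
  shows "r \<longleftrightarrow> fst (tape_at M (pair (x, z)) T 1) 0 = 2"
proof -
  obtain ts where ts: "(step M ^^ t) (init_config M (pair (x, z))) = (1, ts)" "fst (ts ! 1) 0 = (if r then 2 else 1)"
    using out by (auto simp: outputs_within_def bits_def split: prod.splits)
  have "(step M ^^ T) (init_config M (pair (x, z))) = (step M ^^ (T - t)) ((step M ^^ t) (init_config M (pair (x, z))))"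
    using t funpow_add[of "T - t" t "step M"] by simp
  then have "cfg M (pair (x, z)) T = (1, ts)" by (simp only: cfg_def ts(1) halted)
  then show ?thesis using ts(2) by (simp add: tape_at_def[OF M pair_less_4])
qed

definition local_min_degree_problem :: language where
  "local_min_degree_problem = {encode_instance G d | (G :: nat graph) (d :: int).
     simple_graph G \<and> (\<exists>n \<ge> 1. verts G = {..<n}) \<and> bipartite G \<and> int (local_min_degree G) \<le> d}"

lemma reduction_correct:
  assumes M: "wf_tm M"
    and out: "\<And>y. outputs_within M (pair (x, y)) (poly pt (length (pair (x, y)))) (bits [R x y])"
  shows "(\<exists>y. length y \<le> poly p (length x) \<and> R x y) \<longleftrightarrow> reduction M p pt x \<in> local_min_degree_problem"
proof -
  define B T Rr n where d: "B = red_B p x" "T = red_T p pt x" "Rr = red_R M p pt x" "n = red_n M p pt x"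
  have Rr: "2 * T + 2 + rule_count M + (num_tapes M + 1) + num_symbols M + B \<le> Rr"
    unfolding d red_R_def by (rule pow2ge(1))
  obtain r where r: "Rr = 2 ^ r" unfolding d red_R_def using pow2ge(2) by blast
  have n: "n = 2 ^ (3 + 4 * r)"
  proof -
    have "n = 2 ^ 3 * (2 ^ r * (2 ^ r * (2 ^ r * 2 ^ r)))" by (simp add: d(4) red_n_def d(3)[symmetric] r)
    also have "\<dots> = 2 ^ (3 + (r + (r + (r + r))))" by (simp only: power_add)
    also have "3 + (r + (r + (r + r))) = 3 + 4 * r" by simp
    finally show ?thesis .
  qed
  have n0: "0 < n" by (simp add: n)
  \<comment> \<open>Guards the truncated subtraction in \<open>red_d\<close>.\<close>
  have K: "1 \<le> threshold n" using n0 by (simp add: threshold_def Suc_le_eq)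
  have "R x y \<longleftrightarrow> fst (tape_at M (pair (x, y)) T 1) 0 = 2" if "length y \<le> B" for y
  proof (rule accepts_iff[OF M out])
    have "length (pair (x, y)) = length x + 1 + length y" by (simp add: pair_def bits_def)
    then show "poly pt (length (pair (x, y))) \<le> T"
      unfolding d(2) red_T_def using that by (intro poly_mono_nat) (simp add: d(1))
  qed
  then have "(\<exists>y. length y \<le> B \<and> R x y) \<longleftrightarrow> (\<exists>y. length y \<le> B \<and> fst (tape_at M (pair (x, y)) T 1) 0 = 2)"
    by blast
  also have "\<dots> \<longleftrightarrow> (\<exists>Y. quadratic_solution n (machine_quadratics M x B T Rr) Y)"
    unfolding d(4) red_n_def d(3)[symmetric]
    by (rule machine_quadratics_iff[symmetric, OF M]) (use Rr in linarith)+
  also have "\<dots> \<longleftrightarrow> (\<exists>D \<subseteq> {..<n * n}. D \<noteq> {} \<and> card D + card {b. b < num_columns n \<and>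
      odd (card {r \<in> D. red_col M p pt x b r})} \<le> threshold n)"
    unfolding red_col_def d[symmetric] by (rule quadratic_solution_iff[OF n]) simp
  also have "\<dots> \<longleftrightarrow> local_set_le (red_graph M p pt x) (threshold n)"
    unfolding red_graph_def d(4)[symmetric]
    by (rule gadget_local_set[symmetric, OF red_k_pos]) (simp add: red_k_def d(4)[symmetric])
  also have "\<dots> \<longleftrightarrow> local_min_degree (red_graph M p pt x) \<le> red_d M p pt x"
  proof -
    have "verts (red_graph M p pt x) \<noteq> {}" using red_size_pos[of M p pt x] by (auto simp: red_graph_props(3))
    then show ?thesis
      using local_min_degree_le_iff[OF red_graph_props(1), of M p pt x "red_d M p pt x"] K
      by (simp add: red_d_def d(4)[symmetric])
  qed
  also have "\<dots> \<longleftrightarrow> reduction M p pt x \<in> local_min_degree_problem"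
  proof
    assume "local_min_degree (red_graph M p pt x) \<le> red_d M p pt x"
    then show "reduction M p pt x \<in> local_min_degree_problem"
      unfolding local_min_degree_problem_def reduction_def
      using red_graph_props red_size_pos[of M p pt x] by (fastforce simp: Suc_le_eq)
  next
    assume "reduction M p pt x \<in> local_min_degree_problem"
    then obtain G d n' where G: "simple_graph G" "verts G = {..<n'}" "int (local_min_degree G) \<le> d"
      "encode_instance (red_graph M p pt x) (int (red_d M p pt x)) = encode_instance G d"
      unfolding local_min_degree_problem_def reduction_def by blast
    \<comment> \<open>Membership only provides some instance with this encoding; injectivity
      identifies it with the constructed one.\<close>
    have "red_graph M p pt x = G \<and> int (red_d M p pt x) = d"
      by (rule encode_instance_inj[OF red_graph_props(1,3) G(1,2,4)])
    then show "local_min_degree (red_graph M p pt x) \<le> red_d M p pt x" using G(3) by simp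
  qed
  finally show ?thesis by (simp only: d(1) red_B_def)
qed

theorem local_min_degree_NP_hard:
  assumes "in_NP L"
  shows "polytime_reducible L local_min_degree_problem"
proof -
  obtain R p where R: "polytime_rel R" "\<And>x. x \<in> L \<longleftrightarrow> (\<exists>y. length y \<le> poly p (length x) \<and> R x y)"
    using assms unfolding in_NP_def by blast
  obtain M pt where M: "wf_tm M"
    "\<And>a. outputs_within M (pair a) (poly pt (length (pair a))) ((\<lambda>(x, y). bits [R x y]) a)"
    using R(1) unfolding polytime_rel_def polytime_def by blast
  have "x \<in> L \<longleftrightarrow> reduction M p pt x \<in> local_min_degree_problem" for x
    unfolding R(2) by (rule reduction_correct[OF M(1)]) (use M(2) in fastforce)
  then show ?thesis unfolding polytime_reducible_def using reduction_polytime by blast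
qed

section \<open>Membership in NP\<close>

definition bits_val :: "bool list \<Rightarrow> nat" where
  "bits_val bs = foldr (\<lambda>b v. 2 * v + of_bool b) bs 0"

lemma bits_val_Cons: "bits_val (b # bs) = 2 * bits_val bs + of_bool b" and bits_val_Nil: "bits_val [] = 0"
  by (simp_all add: bits_val_def)

lemma bits_val_encode: "bits_val (encode_nat d) = d"
proof (induction d rule: less_induct)
  case (less d)
  show ?case
  proof (cases "d = 0")
    case False
    then show ?thesis using less[of "d div 2"] by (simp add: encode_nat_rec bits_val_Cons)
  qed (simp add: encode_nat_0 bits_val_Nil)
qed

text \<open>The most significant digit stands last, so the condition excludes exactly the words with
  trailing zeros, which encode nothing.\<close>

lemma encode_bits_val: "bs = [] \<or> last bs \<Longrightarrow> encode_nat (bits_val bs) = bs"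
proof (induction bs)
  case (Cons b bs)
  show ?case
  proof (cases "bs = []")
    case True
    then show ?thesis using Cons.prems encode_nat_rec[of 1] by (simp add: bits_val_Cons bits_val_Nil encode_nat_0)
  next
    case False
    then have IH: "encode_nat (bits_val bs) = bs" using Cons by simp
    have "bits_val bs \<noteq> 0" using IH False encode_nat_0 by metis
    then show ?thesis using IH encode_nat_rec[of "2 * bits_val bs + of_bool b"] by (simp add: bits_val_Cons)
  qed
qed (simp add: bits_val_Nil encode_nat_0)

lemma last_encode_nat: "0 < d \<Longrightarrow> encode_nat d \<noteq> [] \<and> last (encode_nat d)"
proof (induction d rule: less_induct)
  case (less d)
  show ?case
  proof (cases "d div 2 = 0")
    case True
    then have "d = 1" using less.prems by linarith
    then show ?thesis by (simp add: encode_nat_rec encode_nat_0)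
  next
    case False
    then show ?thesis using less.IH[of "d div 2"] less.prems by (simp add: encode_nat_rec)
  qed
qed

text \<open>Recognizes encodings with a nonnegative bound, which suffices as local minimum degrees
  are nonnegative. The last conjunct excludes trailing zeros in the bound.\<close>

definition wf_inst :: "bool list \<Rightarrow> nat \<Rightarrow> bool" where
  "wf_inst x n \<longleftrightarrow> 1 \<le> n \<and> n + 2 + n * n \<le> length x \<and> (\<forall>i<n. x ! i) \<and> \<not> x ! n \<and> \<not> x ! (n + 1 + n * n) \<and>
     (n + 2 + n * n < length x \<longrightarrow> x ! (length x - 1))"

lemma wf_inst_encode:
  assumes "1 \<le> n" and x: "x = map (inst_bit n adj d) [0..<inst_len n d]"
  shows "wf_inst x n" "drop (n + 2 + n * n) x = encode_nat d"
    "i < n \<Longrightarrow> j < n \<Longrightarrow> x ! (n + 1 + (i * n + j)) \<longleftrightarrow> adj i j"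
proof -
  have len: "length x = n + 2 + n * n + length (encode_nat d)" by (simp add: x inst_len_def)
  have nth: "x ! i = inst_bit n adj d i" if "i < length x" for i using that by (simp add: x)
  show dr: "drop (n + 2 + n * n) x = encode_nat d"
  proof (rule nth_equalityI)
    fix i assume "i < length (drop (n + 2 + n * n) x)"
    then have i: "i < length (encode_nat d)" by (simp add: len)
    then have "drop (n + 2 + n * n) x ! i = inst_bit n adj d (n + 2 + n * n + i)"
      using nth[of "n + 2 + n * n + i"] by (simp add: len)
    also have "\<dots> = encode_nat d ! i" using i by (simp add: inst_bit_def encode_nat_nth)
    finally show "drop (n + 2 + n * n) x ! i = encode_nat d ! i" .
  qed (simp add: len)
  have "x ! (length x - 1)" if "n + 2 + n * n < length x"
  proof -
    have ne: "encode_nat d \<noteq> []" using that len by auto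
    then have "0 < d" using encode_nat_0 by (cases "d = 0") auto
    then have "last (drop (n + 2 + n * n) x)" unfolding dr using last_encode_nat by blast
    moreover have "last (drop (n + 2 + n * n) x) = last x" by (rule last_drop[OF that])
    moreover have "last x = x ! (length x - 1)" by (rule last_conv_nth) (use that in auto)
    ultimately show ?thesis by blast
  qed
  then show "wf_inst x n"
    unfolding wf_inst_def using assms(1) nth by (simp add: len inst_bit_def)
  show "x ! (n + 1 + (i * n + j)) \<longleftrightarrow> adj i j" if ij: "i < n" "j < n"
  proof -
    have k: "i * n + j < n * n" by (rule index_less[OF ij])
    have "(i * n + j) div n = i" "(i * n + j) mod n = j" using ij by simp_all
    then show ?thesis using k nth[of "n + 1 + (i * n + j)"] by (simp add: len inst_bit_def)
  qed
qed

lemma wf_inst_decode: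
  assumes "wf_inst x n"
  defines "d \<equiv> bits_val (drop (n + 2 + n * n) x)"
  shows "x = map (inst_bit n (\<lambda>i j. x ! (n + 1 + (i * n + j))) d) [0..<inst_len n d]"
proof (rule nth_equalityI)
  let ?t = "drop (n + 2 + n * n) x"
  have x: "1 \<le> n" "n + 2 + n * n \<le> length x" "\<forall>i<n. x ! i" "\<not> x ! n" "\<not> x ! (n + 1 + n * n)"
    "n + 2 + n * n < length x \<Longrightarrow> x ! (length x - 1)"
    using assms(1) by (simp_all add: wf_inst_def)
  have "?t = [] \<or> last ?t"
  proof (cases "n + 2 + n * n < length x")
    case True
    then have "last ?t = last x" by (rule last_drop)
    moreover have "last x = x ! (length x - 1)" by (rule last_conv_nth) (use True in auto)
    ultimately show ?thesis using x(6)[OF True] by blast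
  qed simp
  then have t: "encode_nat d = ?t" unfolding d_def by (rule encode_bits_val)
  show len: "length x = length (map (inst_bit n (\<lambda>i j. x ! (n + 1 + (i * n + j))) d) [0..<inst_len n d])"
    using x(2) by (simp add: inst_len_def t)
  fix i assume i: "i < length x"
  have "x ! i = inst_bit n (\<lambda>i j. x ! (n + 1 + (i * n + j))) d i"
  proof (cases "i < n + 2 + n * n")
    case True
    show ?thesis
      unfolding inst_bit_def using True x by (auto simp: less_Suc_eq)
  next
    case False
    then obtain k where k: "i = n + 2 + n * n + k" using le_Suc_ex not_less by blast
    have "k < length (encode_nat d)" using i k by (simp add: t)
    then have "odd (d div 2 ^ k) = ?t ! k" using encode_nat_nth[of k d] by (simp add: t)
    also have "\<dots> = x ! i" using x(2) k by simp
    finally show ?thesis using k by (simp add: inst_bit_def)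
  qed
  then show "x ! i = map (inst_bit n (\<lambda>i j. x ! (n + 1 + (i * n + j))) d) [0..<inst_len n d] ! i"
    using i len by simp
qed

text \<open>The bound is binary and its value may be exponential, so it is evaluated from the most
  significant digit on and cut at \<open>n\<close> after every digit; doubling commutes with this
  cut as far as the minimum with \<open>n\<close> is concerned.\<close>

definition capval :: "(nat \<Rightarrow> bool) \<Rightarrow> nat \<Rightarrow> nat \<Rightarrow> nat \<Rightarrow> nat" where
  "capval f n l m = rec_nat 0 (\<lambda>k v. min n (2 * v + of_bool (f (l - 1 - k)))) m"

lemma capval_eq:
  assumes "\<And>i. i < length x \<Longrightarrow> f i \<longleftrightarrow> x ! i" "m \<le> length x"
  shows "capval f n (length x) m = min n (bits_val (drop (length x - m) x))"
  using assms(2)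
proof (induction m)
  case 0
  then show ?case by (simp add: capval_def bits_val_Nil)
next
  case (Suc m)
  let ?i = "length x - Suc m"
  have d: "drop ?i x = x ! ?i # drop (length x - m) x"
    using Suc.prems Cons_nth_drop_Suc[of ?i x] by (simp add: Suc_diff_Suc)
  have "capval f n (length x) (Suc m) = min n (2 * capval f n (length x) m + of_bool (x ! ?i))"
    using assms(1)[of ?i] Suc.prems by (simp add: capval_def)
  also have "\<dots> = min n (bits_val (drop ?i x))"
    unfolding d bits_val_Cons using Suc by (simp add: min_def)
  finally show ?case .
qed

text \<open>The number of positions before the first separator, that is, the length of the instance
  within a pair.\<close>

definition xlen :: "nat list \<Rightarrow> nat" where
  "xlen w = (\<Sum>i<length w. of_bool (\<forall>j<i + 1. symb w j \<noteq> 3))"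

text \<open>The certificate consists of the indicator of \<open>D\<close> followed by that of one side of the bipartition.\<close>

definition check :: "nat list \<Rightarrow> bool" where
  "check w \<longleftrightarrow> (\<exists>n<xlen w. 1 \<le> n \<and> n + 2 + n * n \<le> xlen w \<and>
     (\<forall>i<n. symb w i = 2) \<and> symb w n \<noteq> 2 \<and> symb w (n + 1 + n * n) \<noteq> 2 \<and>
     (n + 2 + n * n < xlen w \<longrightarrow> symb w (xlen w - 1) = 2) \<and>
     (\<forall>i<n. symb w (n + 1 + (i * n + i)) \<noteq> 2) \<and>
     (\<forall>i<n. \<forall>j<n. symb w (n + 1 + (i * n + j)) = 2 \<longrightarrow> symb w (n + 1 + (j * n + i)) = 2 \<and>
        (symb w (xlen w + 1 + (n + i)) = 2) \<noteq> (symb w (xlen w + 1 + (n + j)) = 2)) \<and>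
     (\<exists>i<n. symb w (xlen w + 1 + i) = 2) \<and>
     (\<Sum>v<n. of_bool (symb w (xlen w + 1 + v) = 2 \<or>
         odd (\<Sum>u<n. of_bool (symb w (xlen w + 1 + u) = 2 \<and> symb w (n + 1 + (v * n + u)) = 2) :: nat)))
       \<le> capval (\<lambda>i. symb w i = 2) n (xlen w) (xlen w - (n + 2 + n * n)) + 1)"

lemma sum_of_bool_card: "(\<Sum>i<m. of_bool (P i) :: nat) = card ({..<m :: nat} \<inter> {i. P i})"
  by (simp add: sum.If_cases of_bool_def)

lemma pf_xlen: "pf vs W (\<lambda>a. xlen (W a))"
  unfolding xlen_def by (rule pf_all_rules | (rule pf_var, simp; fail) | rule pf_lift)+

lemma pf_capval:
  assumes "pf vs W N" "pf vs W L" "pf vs W M"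
  shows "pf vs W (\<lambda>a. capval (\<lambda>i. symb (W a) i = 2) (N a) (L a) (M a))"
  unfolding capval_def min_def
proof (rule pf_rec_nat[where B = N and n = M and z = "\<lambda>_. 0"
      and f = "\<lambda>a k v. if N a \<le> 2 * v + of_bool (symb (W a) (L a - 1 - k) = 2) then N a
        else 2 * v + of_bool (symb (W a) (L a - 1 - k) = 2)"])
  show "pf ((\<lambda>p. fst (snd p)) # (\<lambda>p. snd (snd p)) # map (\<lambda>v p. v (fst p)) vs) (\<lambda>p. W (fst p))
      (\<lambda>p. if N (fst p) \<le> 2 * snd (snd p) + of_bool (symb (W (fst p)) (L (fst p) - 1 - fst (snd p)) = 2) then N (fst p)
        else 2 * snd (snd p) + of_bool (symb (W (fst p)) (L (fst p) - 1 - fst (snd p)) = 2))"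
    by (rule assms pf_all_rules | (rule pf_var, simp; fail) | rule pf_lift2)+
  show "pbd (sz vs W) N" by (rule pf_pbd[OF assms(1)])
  fix a i
  show "rec_nat 0 (\<lambda>k v. if N a \<le> 2 * v + of_bool (symb (W a) (L a - 1 - k) = 2) then N a
        else 2 * v + of_bool (symb (W a) (L a - 1 - k) = 2)) i \<le> N a"
    by (cases i) simp_all
qed (rule assms pf_const)+

lemma pf_check: "pf vs W (\<lambda>a. of_bool (check (W a)))"
  unfolding check_def
  by (rule pf_all_rules pf_xlen pf_capval | (rule pf_var, simp; fail) | rule pf_lift)+

lemma symb_pair_x: "i < length x \<Longrightarrow> symb (pair (x, y)) i = (if x ! i then 2 else 1)"
  by (simp add: symb_def pair_def bits_def nth_append)

lemma xlen_pair: "xlen (pair (x, y)) = length x"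
proof -
  let ?w = "pair (x, y)"
  have lw: "length ?w = length x + 1 + length y" by (simp add: pair_def bits_def)
  have s3: "symb ?w (length x) = 3" by (simp add: symb_def pair_def bits_def nth_append)
  have "(\<forall>j<i + 1. symb ?w j \<noteq> 3) \<longleftrightarrow> i < length x" for i
  proof
    assume h: "\<forall>j<i + 1. symb ?w j \<noteq> 3"
    show "i < length x"
    proof (rule ccontr)
      assume "\<not> i < length x"
      then show False using h s3 by auto
    qed
  next
    assume "i < length x"
    then show "\<forall>j<i + 1. symb ?w j \<noteq> 3" using symb_pair_x[of _ x y] by auto
  qed
  then have "xlen ?w = (\<Sum>i<length x + 1 + length y. of_bool (i < length x))"
    unfolding xlen_def lw by simp
  also have "\<dots> = card ({..<length x + 1 + length y} \<inter> {i. i < length x})" by (rule sum_of_bool_card)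
  also have "{..<length x + 1 + length y} \<inter> {i. i < length x} = {..<length x}" by auto
  finally show ?thesis by simp
qed

text \<open>Missing certificate bits read as the blank and hence count as false, so the verifier
  need not test the length of \<open>y\<close>.\<close>

lemma symb_pair_y: "symb (pair (x, y)) (length x + 1 + v) = 2 \<longleftrightarrow> v < length y \<and> y ! v"
  by (auto simp: symb_def pair_def bits_def nth_append)

lemma odd_nb_matrix:
  fixes G :: "nat graph"
  assumes G: "simple_graph G" "verts G = {..<n}" and D: "D = {v. v < n \<and> P v}"
    and E: "\<And>i j. i < n \<Longrightarrow> j < n \<Longrightarrow> {i, j} \<in> edges G \<longleftrightarrow> E i j"
  shows "card (D \<union> odd_nb G D) =
    (\<Sum>v<n. of_bool (P v \<or> odd (\<Sum>u<n. of_bool (P u \<and> E v u) :: nat)))"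
proof -
  have "v \<in> odd_nb G D \<longleftrightarrow> odd (\<Sum>u<n. of_bool (P u \<and> E v u) :: nat)" if v: "v < n" for v
  proof -
    have "neighborhood G v \<inter> D = {..<n} \<inter> {u. P u \<and> E v u}"
      using E[OF v] by (auto simp: neighborhood_def D)
    moreover have "(\<Sum>u<n. of_bool (P u \<and> E v u) :: nat) = card ({..<n} \<inter> {u. P u \<and> E v u})"
      by (rule sum_of_bool_card)
    ultimately show ?thesis unfolding odd_nb_def mem_Collect_eq by (simp only:)
  qed
  moreover have "odd_nb G D \<subseteq> {..<n}" using odd_nb_subset[OF G(1)] by (simp add: G(2))
  ultimately have "D \<union> odd_nb G D = {..<n} \<inter> {v. P v \<or> odd (\<Sum>u<n. of_bool (P u \<and> E v u) :: nat)}"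
    by (auto simp: D)
  then show ?thesis by (simp only: sum_of_bool_card)
qed

text \<open>Replaces tape symbols by list entries. Two bounds disappear on the way:
  \<open>n < length x\<close> follows from \<open>wf_inst\<close>, and the cap on the bound is
  harmless.\<close>

lemma check_pair_iff:
  "check (pair (x, y)) \<longleftrightarrow> (\<exists>n. wf_inst x n \<and>
     (\<forall>i<n. \<not> x ! (n + 1 + (i * n + i))) \<and>
     (\<forall>i<n. \<forall>j<n. x ! (n + 1 + (i * n + j)) \<longrightarrow> x ! (n + 1 + (j * n + i)) \<and>
        (n + i < length y \<and> y ! (n + i)) \<noteq> (n + j < length y \<and> y ! (n + j))) \<and>
     (\<exists>i<n. i < length y \<and> y ! i) \<and>
     (\<Sum>v<n. of_bool (v < length y \<and> y ! v \<or>
         odd (\<Sum>u<n. of_bool ((u < length y \<and> y ! u) \<and> x ! (n + 1 + (v * n + u))) :: nat)))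
       \<le> bits_val (drop (n + 2 + n * n) x) + 1)"
    (is "_ \<longleftrightarrow> (\<exists>n. ?P n)")
proof -
  let ?w = "pair (x, y)"
  have sx: "symb ?w i = 2 \<longleftrightarrow> x ! i" if "i < length x" for i using symb_pair_x[OF that] by simp
  let ?Q = "\<lambda>n. 1 \<le> n \<and> n + 2 + n * n \<le> length x \<and>
     (\<forall>i<n. symb ?w i = 2) \<and> symb ?w n \<noteq> 2 \<and> symb ?w (n + 1 + n * n) \<noteq> 2 \<and>
     (n + 2 + n * n < length x \<longrightarrow> symb ?w (length x - 1) = 2) \<and>
     (\<forall>i<n. symb ?w (n + 1 + (i * n + i)) \<noteq> 2) \<and>
     (\<forall>i<n. \<forall>j<n. symb ?w (n + 1 + (i * n + j)) = 2 \<longrightarrow> symb ?w (n + 1 + (j * n + i)) = 2 \<and>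
        (symb ?w (length x + 1 + (n + i)) = 2) \<noteq> (symb ?w (length x + 1 + (n + j)) = 2)) \<and>
     (\<exists>i<n. symb ?w (length x + 1 + i) = 2) \<and>
     (\<Sum>v<n. of_bool (symb ?w (length x + 1 + v) = 2 \<or>
         odd (\<Sum>u<n. of_bool (symb ?w (length x + 1 + u) = 2 \<and> symb ?w (n + 1 + (v * n + u)) = 2) :: nat)))
       \<le> capval (\<lambda>i. symb ?w i = 2) n (length x) (length x - (n + 2 + n * n)) + 1"
  have QP: "?Q n \<longleftrightarrow> ?P n" for n
  proof (cases "1 \<le> n \<and> n + 2 + n * n \<le> length x")
    case True
    have idx: "n + 1 + (i * n + j) < length x" if "i < n" "j < n" for i j
      using index_less[OF that] True by linarith
    have s: "(\<Sum>u<n. of_bool ((u < length y \<and> y ! u) \<and> symb ?w (n + 1 + (v * n + u)) = 2) :: nat) =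
        (\<Sum>u<n. of_bool ((u < length y \<and> y ! u) \<and> x ! (n + 1 + (v * n + u))))" if "v < n" for v
      by (rule sum.cong) (use sx[OF idx[OF that]] in auto)
    have c: "(\<Sum>v<n. of_bool (symb ?w (length x + 1 + v) = 2 \<or>
         odd (\<Sum>u<n. of_bool (symb ?w (length x + 1 + u) = 2 \<and> symb ?w (n + 1 + (v * n + u)) = 2) :: nat)) :: nat) =
        (\<Sum>v<n. of_bool (v < length y \<and> y ! v \<or>
         odd (\<Sum>u<n. of_bool ((u < length y \<and> y ! u) \<and> x ! (n + 1 + (v * n + u))) :: nat)) :: nat)" (is "_ = ?c")
      by (rule sum.cong[OF refl]) (simp only: lessThan_iff s symb_pair_y)
    have cap: "capval (\<lambda>i. symb ?w i = 2) n (length x) (length x - (n + 2 + n * n)) =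
        min n (bits_val (drop (n + 2 + n * n) x))"
      using capval_eq[of x "\<lambda>i. symb ?w i = 2" "length x - (n + 2 + n * n)" n] sx True by simp
    have "?c \<le> (\<Sum>v<n. 1)" by (rule sum_mono) simp
    then have "?c \<le> n" by simp
    \<comment> \<open>The set has at most \<open>n\<close> vertices, so comparing with the capped
      bound gives the same answer.\<close>
    then have le: "?c \<le> min n v + 1 \<longleftrightarrow> ?c \<le> v + 1" for v by linarith
    have 1: "(\<forall>i<n. symb ?w i = 2) \<longleftrightarrow> (\<forall>i<n. x ! i)" using sx True by auto
    have 2: "symb ?w n = 2 \<longleftrightarrow> x ! n" "symb ?w (n + 1 + n * n) = 2 \<longleftrightarrow> x ! (n + 1 + n * n)"
      "symb ?w (length x - 1) = 2 \<longleftrightarrow> x ! (length x - 1)"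
      by (rule sx, use True in linarith)+
    have 3: "(\<forall>i<n. symb ?w (n + 1 + (i * n + i)) \<noteq> 2) \<longleftrightarrow> (\<forall>i<n. \<not> x ! (n + 1 + (i * n + i)))"
      using sx[OF idx] by blast
    have 4: "(\<forall>i<n. \<forall>j<n. symb ?w (n + 1 + (i * n + j)) = 2 \<longrightarrow> symb ?w (n + 1 + (j * n + i)) = 2 \<and> Z i j) \<longleftrightarrow>
        (\<forall>i<n. \<forall>j<n. x ! (n + 1 + (i * n + j)) \<longrightarrow> x ! (n + 1 + (j * n + i)) \<and> Z i j)" for Z
      using sx[OF idx] by blast
    show ?thesis
      unfolding c cap le unfolding wf_inst_def 1 2 3 4 symb_pair_y using True by (simp only: conj_assoc simp_thms)
  next
    case False
    then show ?thesis unfolding wf_inst_def by blast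
  qed
  have ch: "check ?w \<longleftrightarrow> (\<exists>n<length x. ?Q n)" unfolding check_def xlen_pair ..
  have bound: "n < length x" if "?P n" for n using that by (simp add: wf_inst_def)
  have bounded_ex: "(\<And>n. Q n \<longleftrightarrow> P n) \<Longrightarrow> (c \<longleftrightarrow> (\<exists>n<l. Q n)) \<Longrightarrow> (\<And>n. P n \<Longrightarrow> n < l) \<Longrightarrow> c \<longleftrightarrow> (\<exists>n. P n)"
    for Q P and c :: bool and l :: nat by blast
  show ?thesis by (rule bounded_ex[where Q = ?Q and P = ?P, OF QP ch bound])
qed

theorem local_min_degree_in_NP: "in_NP local_min_degree_problem"
proof -
  let ?R = "\<lambda>x y. check (pair (x, y))"
  have rel: "polytime_rel ?R"
  proof -
    have okw: "okw (pair a)" for a by (cases a) (auto simp: okw_def pair_def bits_def)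
    have "polytime pair (\<lambda>a. map (\<lambda>i. if check (pair a) then 2 else 1) [0..<1])"
    proof (rule polytimeI[where bt = "\<lambda>a i. check (pair a)" and len = "\<lambda>_. 1", OF _ _ okw])
      show "pf [] pair (\<lambda>_. 1)" by (rule pf_const)
      show "pf [snd] (\<lambda>p. pair (fst p)) (\<lambda>p. of_bool (check (pair (fst p))))" by (rule pf_check)
    qed
    moreover have "(\<lambda>a. map (\<lambda>i. if check (pair a) then 2 else 1) [0..<1]) = (\<lambda>(x, y). bits [?R x y])"
      by (auto simp: bits_def)
    ultimately show ?thesis by (simp only: polytime_rel_def)
  qed
  \<comment> \<open>A certificate consists of two indicators of \<open>n\<close> bits each, and
    \<open>n \<le> length x\<close> because \<open>n\<close> is given in unary.\<close>
  have "x \<in> local_min_degree_problem \<longleftrightarrow> (\<exists>y. length y \<le> poly [:0, 2:] (length x) \<and> ?R x y)" for x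
  proof
    assume "x \<in> local_min_degree_problem"
    then obtain G d n where G: "simple_graph G" "1 \<le> n" "verts G = {..<n}" "bipartite G"
      "int (local_min_degree G) \<le> d" "x = encode_instance G d"
      unfolding local_min_degree_problem_def by blast
    obtain d' where d': "d = int d'" using G(5) by (metis nonneg_int_cases of_nat_0_le_iff order_trans)
    define adj where "adj i j \<longleftrightarrow> {i, j} \<in> edges G" for i j
    have xe: "x = map (inst_bit n adj d') [0..<inst_len n d']"
      unfolding G(6) d' by (rule encode_instance_eq[OF G(3)]) (simp add: adj_def)
    note wi = wf_inst_encode[OF G(2) xe]
    have "verts G \<noteq> {}" using G(2,3) by (auto simp: lessThan_empty_iff)
    then have "local_set_le G (d' + 1)"
      using local_min_degree_le_iff[OF G(1), of d'] G(5) d' by simp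
    then obtain D where D: "D \<noteq> {}" "D \<subseteq> {..<n}" "card (D \<union> odd_nb G D) \<le> d' + 1"
      by (auto simp: local_set_le_def G(3))
    obtain A C where AC: "A \<union> C = {..<n}" "A \<inter> C = {}" "\<forall>e \<in> edges G. \<exists>a \<in> A. \<exists>b \<in> C. e = {a, b}"
      using G(4) unfolding bipartite_def G(3) by blast
    define y where "y = map (\<lambda>v. v \<in> D) [0..<n] @ map (\<lambda>v. v \<in> A) [0..<n]"
    have y1: "v < length y \<and> y ! v \<longleftrightarrow> v \<in> D" if "v < n" for v
      using that by (simp add: y_def nth_append)
    have y2: "n + v < length y \<and> y ! (n + v) \<longleftrightarrow> v \<in> A" if "v < n" for v
      using that by (simp add: y_def nth_append)
    have "?R x y"
      unfolding check_pair_iff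
    proof (rule exI[of _ n], intro conjI allI impI)
      show "wf_inst x n" by (rule wi(1))
      have ne: "i \<noteq> j" if "adj i j" for i j
        using that G(1) by (fastforce simp: adj_def simple_graph_def doubleton_eq_iff)
      show "\<not> x ! (n + 1 + (i * n + i))" if "i < n" for i using wi(3)[OF that that] ne by blast
      fix i j assume ij: "i < n" "j < n" "x ! (n + 1 + (i * n + j))"
      have a: "adj i j" using wi(3)[OF ij(1,2)] ij(3) by blast
      then have "adj j i" by (simp add: adj_def insert_commute)
      then show "x ! (n + 1 + (j * n + i))" using wi(3)[OF ij(2,1)] by blast
      obtain a b where "a \<in> A" "b \<in> C" "{i, j} = {a, b}" using AC(3) a by (auto simp: adj_def)
      then have "(i \<in> A) \<noteq> (j \<in> A)" using AC(2) by (auto simp: doubleton_eq_iff)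
      then show "(n + i < length y \<and> y ! (n + i)) \<noteq> (n + j < length y \<and> y ! (n + j))"
        unfolding y2[OF ij(1)] y2[OF ij(2)] .
    next
      obtain v where "v \<in> D" using D(1) by blast
      then show "\<exists>i<n. i < length y \<and> y ! i" using D(2) y1 by blast
    next
      have "D = {v. v < n \<and> (v < length y \<and> y ! v)}" using D(2) y1 by auto
      from G(1,3) this have "card (D \<union> odd_nb G D) = (\<Sum>v<n. of_bool (v < length y \<and> y ! v \<or>
         odd (\<Sum>u<n. of_bool ((u < length y \<and> y ! u) \<and> x ! (n + 1 + (v * n + u))) :: nat)))"
        by (rule odd_nb_matrix) (simp only: wi(3) adj_def)
      then show "(\<Sum>v<n. of_bool (v < length y \<and> y ! v \<or>
         odd (\<Sum>u<n. of_bool ((u < length y \<and> y ! u) \<and> x ! (n + 1 + (v * n + u))) :: nat)))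
       \<le> bits_val (drop (n + 2 + n * n) x) + 1"
        using D(3) unfolding wi(2) bits_val_encode by (simp only:)
    qed
    moreover have "length y \<le> poly [:0, 2:] (length x)"
      using wi(1) by (simp add: y_def wf_inst_def)
    ultimately show "\<exists>y. length y \<le> poly [:0, 2:] (length x) \<and> ?R x y" by blast
  next
    assume "\<exists>y. length y \<le> poly [:0, 2:] (length x) \<and> ?R x y"
    then obtain y n where wf: "wf_inst x n" and irr: "\<forall>i<n. \<not> x ! (n + 1 + (i * n + i))"
      and adj: "\<forall>i<n. \<forall>j<n. x ! (n + 1 + (i * n + j)) \<longrightarrow> x ! (n + 1 + (j * n + i)) \<and>
        (n + i < length y \<and> y ! (n + i)) \<noteq> (n + j < length y \<and> y ! (n + j))"
      and ne: "\<exists>i<n. i < length y \<and> y ! i"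
      and c: "(\<Sum>v<n. of_bool (v < length y \<and> y ! v \<or>
         odd (\<Sum>u<n. of_bool ((u < length y \<and> y ! u) \<and> x ! (n + 1 + (v * n + u))) :: nat)))
         \<le> bits_val (drop (n + 2 + n * n) x) + 1"
      unfolding check_pair_iff by blast
    define E where "E i j \<longleftrightarrow> x ! (n + 1 + (i * n + j))" for i j
    define d where "d = bits_val (drop (n + 2 + n * n) x)"
    \<comment> \<open>The checked symmetry and empty diagonal of the matrix make this a simple graph
      whose encoding is \<open>x\<close> again.\<close>
    define G :: "nat graph" where "G = \<lparr>verts = {..<n}, edges = {{i, j} | i j. i < n \<and> j < n \<and> E i j}\<rparr>"
    have n1: "1 \<le> n" using wf by (simp add: wf_inst_def)
    have vG: "verts G = {..<n}" by (simp add: G_def)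
    have eG: "{i, j} \<in> edges G \<longleftrightarrow> E i j" if "i < n" "j < n" for i j
      using that adj by (auto simp: G_def E_def doubleton_eq_iff)
    have sG: "simple_graph G"
    proof -
      have "i \<noteq> j" if "i < n" "E i j" for i j using that irr by (auto simp: E_def)
      then show ?thesis by (fastforce simp: simple_graph_def G_def)
    qed
    have bG: "bipartite G"
      unfolding bipartite_def
    proof (intro exI conjI ballI)
      let ?A = "{v. v < n \<and> (n + v < length y \<and> y ! (n + v))}"
      let ?B = "{v. v < n \<and> \<not> (n + v < length y \<and> y ! (n + v))}"
      show "?A \<union> ?B = verts G" by (auto simp: vG)
      show "?A \<inter> ?B = {}" by auto
      fix e assume "e \<in> edges G"
      then obtain i j where ij: "e = {i, j}" "i < n" "j < n" "E i j" by (auto simp: G_def)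
      then have "i \<in> ?A \<and> j \<in> ?B \<or> j \<in> ?A \<and> i \<in> ?B" using adj unfolding E_def by blast
      then show "\<exists>a \<in> ?A. \<exists>b \<in> ?B. e = {a, b}" using ij(1) by (auto simp: insert_commute)
    qed
    have "encode_instance G (int d) = map (inst_bit n E d) [0..<inst_len n d]"
      by (rule encode_instance_eq[OF vG eG])
    also have "\<dots> = x"
      using wf_inst_decode[OF wf] unfolding d_def E_def[abs_def] by (rule sym)
    finally have x: "x = encode_instance G (int d)" by (rule sym)
    define D where "D = {v. v < n \<and> (v < length y \<and> y ! v)}"
    from sG vG D_def eG have "card (D \<union> odd_nb G D) =
        (\<Sum>v<n. of_bool ((v < length y \<and> y ! v) \<or> odd (\<Sum>u<n. of_bool ((u < length y \<and> y ! u) \<and> E v u) :: nat)))"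
      by (rule odd_nb_matrix)
    then have "card (D \<union> odd_nb G D) \<le> d + 1" using c unfolding E_def d_def by (simp only:)
    moreover have "D \<noteq> {}" "D \<subseteq> {..<n}" using ne by (auto simp: D_def)
    ultimately have "local_set_le G (d + 1)" unfolding local_set_le_def vG by blast
    moreover have "verts G \<noteq> {}" using n1 by (auto simp: vG lessThan_empty_iff)
    ultimately have "local_min_degree G \<le> d" using local_min_degree_le_iff[OF sG] by blast
    then have "int (local_min_degree G) \<le> int d" by simp
    then show "x \<in> local_min_degree_problem"
      unfolding local_min_degree_problem_def using x sG vG bG n1 by blast
  qed
  then show ?thesis unfolding in_NP_def using rel by blast
qed

theorem theorem4:
  shows "NP_complete
    {encode_instance G d | (G :: nat graph) (d :: int).
       simple_graph G \<and> (\<exists>n \<ge> 1. verts G = {..<n}) \<and> bipartite G \<and>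
       int (local_min_degree G) \<le> d}"
  unfolding NP_complete_def local_min_degree_problem_def[symmetric]
  using local_min_degree_in_NP local_min_degree_NP_hard by blast

end
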